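(* Let $Y=\mathrm{TV}(\Sigma)$ be a smooth, complete toric surface, let $R\in M$ be primitive, and let $\pi:X\to\mathbb{A}^1$ be the deformation of $Y$ associated to an integer $\lambda_0$ and an admissible tuple $a\in\{-1,1\}^{m+2}$ (equivalently, to an admissible subdivision decomposition of $\Xi_0$). Then the image of $\pi$ in $H^1(Y,\mathcal{T}_Y)$ under the Kodaira-Spencer map is the class of the Čech cocycle induced by the sections $d_{i-1,i}\in\Gamma(\mathrm{TV}(\rho_i),\mathcal{T}_Y)$, $1\le i\le l$, where $$d_{i-1,i}=\begin{cases}0&\text{if } i\notin\{m+2,l\}\text{ and }a_i=a_{i-1},\\[2pt] a_{i-1}(\lambda_{i-1}-\lambda_i)\,xy^{-1}\dfrac{\partial}{\partial x}&\text{if } i\in\{m+2,l\}\text{ and }a_i=a_{i-1},\\[6pt] a_{i-1}\left((\lambda_i+\lambda_{i-1})\,xy^{-1}\dfrac{\partial}{\partial x}+\dfrac{\partial}{\partial y}\right)&\text{if } a_i\neq a_{i-1}.\end{cases}$$ In particular, the deformation is homogeneous of degree $[0,-1]=-R$.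
   Context: Everything is over $\mathbb{C}$. Fan and slice. $N$ is a rank $2$ lattice with dual $M$, and $\Sigma$ is a complete smooth fan on $N_\mathbb{Q}$ with rays $\rho_1,\dots,\rho_l$ numbered counterclockwise, indices modulo $l$ ($\rho_0=\rho_l$, $\rho_{l+1}=\rho_1$); $\nu(\rho_i)$ is the minimal lattice generator of $\rho_i$. Choose a basis of $N$ such that $R=[0,1]$ in the dual basis of $M$; write $x=\chi^{[1,0]}$, $y=\chi^{[0,1]}$, so $\chi^{[r,s]}=x^ry^s$. Let $\Xi_0=\Sigma\cap\{v\in N_\mathbb{Q}:\langle v,R\rangle=1\}$, regarded as a polyhedral subdivision of $\mathbb{Q}$ by taking $(0,1)$ as origin (the point $(p,1)$ corresponds to $p\in\mathbb{Q}$; lattice points are the integers). Its segments are $\Delta_0^0,\dots,\Delta_0^{m+1}$, ordered with $\Delta_0^i\ge\Delta_0^{i+1}$ (from right to left), so $\Delta_0^0$ and $\Delta_0^{m+1}$ are half-lines and the others are bounded. The rays are numbered so that $\rho_1$ passes through $\Delta_0^0\cap\Delta_0^1$; hence $\rho_i$ passes through $\Delta_0^{i-1}\cap\Delta_0^i$ for $1\le i\le m+1$. Decompositions. A subdivision decomposition of $\Xi_0$ consists of sets $\{\widetilde\Delta_0^0,\dots,\widetilde\Delta_0^{m+1}\}$ and $\{\widetilde\Delta_t^0,\dots,\widetilde\Delta_t^{m+1}\}$ of polyhedra in $\mathbb{Q}$, each ordered decreasingly and covering $\mathbb{Q}$, with $\Delta_0^i=\widetilde\Delta_0^i+\widetilde\Delta_t^i$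 for all $i$; it is admissible if for each $1\le i\le m$ either $\widetilde\Delta_0^i$ or $\widetilde\Delta_t^i$ is a lattice point. Admissible decompositions are encoded by an integer $\lambda_0$ and a tuple $a=(a_0,\dots,a_{m+1})\in\{-1,1\}^{m+2}$ that is admissible, meaning that $\Delta_0^i\cap\Delta_0^{i+1}$ is a lattice point for every $0\le i\le m$ with $a_i\ne a_{i+1}$. The integers $\lambda_1,\dots,\lambda_{m+1}$ are determined by $\lambda_{i+1}=\lambda_i$ if $a_{i+1}=a_i$, and $\lambda_i+\lambda_{i+1}=\Delta_0^i\cap\Delta_0^{i+1}$ if $a_{i+1}\neq a_i$. The decomposition satisfies $\Delta_0^i=\widetilde\Delta_0^i+\lambda_i$ if $a_i=1$ and $\Delta_0^i=\widetilde\Delta_t^i+\lambda_i$ if $a_i=-1$. For $m+1<i<l$ put $a_i=1$, $\lambda_i=0$. Indices are read modulo $l$, so $a_l=a_0$, $\lambda_l=\lambda_0$. The family. Let $\sigma_i\in\Sigma$ be the cone spanned by $\rho_i,\rho_{i+1}$. Let $w_i^1=[r_i^1,s_i^1]$, $w_i^2=[r_i^2,s_i^2]$ be the positively oriented minimal lattice generators of $\sigma_i^\vee$ (so $w_i^1$ vanishes on $\rho_{i+1}$, $w_i^2$ vanishes on $\rho_i$, and $w_i^1=-w_{i+1}^2$). Then $\mathrm{TV}(\sigma_i)=\operatorname{Spec}A_i$ with $A_i=\mathbb{C}[\sigma_i^\vee\cap M]=\mathbb{C}[Z_{i,1},Z_{i,2}]$, $Z_{i,j}=x^{r_i^j}y^{s_i^j}$.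 For $0\le i\le l-1$ and $j\in\{1,2\}$ define, in $\mathbb{C}(x,y,t)$, $$\widetilde Z_{i,j}=\begin{cases}x^{r_i^j}y^{s_i^j+\lambda_ir_i^j}(y-t)^{-\lambda_ir_i^j}&\text{if }a_i=1,\\ x^{r_i^j}y^{-\lambda_ir_i^j}(y-t)^{s_i^j+\lambda_ir_i^j}&\text{if }a_i=-1,\end{cases}$$ and let $\widetilde A_i=\mathbb{C}[t,\widetilde Z_{i,1},\widetilde Z_{i,2}]$ for $0\le i\le m+1$, and $\widetilde A_i=\mathbb{C}[t,\widetilde Z_{i,1},\widetilde Z_{i,2},y(y-t)^{-1}]$ for $m+1<i\le l-1$. The scheme $X$ is obtained by identifying, for all $0\le i,j<l$, $\operatorname{Spec}\widetilde A_i$ with $\operatorname{Spec}\widetilde A_j$ along all open subsets $\operatorname{Spec}B$, where $B\subset\mathbb{C}(x,y,t)$ is a localization of both $\widetilde A_i$ and $\widetilde A_j$; $\pi:X\to\mathbb{A}^1=\operatorname{Spec}\mathbb{C}[t]$ is glued from the maps given by $\mathbb{C}[t]\subset\widetilde A_i$. It is a one-parameter deformation of $Y$ (a flat family with $\pi^{-1}(0)=Y$). Kodaira-Spencer map and Čech conventions. $\mathcal{T}_Y$ is the tangent sheaf. Čech cocycles are taken with respect to the affine invariant open covering $\{\mathrm{TV}(\tau):\tau\in\Sigma^{(2)}\}=\{\mathrm{TV}(\sigma_i)\}_i$ ($\Sigma^{(2)}$ being the two-dimensional cones), where $\mathrm{TV}(\sigma_{i-1})\cap\mathrm{TV}(\sigma_i)=\mathrm{TV}(\rho_i)$;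 a cocycle is determined by its sections on $\mathrm{TV}(\rho_i)$, $1\le i\le l$. The Kodaira-Spencer class of $\pi$ is computed from the restriction of $\pi$ to $\operatorname{Spec}\mathbb{C}[t]/t^2$: given trivializations $\theta_i^\#:\widetilde A_i\otimes\mathbb{C}[t]/t^2\to A_i\otimes\mathbb{C}[t]/t^2$ over $\mathbb{C}[t]/t^2$ that are the identity modulo $t$, it is the class of the cocycle $(d_{i,j})$ defined on overlaps by $\theta_j^\#(\theta_i^\#)^{-1}=\mathrm{id}+t\cdot d_{i,j}$. $H^1(Y,\mathcal{T}_Y)$ is $M$-graded, with $\chi^u$ times a torus-invariant vector field having degree $u$; the deformation is called homogeneous of degree $u$ if its Kodaira-Spencer class lies in $H^1(Y,\mathcal{T}_Y)(u)$. *)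

theory Defs
  imports
    Complex_Main
    "HOL-Computational_Algebra.Polynomial"
    "HOL-Computational_Algebra.Fraction_Field"
    "HOL-Library.Product_Plus"
begin

section \<open>Fans in the plane\<close>

text \<open>
  In the chosen basis of the lattice, \<open>N\<close> and its dual \<open>M\<close> are both \<open>int \<times> int\<close>, and
  the rational vector space \<open>N \<otimes> \<rat>\<close> is \<open>rat \<times> rat\<close>.
\<close>

type_synonym lattice = "int \<times> int"
type_synonym rat_plane = "rat \<times> rat"

definition pairing :: "lattice \<Rightarrow> rat_plane \<Rightarrow> rat" where
  "pairing w v = of_int (fst w) * fst v + of_int (snd w) * snd v"

definition det2 :: "lattice \<Rightarrow> lattice \<Rightarrow> int" where
  "det2 v w = fst v * snd w - snd v * fst w"

definition primitive :: "lattice \<Rightarrow> bool" where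
  "primitive v \<longleftrightarrow> coprime (fst v) (snd v)"

definition cone_gen :: "lattice set \<Rightarrow> rat_plane set" where
  "cone_gen G = {((\<Sum>v\<in>G. c v * of_int (fst v)), (\<Sum>v\<in>G. c v * of_int (snd v))) | c.
     \<forall>v\<in>G. c v \<ge> (0::rat)}"

definition strongly_convex_cone :: "rat_plane set \<Rightarrow> bool" where
  "strongly_convex_cone C \<longleftrightarrow>
     (\<exists>G. finite G \<and> C = cone_gen G) \<and> (\<forall>v. v \<in> C \<and> - v \<in> C \<longrightarrow> v = 0)"

definition dual_monoid :: "rat_plane set \<Rightarrow> lattice set" where
  "dual_monoid C = {w. \<forall>v\<in>C. pairing w v \<ge> 0}"

definition face_of_cone :: "rat_plane set \<Rightarrow> rat_plane set \<Rightarrow> bool" where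
  "face_of_cone F C \<longleftrightarrow> (\<exists>w\<in>dual_monoid C. F = {v \<in> C. pairing w v = 0})"

definition fan :: "rat_plane set set \<Rightarrow> bool" where
  "fan \<Sigma> \<longleftrightarrow> finite \<Sigma> \<and> \<Sigma> \<noteq> {} \<and> (\<forall>C\<in>\<Sigma>. strongly_convex_cone C) \<and>
     (\<forall>C\<in>\<Sigma>. \<forall>F. face_of_cone F C \<longrightarrow> F \<in> \<Sigma>) \<and>
     (\<forall>C\<in>\<Sigma>. \<forall>C'\<in>\<Sigma>. face_of_cone (C \<inter> C') C \<and> face_of_cone (C \<inter> C') C')"

definition complete_fan :: "rat_plane set set \<Rightarrow> bool" where
  "complete_fan \<Sigma> \<longleftrightarrow> \<Union>\<Sigma> = UNIV"

definition smooth_fan :: "rat_plane set set \<Rightarrow> bool" where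
  "smooth_fan \<Sigma> \<longleftrightarrow>
     (\<forall>C\<in>\<Sigma>. \<exists>b1 b2 G. \<bar>det2 b1 b2\<bar> = 1 \<and> G \<subseteq> {b1, b2} \<and> C = cone_gen G)"

definition rays :: "rat_plane set set \<Rightarrow> rat_plane set set" where
  "rays \<Sigma> = {C \<in> \<Sigma>. \<exists>v. v \<noteq> 0 \<and> C = cone_gen {v}}"

text \<open>
  \<open>\<nu> i\<close> is the minimal generator of the ray \<open>\<rho>\<^sub>i\<close>; the index is read modulo \<open>l\<close>, the
  ray with index \<open>0\<close> being the ray with index \<open>l\<close>.
\<close>

definition ccw_ray_generators :: "rat_plane set set \<Rightarrow> nat \<Rightarrow> (nat \<Rightarrow> lattice) \<Rightarrow> bool" where
  "ccw_ray_generators \<Sigma> l \<nu> \<longleftrightarrow>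
     (\<forall>i. \<nu> (i + l) = \<nu> i) \<and> (\<forall>i. primitive (\<nu> i)) \<and>
     bij_betw (\<lambda>i. cone_gen {\<nu> i}) {1..l} (rays \<Sigma>) \<and>
     (\<forall>i. det2 (\<nu> i) (\<nu> (Suc i)) > 0 \<and> cone_gen {\<nu> i, \<nu> (Suc i)} \<in> \<Sigma>)"

definition chart_cone :: "(nat \<Rightarrow> lattice) \<Rightarrow> nat \<Rightarrow> rat_plane set" where
  "chart_cone \<nu> i = cone_gen {\<nu> i, \<nu> (Suc i)}"

section \<open>The slice and the admissible tuples\<close>

definition R_deg :: lattice where
  "R_deg = (0, 1)"

definition slice :: "rat_plane set \<Rightarrow> rat set" where
  "slice C = {fst v | v. v \<in> C \<and> pairing R_deg v = 1}"

definition slice_subdivision :: "rat_plane set set \<Rightarrow> rat set set" where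
  "slice_subdivision \<Sigma> = slice ` \<Sigma> - {{}}"

definition slice_segments ::
    "rat_plane set set \<Rightarrow> nat \<Rightarrow> (nat \<Rightarrow> rat set) \<Rightarrow> bool" where
  "slice_segments \<Sigma> m \<Delta> \<longleftrightarrow>
     bij_betw \<Delta> {0..Suc m} {S \<in> slice_subdivision \<Sigma>. \<not> is_singleton S} \<and>
     (\<forall>i\<le>m. \<forall>p\<in>\<Delta> i. \<forall>q\<in>\<Delta> (Suc i). q \<le> p)"

definition lattice_point :: "rat set \<Rightarrow> bool" where
  "lattice_point S \<longleftrightarrow> (\<exists>k::int. S = {of_int k})"

text \<open>The tuple consists of the values of \<open>a\<close> at \<open>0, \<dots>, m + 1\<close>.\<close>

definition admissible_tuple :: "nat \<Rightarrow> (nat \<Rightarrow> rat set) \<Rightarrow> (nat \<Rightarrow> int) \<Rightarrow> bool" where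
  "admissible_tuple m \<Delta> a \<longleftrightarrow> (\<forall>i\<le>Suc m. a i \<in> {-1, 1}) \<and>
     (\<forall>i\<le>m. a i \<noteq> a (Suc i) \<longrightarrow> lattice_point (\<Delta> i \<inter> \<Delta> (Suc i)))"

text \<open>
  The integers \<open>\<lambda>\<^sub>i\<close> (here \<open>lam i\<close>) determined by \<open>\<lambda>\<^sub>0\<close> and the tuple, together with the
  conventions for the remaining indices, which are read modulo \<open>l\<close>.
\<close>

definition shifts ::
    "nat \<Rightarrow> nat \<Rightarrow> (nat \<Rightarrow> rat set) \<Rightarrow> int \<Rightarrow> (nat \<Rightarrow> int) \<Rightarrow> (nat \<Rightarrow> int) \<Rightarrow> bool" where
  "shifts l m \<Delta> lam0 a lam \<longleftrightarrow> lam 0 = lam0 \<and>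
     (\<forall>i\<le>m. (a (Suc i) = a i \<longrightarrow> lam (Suc i) = lam i) \<and>
            (a (Suc i) \<noteq> a i \<longrightarrow> \<Delta> i \<inter> \<Delta> (Suc i) = {of_int (lam i + lam (Suc i))})) \<and>
     (\<forall>i. Suc m < i \<and> i < l \<longrightarrow> a i = 1 \<and> lam i = 0) \<and>
     (\<forall>i. a (i + l) = a i \<and> lam (i + l) = lam i)"

section \<open>Rational functions and vector fields\<close>

text \<open>
  \<open>\<complex>(x,y)\<close> is the fraction field of \<open>\<complex>[x][y]\<close>, and \<open>\<complex>(x,y,t)\<close> is the fraction field of
  \<open>\<complex>(x,y)[t]\<close>.
\<close>

type_synonym ratfun = "complex poly poly fract"
type_synonym ratfun_t = "ratfun poly fract"

definition const_xy :: "complex \<Rightarrow> ratfun" where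
  "const_xy c = Fract [:[:c:]:] 1"

definition x_var :: ratfun where
  "x_var = Fract [:[:0, 1:]:] 1"

definition y_var :: ratfun where
  "y_var = Fract [:0, 1:] 1"

definition lift_t :: "ratfun \<Rightarrow> ratfun_t" where
  "lift_t f = Fract [:f:] 1"

definition t_var :: ratfun_t where
  "t_var = Fract [:0, 1:] 1"

definition chi :: "lattice \<Rightarrow> ratfun" where
  "chi w = x_var powi fst w * y_var powi snd w"

text \<open>The ring \<open>\<complex>[\<tau>\<^sup>\<or> \<inter> M]\<close>.\<close>

definition toric_ring :: "rat_plane set \<Rightarrow> ratfun set" where
  "toric_ring \<tau> =
     {\<Sum>w\<in>F. const_xy (c w) * chi w | F c. finite F \<and> F \<subseteq> dual_monoid \<tau>}"

definition derivation :: "(ratfun \<Rightarrow> ratfun) \<Rightarrow> bool" where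
  "derivation D \<longleftrightarrow> (\<forall>f g. D (f + g) = D f + D g) \<and>
     (\<forall>f g. D (f * g) = D f * g + f * D g) \<and> (\<forall>c. D (const_xy c) = 0)"

text \<open>
  \<open>\<Gamma>(TV(\<tau>), T)\<close> consists of the \<open>\<complex>\<close>-derivations of \<open>\<complex>[\<tau>\<^sup>\<or> \<inter> M]\<close>. Such a derivation
  is identified with its unique extension to the function field \<open>\<complex>(x,y)\<close>; then the
  restriction maps of the tangent sheaf are inclusions.
\<close>

definition vector_fields :: "rat_plane set \<Rightarrow> (ratfun \<Rightarrow> ratfun) set" where
  "vector_fields \<tau> = {D. derivation D \<and> D ` toric_ring \<tau> \<subseteq> toric_ring \<tau>}"

definition partial_x :: "ratfun \<Rightarrow> ratfun" where
  "partial_x = (THE D. derivation D \<and> D x_var = 1 \<and> D y_var = 0)"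

definition partial_y :: "ratfun \<Rightarrow> ratfun" where
  "partial_y = (THE D. derivation D \<and> D x_var = 0 \<and> D y_var = 1)"

text \<open>\<open>\<chi>\<^sup>u\<close> times a torus-invariant vector field.\<close>

definition has_degree :: "lattice \<Rightarrow> (ratfun \<Rightarrow> ratfun) \<Rightarrow> bool" where
  "has_degree u D \<longleftrightarrow> (\<exists>\<alpha> \<beta>. D = (\<lambda>f. chi u *
     (const_xy \<alpha> * x_var * partial_x f + const_xy \<beta> * y_var * partial_y f)))"

section \<open>Cech cohomology of the tangent sheaf\<close>

text \<open>
  The covering is given by the cones \<open>\<sigma> i\<close> with \<open>i < l\<close>, and the intersection of two charts
  is the chart of the intersection of the cones. Cochains vanish at indices outside the
  range, so that equality of cochains is equality of functions.
\<close>

definition cech_cocycles ::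
    "nat \<Rightarrow> (nat \<Rightarrow> rat_plane set) \<Rightarrow> (nat \<Rightarrow> nat \<Rightarrow> ratfun \<Rightarrow> ratfun) set" where
  "cech_cocycles l \<sigma> = {D.
     (\<forall>i<l. \<forall>j<l. D i j \<in> vector_fields (\<sigma> i \<inter> \<sigma> j)) \<and>
     (\<forall>i j. \<not> (i < l \<and> j < l) \<longrightarrow> D i j = (\<lambda>f. 0)) \<and>
     (\<forall>i<l. \<forall>j<l. \<forall>k<l. \<forall>f. D i j f + D j k f = D i k f)}"

definition cohomologous :: "nat \<Rightarrow> (nat \<Rightarrow> rat_plane set) \<Rightarrow>
    ((nat \<Rightarrow> nat \<Rightarrow> ratfun \<Rightarrow> ratfun) \<times> (nat \<Rightarrow> nat \<Rightarrow> ratfun \<Rightarrow> ratfun)) set" where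
  "cohomologous l \<sigma> = {(D, E). D \<in> cech_cocycles l \<sigma> \<and> E \<in> cech_cocycles l \<sigma> \<and>
     (\<exists>e. (\<forall>i<l. e i \<in> vector_fields (\<sigma> i)) \<and>
          (\<forall>i<l. \<forall>j<l. \<forall>f. E i j f - D i j f = e j f - e i f))}"

definition cech_H1 ::
    "nat \<Rightarrow> (nat \<Rightarrow> rat_plane set) \<Rightarrow> (nat \<Rightarrow> nat \<Rightarrow> ratfun \<Rightarrow> ratfun) set set" where
  "cech_H1 l \<sigma> = cech_cocycles l \<sigma> // cohomologous l \<sigma>"

definition cech_class :: "nat \<Rightarrow> (nat \<Rightarrow> rat_plane set) \<Rightarrow>
    (nat \<Rightarrow> nat \<Rightarrow> ratfun \<Rightarrow> ratfun) \<Rightarrow> (nat \<Rightarrow> nat \<Rightarrow> ratfun \<Rightarrow> ratfun) set" where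
  "cech_class l \<sigma> D = cohomologous l \<sigma> `` {D}"

definition cech_H1_degree :: "nat \<Rightarrow> (nat \<Rightarrow> rat_plane set) \<Rightarrow> lattice \<Rightarrow>
    (nat \<Rightarrow> nat \<Rightarrow> ratfun \<Rightarrow> ratfun) set set" where
  "cech_H1_degree l \<sigma> u =
     {c \<in> cech_H1 l \<sigma>. \<exists>D\<in>c. \<forall>i<l. \<forall>j<l. has_degree u (D i j)}"

text \<open>
  The cocycle \<open>D\<close> is induced by the sections \<open>d i\<close>, \<open>1 \<le> i \<le> l\<close>, on the charts of the
  rays \<open>\<rho>\<^sub>i\<close>; the chart with index \<open>l\<close> is the one with index \<open>0\<close>.
\<close>

definition induced_by :: "nat \<Rightarrow> (nat \<Rightarrow> rat_plane set) \<Rightarrow> (nat \<Rightarrow> ratfun \<Rightarrow> ratfun) \<Rightarrow>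
    (nat \<Rightarrow> nat \<Rightarrow> ratfun \<Rightarrow> ratfun) \<Rightarrow> bool" where
  "induced_by l \<sigma> d D \<longleftrightarrow>
     D \<in> cech_cocycles l \<sigma> \<and> (\<forall>i\<in>{1..l}. D (i - 1) (i mod l) = d i)"

definition induced_cocycle :: "nat \<Rightarrow> (nat \<Rightarrow> rat_plane set) \<Rightarrow>
    (nat \<Rightarrow> ratfun \<Rightarrow> ratfun) \<Rightarrow> nat \<Rightarrow> nat \<Rightarrow> ratfun \<Rightarrow> ratfun" where
  "induced_cocycle l \<sigma> d = (THE D. induced_by l \<sigma> d D)"

section \<open>The family\<close>

definition w1 :: "(nat \<Rightarrow> lattice) \<Rightarrow> nat \<Rightarrow> lattice" where
  "w1 \<nu> i = (THE w. primitive w \<and> w \<in> dual_monoid (chart_cone \<nu> i) \<and>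
     (\<forall>v\<in>cone_gen {\<nu> (Suc i)}. pairing w v = 0))"

definition w2 :: "(nat \<Rightarrow> lattice) \<Rightarrow> nat \<Rightarrow> lattice" where
  "w2 \<nu> i = (THE w. primitive w \<and> w \<in> dual_monoid (chart_cone \<nu> i) \<and>
     (\<forall>v\<in>cone_gen {\<nu> i}. pairing w v = 0))"

definition Z_tilde :: "int \<Rightarrow> int \<Rightarrow> lattice \<Rightarrow> ratfun_t" where
  "Z_tilde ai li w = (let x = lift_t x_var; y = lift_t y_var; t = t_var; r = fst w; s = snd w in
     if ai = 1 then x powi r * y powi (s + li * r) * (y - t) powi (- (li * r))
     else x powi r * y powi (- (li * r)) * (y - t) powi (s + li * r))"

inductive_set alg_gen :: "ratfun_t set \<Rightarrow> ratfun_t set" for G where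
  const: "lift_t (const_xy c) \<in> alg_gen G"
| gen: "g \<in> G \<Longrightarrow> g \<in> alg_gen G"
| add: "f \<in> alg_gen G \<Longrightarrow> g \<in> alg_gen G \<Longrightarrow> f + g \<in> alg_gen G"
| mult: "f \<in> alg_gen G \<Longrightarrow> g \<in> alg_gen G \<Longrightarrow> f * g \<in> alg_gen G"

definition A_tilde ::
    "nat \<Rightarrow> (nat \<Rightarrow> lattice) \<Rightarrow> (nat \<Rightarrow> int) \<Rightarrow> (nat \<Rightarrow> int) \<Rightarrow> nat \<Rightarrow> ratfun_t set" where
  "A_tilde m \<nu> a lam i = alg_gen (
     {t_var, Z_tilde (a i) (lam i) (w1 \<nu> i), Z_tilde (a i) (lam i) (w2 \<nu> i)} \<union>
     (if i \<le> Suc m then {} else {lift_t y_var * inverse (lift_t y_var - t_var)}))"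

text \<open>The principal localization of \<open>A\<close> at \<open>g\<close>, as a subring of \<open>\<complex>(x,y,t)\<close>. A localization
  whose spectrum is an open subset is of this form.\<close>

definition localization :: "ratfun_t set \<Rightarrow> ratfun_t \<Rightarrow> ratfun_t set" where
  "localization A g = {f / g ^ n | f n. f \<in> A}"

section \<open>The Kodaira-Spencer class\<close>

text \<open>The restriction of \<open>f\<close> to \<open>t = 0\<close>, for \<open>f\<close> without pole along \<open>t = 0\<close>.\<close>

definition at_t0 :: "ratfun_t \<Rightarrow> ratfun" where
  "at_t0 f = (THE c. \<exists>p q. poly q 0 \<noteq> 0 \<and> f = Fract p q \<and> c = poly p 0 / poly q 0)"

text \<open>
  Elements \<open>u + t v\<close> of \<open>\<complex>(x,y)[t]/t\<^sup>2\<close> are represented by the polynomials \<open>[:u, v:]\<close>,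
  products being reduced modulo \<open>t\<^sup>2\<close>.
\<close>

definition mod_t2 :: "ratfun poly \<Rightarrow> ratfun poly" where
  "mod_t2 p = p mod [:0, 0, 1:]"

definition first_order :: "ratfun set \<Rightarrow> ratfun poly set" where
  "first_order A0 = {[:u, v:] | u v. u \<in> A0 \<and> v \<in> A0}"

text \<open>
  A trivialization, i.e. an isomorphism of \<open>A \<otimes> \<complex>[t]/t\<^sup>2 = A / t\<^sup>2 A\<close> with
  \<open>A0 \<otimes> \<complex>[t]/t\<^sup>2\<close> over \<open>\<complex>[t]/t\<^sup>2\<close> that is the identity modulo \<open>t\<close>. It is given as a map
  on \<open>A\<close> with kernel \<open>t\<^sup>2 A\<close>. The fibre of \<open>A\<close> over \<open>t = 0\<close> is identified with \<open>A0\<close> by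
  restricting functions to \<open>t = 0\<close>.
\<close>

definition trivialization ::
    "ratfun set \<Rightarrow> ratfun_t set \<Rightarrow> (ratfun_t \<Rightarrow> ratfun poly) \<Rightarrow> bool" where
  "trivialization A0 A \<theta> \<longleftrightarrow>
     (\<forall>f\<in>A. \<forall>g\<in>A. \<theta> (f + g) = \<theta> f + \<theta> g) \<and>
     (\<forall>f\<in>A. \<forall>g\<in>A. \<theta> (f * g) = mod_t2 (\<theta> f * \<theta> g)) \<and>
     (\<forall>c. \<theta> (lift_t (const_xy c)) = [:const_xy c:]) \<and> \<theta> t_var = [:0, 1:] \<and>
     \<theta> ` A = first_order A0 \<and>
     {f \<in> A. \<theta> f = 0} = (\<lambda>g. t_var\<^sup>2 * g) ` A \<and>
     (\<forall>f\<in>A. coeff (\<theta> f) 0 = at_t0 f)"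

text \<open>The extension of a trivialization to the localization of \<open>A\<close> at an element \<open>g\<close> not
  vanishing identically on \<open>t = 0\<close>; the value at \<open>f / g\<^sup>n\<close> is \<open>\<theta> f / (\<theta> g)\<^sup>n\<close>.\<close>

definition localized ::
    "ratfun_t set \<Rightarrow> (ratfun_t \<Rightarrow> ratfun poly) \<Rightarrow> ratfun_t \<Rightarrow> ratfun_t \<Rightarrow> ratfun poly" where
  "localized A \<theta> g b = (THE p. degree p \<le> 1 \<and>
     (\<exists>f\<in>A. \<exists>n. b = f / g ^ n \<and> mod_t2 (p * \<theta> g ^ n) = \<theta> f))"

definition id_plus_t :: "(ratfun \<Rightarrow> ratfun) \<Rightarrow> ratfun poly \<Rightarrow> ratfun poly" where
  "id_plus_t D p = [:coeff p 0, coeff p 1 + D (coeff p 0):]"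

text \<open>
  The family is given by its coordinate rings \<open>A i\<close> in \<open>\<complex>(x,y,t)\<close>, glued along all
  common localizations. Localizations at functions that vanish on \<open>t = 0\<close> do not meet the
  fibre over \<open>\<complex>[t]/t\<^sup>2\<close> and are left out. On the remaining ones the defining relation is
  \<open>\<theta>\<^sub>j = (id + t D\<^sub>i\<^sub>j) \<theta>\<^sub>i\<close>.
\<close>

definition transition_cocycle :: "nat \<Rightarrow> (nat \<Rightarrow> rat_plane set) \<Rightarrow> (nat \<Rightarrow> ratfun_t set) \<Rightarrow>
    (nat \<Rightarrow> ratfun_t \<Rightarrow> ratfun poly) \<Rightarrow> (nat \<Rightarrow> nat \<Rightarrow> ratfun \<Rightarrow> ratfun) \<Rightarrow> bool" where
  "transition_cocycle l \<sigma> A \<theta> D \<longleftrightarrow> D \<in> cech_cocycles l \<sigma> \<and>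
     (\<forall>i<l. \<forall>j<l. \<forall>g\<in>A i. \<forall>h\<in>A j.
        at_t0 g \<noteq> 0 \<and> at_t0 h \<noteq> 0 \<and> localization (A i) g = localization (A j) h \<longrightarrow>
        (\<forall>b\<in>localization (A i) g.
           localized (A j) (\<theta> j) h b = id_plus_t (D i j) (localized (A i) (\<theta> i) g b)))"

definition is_KS_class :: "nat \<Rightarrow> (nat \<Rightarrow> rat_plane set) \<Rightarrow> (nat \<Rightarrow> ratfun_t set) \<Rightarrow>
    (nat \<Rightarrow> nat \<Rightarrow> ratfun \<Rightarrow> ratfun) set \<Rightarrow> bool" where
  "is_KS_class l \<sigma> A c \<longleftrightarrow>
     (\<exists>\<theta> D. (\<forall>i<l. trivialization (toric_ring (\<sigma> i)) (A i) (\<theta> i)) \<and>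
            transition_cocycle l \<sigma> A \<theta> D \<and> c = cech_class l \<sigma> D)"

definition KS_class :: "nat \<Rightarrow> (nat \<Rightarrow> rat_plane set) \<Rightarrow> (nat \<Rightarrow> ratfun_t set) \<Rightarrow>
    (nat \<Rightarrow> nat \<Rightarrow> ratfun \<Rightarrow> ratfun) set" where
  "KS_class l \<sigma> A = (THE c. is_KS_class l \<sigma> A c)"

text \<open>The section \<open>d\<^sub>i\<^sub>-\<^sub>1\<^sub>,\<^sub>i\<close>.\<close>

definition d_section ::
    "nat \<Rightarrow> nat \<Rightarrow> (nat \<Rightarrow> int) \<Rightarrow> (nat \<Rightarrow> int) \<Rightarrow> nat \<Rightarrow> ratfun \<Rightarrow> ratfun" where
  "d_section l m a lam i = (\<lambda>f.
     if a i = a (i - 1) then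
       if i \<in> {m + 2, l}
       then of_int (a (i - 1) * (lam (i - 1) - lam i)) * (x_var / y_var) * partial_x f
       else 0
     else of_int (a (i - 1)) *
       (of_int (lam i + lam (i - 1)) * (x_var / y_var) * partial_x f + partial_y f))"

end

theory Submission
  imports Defs
begin

text \<open>
  Every chart carries a natural trivialization over \<open>\<complex>[t]/t\<^sup>2\<close>, the one that sends the deformed
  coordinates to the coordinates of the toric chart. To compare these trivializations, expand rational
  functions along \<open>t = 0\<close>: \<open>jet f = u + t v\<close>. From \<open>y - t = y (1 - t/y)\<close> one reads off that the deformed
  monomial of exponent \<open>w\<close> has the jet \<open>\<chi>\<^sup>w - t \<delta>\<^sub>i(\<chi>\<^sup>w)\<close>, where \<open>\<delta>\<^sub>i\<close> is the vector field
  \<open>- \<lambda>\<^sub>i (x/y) \<partial>/\<partial>x\<close> if \<open>a\<^sub>i = 1\<close> and \<open>\<lambda>\<^sub>i (x/y) \<partial>/\<partial>x + \<partial>/\<partial>y\<close> if \<open>a\<^sub>i = - 1\<close>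
  (\<open>Z_tilde_expand\<close>). So the natural trivialization is \<open>(id + t \<delta>\<^sub>i) \<circ> jet\<close>, the transition
  cocycle is \<open>\<delta>\<^sub>j - \<delta>\<^sub>i\<close>, and its values at consecutive indices are the sections of the theorem
  (\<open>d_section_eq\<close>). All \<open>\<delta>\<^sub>i\<close> have degree \<open>[0,-1]\<close>.

  That \<open>(id + t \<delta>\<^sub>i) \<circ> jet\<close> is a trivialization, with kernel exactly \<open>t\<^sup>2\<close> times the ring of the
  chart, holds because that ring is the sum of the linear span of the deformed monomials and of \<open>t\<close>
  times itself (\<open>A_decomp\<close>), and because the deformed monomials restrict to linearly independent
  characters at \<open>t = 0\<close> (\<open>characters_independent\<close>).

  For the uniqueness of the class, every trivialization of a chart is \<open>(id + t (e\<^sub>i + \<delta>\<^sub>i)) \<circ> jet\<close>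
  with a vector field \<open>e\<^sub>i\<close> of the toric chart (\<open>trivialization_form\<close>). The gluing condition speaks
  only of common localizations, so these have to be exhibited for consecutive charts
  (\<open>common_localization\<close>): for the rays through the slice, both rings become the ring generated by
  \<open>t\<close> and the deformed monomials of the half-plane dual to the ray; for the other rays, where \<open>1/y\<close>
  is a regular function, both become the ring generated by \<open>t\<close>, the undeformed monomials of the
  half-plane, and the unit \<open>y/(y - t)\<close> with its inverse. Consecutive transition fields are then
  forced, and the cocycle condition gives the remaining ones.

  The fan enters through three facts: consecutive generators have determinant \<open>1\<close> (\<open>det_1\<close>),
  two charts meet in the origin or along a common ray or coincide (\<open>cone_inter\<close>), and the rays \<open>\<rho>\<^sub>i\<close>
  with \<open>1 \<le> i \<le> m + 1\<close> pass through \<open>\<Delta>\<^sub>0\<^sup>i\<^sup>-\<^sup>1 \<inter> \<Delta>\<^sub>0\<^sup>i\<close> while those with \<open>m + 2 \<le> i \<le> l\<close> do not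
  meet the line of the slice (\<open>upper_rays\<close>, \<open>lower_rays\<close>).
\<close>

section \<open>Derivations of the function field\<close>

lemma quotient_rule_well_defined: fixes d :: "'a::idom \<Rightarrow> 'a"
  assumes add: "\<And>p q. d (p + q) = d p + d q" and mult: "\<And>p q. d (p * q) = d p * q + p * d q"
    and "q \<noteq> 0" "q' \<noteq> 0" and eq: "Fract p q = Fract p' q'"
  shows "Fract (d p * q - p * d q) (q * q) = Fract (d p' * q' - p' * d q') (q' * q')"
proof -
  have e: "p * q' = p' * q" using assms by (simp add: eq_fract)
  hence "d (p * q') = d (p' * q)" by simp
  hence "d p * q' + p * d q' = d p' * q + p' * d q" by (simp add: mult)
  with e have "(d p * q - p * d q) * (q' * q') = (d p' * q' - p' * d q') * (q * q)"
    by algebra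
  thus ?thesis using assms by (simp add: eq_fract)
qed

text \<open>
  The extension of a derivation to the field of fractions by the quotient rule.
\<close>

definition fract_ext :: "('a::idom \<Rightarrow> 'a) \<Rightarrow> 'a fract \<Rightarrow> 'a fract" where
  "fract_ext d f = (THE e. \<exists>p q. q \<noteq> 0 \<and> f = Fract p q \<and> e = Fract (d p * q - p * d q) (q * q))"

lemma fract_ext_Fract: fixes d :: "'a::idom \<Rightarrow> 'a"
  assumes add: "\<And>p q. d (p + q) = d p + d q" and mult: "\<And>p q. d (p * q) = d p * q + p * d q"
    and "q \<noteq> 0"
  shows "fract_ext d (Fract p q) = Fract (d p * q - p * d q) (q * q)"
  unfolding fract_ext_def
proof (rule the_equality)
  show "\<exists>p' q'. q' \<noteq> 0 \<and> Fract p q = Fract p' q' \<and>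
      Fract (d p * q - p * d q) (q * q) = Fract (d p' * q' - p' * d q') (q' * q')"
    using assms(3) by blast
qed (use quotient_rule_well_defined[of d, OF add mult] assms(3) in metis)

lemma fract_ext_derivation: fixes d :: "'a::idom \<Rightarrow> 'a"
  assumes add: "\<And>p q. d (p + q) = d p + d q" and mult: "\<And>p q. d (p * q) = d p * q + p * d q"
  shows "fract_ext d (f + g) = fract_ext d f + fract_ext d g"
    and "fract_ext d (f * g) = fract_ext d f * g + f * fract_ext d g"
proof -
  obtain p q where f: "f = Fract p q" "q \<noteq> 0" by (cases f)
  obtain r s where g: "g = Fract r s" "s \<noteq> 0" by (cases g)
  note e = fract_ext_Fract[of d, OF add mult]
  show "fract_ext d (f + g) = fract_ext d f + fract_ext d g"
    unfolding f g using f(2) g(2) by (simp add: e add mult eq_fract) algebra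
  show "fract_ext d (f * g) = fract_ext d f * g + f * fract_ext d g"
    unfolding f g using f(2) g(2) by (simp add: e add mult eq_fract) algebra
qed

lemma map_poly_pderiv_add: "map_poly pderiv (p + q) = map_poly pderiv p + map_poly pderiv q"
  for p q :: "'a::idom poly poly"
  by (rule poly_eqI) (simp add: coeff_map_poly pderiv_add)

text \<open>
  Differentiating the coefficients is a derivation; on \<open>\<complex>[x][y]\<close> it is \<open>\<partial>/\<partial>x\<close>, while
  \<open>pderiv\<close> itself is \<open>\<partial>/\<partial>y\<close>.
\<close>

lemma map_poly_pderiv_mult:
  "map_poly pderiv (p * q) = map_poly pderiv p * q + p * map_poly pderiv q"
  for p q :: "'a::idom poly poly"
proof (rule poly_eqI)
  fix n
  have sum: "pderiv (sum f F) = (\<Sum>i\<in>F. pderiv (f i))" for f :: "nat \<Rightarrow> 'a poly" and F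
    by (induction F rule: infinite_finite_induct) (simp_all add: pderiv_add)
  have mult: "pderiv (f * g) = pderiv f * g + f * pderiv g" for f g :: "'a poly"
    by (simp add: pderiv_mult)
  show "coeff (map_poly pderiv (p * q)) n =
      coeff (map_poly pderiv p * q + p * map_poly pderiv q) n"
    by (simp add: coeff_map_poly coeff_mult mult sum sum.distrib)
qed

lemma const_xy_simps [simp]:
  "const_xy 0 = 0" "const_xy 1 = 1" "const_xy (c + d) = const_xy c + const_xy d"
  "const_xy (c * d) = const_xy c * const_xy d" "const_xy (- c) = - const_xy c"
  "const_xy (c - d) = const_xy c - const_xy d"
  by (simp_all add: const_xy_def Zero_fract_def One_fract_def one_pCons)

lemma const_xy_of_int [simp]: "const_xy (of_int n) = of_int n"
proof (induction n)
  case (nonneg n) show ?case by (induction n) simp_all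
next
  case (neg n) show ?case using const_xy_simps(3)[of 1 1] by (induction n) simp_all
qed

lemma const_xy_eq_0_iff [simp]: "const_xy c = 0 \<longleftrightarrow> c = 0"
  by (simp add: const_xy_def Zero_fract_def eq_fract)

lemma xy_nonzero [simp]: "x_var \<noteq> 0" "y_var \<noteq> 0"
  by (simp_all add: x_var_def y_var_def Zero_fract_def eq_fract)

lemma chi_nonzero [simp]: "chi w \<noteq> 0"
  by (simp add: chi_def)

lemma chi_add: "chi (v + w) = chi v * chi w"
  by (simp add: chi_def power_int_add)

lemma chi_0 [simp]: "chi 0 = 1"
  by (simp add: chi_def)

lemma derivation_add: "derivation D \<Longrightarrow> D (f + g) = D f + D g"
  and derivation_mult: "derivation D \<Longrightarrow> D (f * g) = D f * g + f * D g"
  and derivation_const: "derivation D \<Longrightarrow> D (const_xy c) = 0"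
  by (simp_all add: derivation_def)

lemma derivation_01: assumes "derivation D" shows "D 0 = 0" "D 1 = 0"
  using derivation_const[OF assms, of 0] derivation_const[OF assms, of 1] by simp_all

text \<open>
  The variables generate the field over \<open>\<complex>\<close>, so a derivation is determined by its values on them.
\<close>

lemma derivation_eqI:
  assumes D: "derivation D" and E: "derivation E"
    and x: "D x_var = E x_var" and y: "D y_var = E y_var"
  shows "D = E"
proof
  fix f :: ratfun
  have 1: "D (Fract [:p:] 1) = E (Fract [:p:] 1)" for p
  proof (induction p)
    case 0 show ?case using derivation_01(1)[OF D] derivation_01(1)[OF E] by (simp add: Zero_fract_def)
  next
    case (pCons c p)
    have "Fract [:pCons c p:] 1 = const_xy c + x_var * Fract [:p:] 1"
      by (simp add: const_xy_def x_var_def)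
    thus ?case using pCons x by (simp add: derivation_add derivation_mult derivation_const D E)
  qed
  have 2: "D (Fract p 1) = E (Fract p 1)" for p
  proof (induction p)
    case 0 show ?case using derivation_01(1)[OF D] derivation_01(1)[OF E] by (simp add: Zero_fract_def)
  next
    case (pCons c p)
    have "Fract (pCons c p) 1 = Fract [:c:] 1 + y_var * Fract p 1"
      by (simp add: y_var_def)
    thus ?case using pCons y 1[of c] by (simp add: derivation_add derivation_mult D E)
  qed
  obtain p q where f: "f = Fract p q" and q: "q \<noteq> 0" by (cases f)
  have q0: "Fract q 1 \<noteq> 0" using q by (simp add: Zero_fract_def eq_fract)
  have p: "Fract p 1 = f * Fract q 1" using q by (simp add: f eq_fract)
  have "D f * Fract q 1 + f * D (Fract q 1) = E f * Fract q 1 + f * E (Fract q 1)"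
    using 2[of p] unfolding p by (simp add: derivation_mult D E)
  thus "D f = E f" using 2[of q] q0 by simp
qed

text \<open>
  The definite descriptions of the partial derivatives refer to something: existence comes from the
  quotient rule, uniqueness from \<open>derivation_eqI\<close>.
\<close>

lemma partial_derivatives:
  "derivation partial_x \<and> partial_x x_var = 1 \<and> partial_x y_var = 0"
  "derivation partial_y \<and> partial_y x_var = 0 \<and> partial_y y_var = 1"
proof -
  let ?X = "fract_ext (map_poly pderiv) :: ratfun \<Rightarrow> ratfun"
  note X = fract_ext_derivation[OF map_poly_pderiv_add map_poly_pderiv_mult]
  note X' = fract_ext_Fract[OF map_poly_pderiv_add map_poly_pderiv_mult]
  have "derivation ?X \<and> ?X x_var = 1 \<and> ?X y_var = 0"
    unfolding derivation_def const_xy_def x_var_def y_var_def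
    by (intro conjI allI X)
      (simp_all add: X' pderiv_pCons map_poly_pCons Zero_fract_def One_fract_def eq_fract one_pCons)
  hence "\<exists>!D. derivation D \<and> D x_var = 1 \<and> D y_var = 0"
    by (intro ex1I[where a = ?X]) (simp_all add: derivation_eqI)
  thus "derivation partial_x \<and> partial_x x_var = 1 \<and> partial_x y_var = 0"
    unfolding partial_x_def by (rule theI')
  let ?Y = "fract_ext pderiv :: ratfun \<Rightarrow> ratfun"
  have Yd: "pderiv (p * q) = pderiv p * q + p * pderiv q" for p q :: "complex poly poly"
    by (simp add: pderiv_mult)
  note Y = fract_ext_derivation[OF pderiv_add Yd]
  note Y' = fract_ext_Fract[OF pderiv_add Yd]
  have "derivation ?Y \<and> ?Y x_var = 0 \<and> ?Y y_var = 1"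
    unfolding derivation_def const_xy_def x_var_def y_var_def
    by (intro conjI allI Y)
      (simp_all add: Y' pderiv_pCons Zero_fract_def One_fract_def eq_fract one_pCons)
  hence "\<exists>!D. derivation D \<and> D x_var = 0 \<and> D y_var = 1"
    by (intro ex1I[where a = ?Y]) (simp_all add: derivation_eqI)
  thus "derivation partial_y \<and> partial_y x_var = 0 \<and> partial_y y_var = 1"
    unfolding partial_y_def by (rule theI')
qed

lemmas partial_simps [simp] = partial_derivatives[THEN conjunct1]
  partial_derivatives[THEN conjunct2, THEN conjunct1]
  partial_derivatives[THEN conjunct2, THEN conjunct2]

lemma derivation_combination:
  assumes "derivation D" "derivation E" shows "derivation (\<lambda>f. p * D f + q * E f)"
  using assms by (simp add: derivation_def algebra_simps)

lemma derivation_diff: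
  assumes "derivation D" "derivation E" shows "derivation (\<lambda>f. D f - E f)"
  using assms by (simp add: derivation_def algebra_simps)

lemma derivation_plus:
  assumes "derivation D" "derivation E" shows "derivation (\<lambda>f. D f + E f)"
  using assms by (simp add: derivation_def algebra_simps)

lemma derivation_zero: "derivation (\<lambda>f. 0)"
  by (simp add: derivation_def)

lemma derivation_power_int:
  assumes D: "derivation D" and f: "f \<noteq> 0"
  shows "D (f powi n) = of_int n * (D f / f) * f powi n"
proof -
  have nat: "D (f ^ k) = of_nat k * (D f / f) * f ^ k" for k
    using f by (induction k) (simp_all add: derivation_01 derivation_mult D field_simps)
  show ?thesis
  proof (cases n rule: int_cases2)
    case (nonneg k) thus ?thesis by (simp add: nat)
  next
    case (nonpos k)
    have "D (f ^ k * inverse (f ^ k)) = 0" using f by (simp add: derivation_01 D)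
    hence "D (f ^ k) * inverse (f ^ k) + f ^ k * D (inverse (f ^ k)) = 0"
      by (simp only: derivation_mult D)
    hence "D (inverse (f ^ k)) = - of_nat k * (D f / f) * inverse (f ^ k)"
      using f by (simp add: nat field_simps eq_neg_iff_add_eq_0 add.commute)
    thus ?thesis using nonpos f by (simp add: power_int_minus)
  qed
qed

lemma derivation_chi:
  assumes "derivation D"
  shows "D (chi w) = (of_int (fst w) * (D x_var / x_var) + of_int (snd w) * (D y_var / y_var)) * chi w"
  unfolding chi_def
  by (simp add: derivation_mult[OF assms] derivation_power_int[OF assms] algebra_simps)

lemma derivation_sum:
  assumes "derivation D" shows "D (sum f F) = (\<Sum>x\<in>F. D (f x))"
  by (induction F rule: infinite_finite_induct) (simp_all add: derivation_01 derivation_add assms)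

text \<open>
  Characters with distinct exponents are simultaneous eigenvectors of \<open>x \<partial>/\<partial>x\<close> and \<open>y \<partial>/\<partial>y\<close>
  with distinct pairs of eigenvalues.
\<close>

lemma characters_independent:
  assumes "finite F" "(\<Sum>w\<in>F. const_xy (c w) * chi w) = 0" "w \<in> F"
  shows "c w = 0"
  using assms
proof (induction F arbitrary: c w rule: finite_induct)
  case (insert v F)
  let ?E = "\<lambda>p q f. (p * x_var) * partial_x f + (q * y_var) * partial_y f"
  have E: "derivation (?E p q)" for p q by (intro derivation_combination) simp_all
  have Echi: "?E p q (const_xy c * chi w) = const_xy c * ((of_int (fst w) * p + of_int (snd w) * q) * chi w)" for p q w c
    by (simp only: derivation_mult[OF E] derivation_chi[OF E] derivation_const[OF E])
       (simp add: algebra_simps)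
  \<comment> \<open>subtracting the eigenvalue of \<open>v\<close> from the operator kills the term of \<open>v\<close>\<close>
  have shift: "(\<Sum>w\<in>F. const_xy (of_int (fst w * p + snd w * q - (fst v * p + snd v * q)) * c w) * chi w) = 0"
    for p q :: int
  proof -
    let ?k = "\<lambda>w. of_int (fst w) * of_int p + of_int (snd w) * of_int q :: ratfun"
    have "0 = ?E (of_int p) (of_int q) (\<Sum>w\<in>insert v F. const_xy (c w) * chi w) -
        ?k v * (\<Sum>w\<in>insert v F. const_xy (c w) * chi w)"
      by (simp only: insert.prems(1) derivation_01[OF E]) simp
    also have "\<dots> = (\<Sum>w\<in>insert v F. const_xy (c w) * (?k w * chi w)) - (\<Sum>w\<in>insert v F. ?k v * (const_xy (c w) * chi w))"
      by (simp only: derivation_sum[OF E] Echi sum_distrib_left)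
    also have "\<dots> = (\<Sum>w\<in>insert v F. (?k w - ?k v) * (const_xy (c w) * chi w))"
      unfolding sum_subtractf[symmetric] by (intro sum.cong) (simp_all add: algebra_simps)
    also have "\<dots> = (\<Sum>w\<in>F. (?k w - ?k v) * (const_xy (c w) * chi w))"
      using insert.hyps by simp
    also have "\<dots> = (\<Sum>w\<in>F. const_xy (of_int (fst w * p + snd w * q - (fst v * p + snd v * q)) * c w) * chi w)"
      by (intro sum.cong) (simp_all add: algebra_simps)
    finally show ?thesis by simp
  qed
  have zero: "c w = 0" if w: "w \<in> F" for w
  proof -
    have "w \<noteq> v" using w insert.hyps by auto
    then consider "fst w - fst v \<noteq> 0" | "snd w - snd v \<noteq> 0" by (cases w, cases v) auto
    thus ?thesis
    proof cases
      case 1 thus ?thesis using insert.IH[OF shift[of 1 0] w] by simp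
    next
      case 2 thus ?thesis using insert.IH[OF shift[of 0 1] w] by simp
    qed
  qed
  hence "const_xy (c v) * chi v = 0" using insert by (simp add: sum.neutral)
  hence "c v = 0" by simp
  with zero insert.prems(2) show ?case by blast
qed simp

section \<open>Spans of characters\<close>

definition char_span :: "(complex \<Rightarrow> 'a::field) \<Rightarrow> (lattice \<Rightarrow> 'a) \<Rightarrow> lattice set \<Rightarrow> 'a set" where
  "char_span k Z W = {\<Sum>w\<in>F. k (c w) * Z w | F c. finite F \<and> F \<subseteq> W}"

text \<open>
  The characters \<open>\<chi>\<^sup>w\<close> and the deformed monomials of a chart are both multiplicative families indexed
  by the lattice \<open>M\<close>; the ring generated by such a family over a submonoid is its linear span.
\<close>

locale character =
  fixes k :: "complex \<Rightarrow> 'a::field" and Z :: "lattice \<Rightarrow> 'a"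
  assumes k_0: "k 0 = 0" and k_1: "k 1 = 1"
    and k_add: "k (c + d) = k c + k d" and k_mult: "k (c * d) = k c * k d"
    and Z_0: "Z 0 = 1" and Z_add: "Z (v + w) = Z v * Z w"
begin

lemma span_0: "0 \<in> char_span k Z W"
  unfolding char_span_def by (rule CollectI) (intro exI[of _ "{}"], auto)

lemma span_insert:
  assumes "f \<in> char_span k Z W" "w \<in> W"
  shows "f + k d * Z w \<in> char_span k Z W"
proof -
  obtain F c where f: "f = (\<Sum>w\<in>F. k (c w) * Z w)" and F: "finite F" "F \<subseteq> W"
    using assms(1) by (auto simp: char_span_def)
  define c' where "c' = (if w \<in> F then c(w := c w + d) else c(w := d))"
  have "f + k d * Z w = (\<Sum>w\<in>insert w F. k (c' w) * Z w)"
  proof (cases "w \<in> F")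
    case True
    hence "insert w F = insert w (F - {w})" "F = insert w (F - {w})" by auto
    hence "f = k (c w) * Z w + (\<Sum>w\<in>F - {w}. k (c w) * Z w)"
      "(\<Sum>w\<in>insert w F. k (c' w) * Z w) = k (c' w) * Z w + (\<Sum>w\<in>F - {w}. k (c' w) * Z w)"
      using F by (simp_all add: f sum.remove[OF _ True] insert_absorb True)
    moreover have "(\<Sum>w\<in>F - {w}. k (c' w) * Z w) = (\<Sum>w\<in>F - {w}. k (c w) * Z w)"
      by (intro sum.cong) (auto simp: c'_def True)
    ultimately show ?thesis using True by (simp add: c'_def k_add algebra_simps)
  next
    case False
    hence "(\<Sum>w\<in>F. k (c' w) * Z w) = f"
      unfolding f by (intro sum.cong) (auto simp: c'_def)
    thus ?thesis using False F by (simp add: c'_def)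
  qed
  moreover have "finite (insert w F)" "insert w F \<subseteq> W" using F assms by auto
  ultimately show ?thesis unfolding char_span_def by blast
qed

lemma span_induct [consumes 1, case_names zero insert]:
  assumes "f \<in> char_span k Z W" and "P 0"
    and "\<And>f w c. f \<in> char_span k Z W \<Longrightarrow> P f \<Longrightarrow> w \<in> W \<Longrightarrow> P (f + k c * Z w)"
  shows "P f"
proof -
  obtain F c where f: "f = (\<Sum>w\<in>F. k (c w) * Z w)" and F: "finite F" "F \<subseteq> W"
    using assms(1) by (auto simp: char_span_def)
  from F have "P (\<Sum>w\<in>F. k (c w) * Z w)"
  proof (induction F rule: finite_induct)
    case (insert w F)
    have "(\<Sum>w\<in>F. k (c w) * Z w) \<in> char_span k Z W"
      unfolding char_span_def using insert by auto
    from assms(3)[OF this, of w "c w"] insert show ?case by (simp add: add.commute)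
  qed (simp add: assms(2))
  thus ?thesis by (simp add: f)
qed

lemma span_add:
  assumes "f \<in> char_span k Z W" "g \<in> char_span k Z W"
  shows "f + g \<in> char_span k Z W"
  using assms(2) by (induction rule: span_induct) (use assms(1) span_insert in \<open>auto simp: add.assoc[symmetric]\<close>)

lemma span_char: "w \<in> W \<Longrightarrow> k c * Z w \<in> char_span k Z W"
  using span_insert[OF span_0] by simp

lemma span_const: "0 \<in> W \<Longrightarrow> k c \<in> char_span k Z W"
  using span_char[of 0 W c] by (simp add: Z_0)

lemma span_mult:
  assumes W: "\<And>v w. v \<in> W \<Longrightarrow> w \<in> W \<Longrightarrow> v + w \<in> W"
    and f: "f \<in> char_span k Z W" and g: "g \<in> char_span k Z W"
  shows "f * g \<in> char_span k Z W"
  using g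
proof (induction rule: span_induct)
  case (insert g w c)
  have "f * (k c * Z w) \<in> char_span k Z W" using f
  proof (induction rule: span_induct)
    case (insert f v d)
    have "(f + k d * Z v) * (k c * Z w) = f * (k c * Z w) + k (d * c) * Z (v + w)"
      by (simp add: k_mult Z_add algebra_simps)
    thus ?case using insert W \<open>w \<in> W\<close> by (simp add: span_insert)
  qed (simp add: span_0)
  thus ?case using insert by (simp add: distrib_left span_add)
qed (simp add: span_0)

lemma Z_power: "Z (int m * fst w, int m * snd w) = Z w ^ m"
proof (induction m)
  case 0 show ?case using Z_0 by (simp add: zero_prod_def)
next
  case (Suc m)
  have "(int (Suc m) * fst w, int (Suc m) * snd w) = w + (int m * fst w, int m * snd w)"
    by (cases w) (simp add: algebra_simps)
  thus ?case by (simp only: Z_add Suc.IH power_Suc)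
qed

lemma Z_nonzero: "Z w \<noteq> 0"
proof
  assume "Z w = 0"
  hence "Z (w + - w) = 0" by (simp only: Z_add) simp
  thus False using Z_0 by simp
qed

lemma Z_minus: "Z (- w) = inverse (Z w)"
proof -
  have "Z w * Z (- w) = 1" using Z_add[of w "- w"] Z_0 by simp
  thus ?thesis by (metis inverse_unique)
qed

end

lemma toric_ring_eq: "toric_ring C = char_span const_xy chi (dual_monoid C)"
  by (simp add: toric_ring_def char_span_def)

interpretation chi: character const_xy chi
  by unfold_locales (simp_all add: chi_add)

section \<open>Expansion along \<open>t = 0\<close>\<close>

text \<open>
  The local ring of \<open>\<complex>(x,y)[t]\<close> at \<open>t = 0\<close>.
\<close>

definition reg :: "ratfun_t set" where
  "reg = {Fract p q | p q. poly q 0 \<noteq> 0}"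

lemma at_t0_Fract:
  assumes "poly q 0 \<noteq> 0" shows "at_t0 (Fract p q) = poly p 0 / poly q 0"
  unfolding at_t0_def
proof (rule the_equality)
  fix c assume "\<exists>p' q'. poly q' 0 \<noteq> 0 \<and> Fract p q = Fract p' q' \<and> c = poly p' 0 / poly q' 0"
  then obtain p' q' where *: "poly q' 0 \<noteq> 0" "Fract p q = Fract p' q'" "c = poly p' 0 / poly q' 0"
    by blast
  have "q \<noteq> 0" "q' \<noteq> 0" using assms * by auto
  hence "p * q' = p' * q" using * by (simp add: eq_fract)
  hence "poly (p * q') 0 = poly (p' * q) 0" by simp
  hence "poly p 0 / poly q 0 = poly p' 0 / poly q' 0" using * assms by (simp add: frac_eq_eq)
  thus "c = poly p 0 / poly q 0" using *(3) by simp
qed (use assms in blast)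

lemma regE: assumes "f \<in> reg" obtains p q where "f = Fract p q" "poly q 0 \<noteq> 0" "q \<noteq> 0"
proof -
  obtain p q where "f = Fract p q" "poly q 0 \<noteq> 0" using assms by (auto simp: reg_def)
  moreover from this have "q \<noteq> 0" by auto
  ultimately show thesis by (rule that)
qed

lemma reg_Fract: "poly q 0 \<noteq> 0 \<Longrightarrow> Fract p q \<in> reg"
  by (auto simp: reg_def)

lemma reg_add: assumes "f \<in> reg" "g \<in> reg" shows "f + g \<in> reg" "at_t0 (f + g) = at_t0 f + at_t0 g"
  using assms by (auto elim!: regE simp: at_t0_Fract field_simps intro!: reg_Fract)

lemma reg_mult: assumes "f \<in> reg" "g \<in> reg" shows "f * g \<in> reg" "at_t0 (f * g) = at_t0 f * at_t0 g"
  using assms by (auto elim!: regE simp: at_t0_Fract field_simps intro!: reg_Fract)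

lemma reg_diff: assumes "f \<in> reg" "g \<in> reg" shows "f - g \<in> reg" "at_t0 (f - g) = at_t0 f - at_t0 g"
  using assms by (auto elim!: regE simp: at_t0_Fract field_simps intro!: reg_Fract)

lemma reg_inverse:
  assumes "f \<in> reg" "at_t0 f \<noteq> 0" shows "inverse f \<in> reg" "at_t0 (inverse f) = inverse (at_t0 f)"
  using assms by (auto elim!: regE simp: at_t0_Fract intro!: reg_Fract)

lemma reg_lift [simp]: "lift_t u \<in> reg" "at_t0 (lift_t u) = u"
  unfolding lift_t_def by (simp_all add: reg_Fract at_t0_Fract)

lemma reg_t [simp]: "t_var \<in> reg" "at_t0 t_var = 0"
  unfolding t_var_def by (simp_all add: reg_Fract at_t0_Fract)

lemma t_nonzero [simp]: "t_var \<noteq> 0"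
  by (simp add: t_var_def Zero_fract_def[where ?'a = "ratfun poly"] eq_fract)

lemma lift_simps [simp]: "lift_t (u + v) = lift_t u + lift_t v" "lift_t (u * v) = lift_t u * lift_t v"
  "lift_t 0 = 0" "lift_t 1 = 1" "lift_t (- u) = - lift_t u" "lift_t (u - v) = lift_t u - lift_t v"
  unfolding lift_t_def
  by (simp_all add: Zero_fract_def[where ?'a = "ratfun poly"] One_fract_def[where ?'a = "ratfun poly"] one_pCons mult.commute)

lemma lift_eq_0_iff [simp]: "lift_t u = 0 \<longleftrightarrow> u = 0"
  by (simp add: lift_t_def Zero_fract_def[where ?'a = "ratfun poly"] eq_fract)

lemma lift_inverse: "lift_t (inverse u) = inverse (lift_t u)"
proof (cases "u = 0")
  case False
  hence "lift_t u * lift_t (inverse u) = 1" by (simp flip: lift_simps(2))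
  thus ?thesis by (metis inverse_unique)
qed simp

lemma lift_power: "lift_t (u ^ n) = lift_t u ^ n"
  by (induction n) simp_all

lemma lift_power_int: "lift_t (u powi n) = lift_t u powi n"
  by (cases n rule: int_cases2) (simp_all add: lift_power lift_inverse power_int_minus)

lemma reg_vanishing:
  assumes "f \<in> reg" "at_t0 f = 0" obtains g where "g \<in> reg" "f = t_var * g"
proof -
  obtain p q where f: "f = Fract p q" "poly q 0 \<noteq> 0" "q \<noteq> 0" using assms(1) by (rule regE)
  obtain c p' where p: "p = pCons c p'" by (cases p)
  have "c = 0" using assms(2) f p by (simp add: at_t0_Fract)
  hence "f = t_var * Fract p' q" using f p by (simp add: t_var_def)
  thus ?thesis using that reg_Fract f by blast
qed

text \<open>
  The coefficient of \<open>t\<close> in the expansion along \<open>t = 0\<close>, as a difference quotient.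
\<close>

definition jet1 :: "ratfun_t \<Rightarrow> ratfun" where
  "jet1 f = at_t0 ((f - lift_t (at_t0 f)) / t_var)"

definition jet :: "ratfun_t \<Rightarrow> ratfun poly" where
  "jet f = [:at_t0 f, jet1 f:]"

lemma reg_expand:
  assumes "f \<in> reg"
  obtains g where "g \<in> reg" "f = lift_t (at_t0 f) + t_var * g" "at_t0 g = jet1 f"
proof -
  have "f - lift_t (at_t0 f) \<in> reg" "at_t0 (f - lift_t (at_t0 f)) = 0"
    using assms by (simp_all add: reg_diff)
  then obtain g where g: "g \<in> reg" "f - lift_t (at_t0 f) = t_var * g" by (rule reg_vanishing)
  hence "f = lift_t (at_t0 f) + t_var * g" by (simp add: diff_eq_eq add.commute)
  moreover have "at_t0 g = jet1 f" unfolding jet1_def g(2) by simp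
  ultimately show ?thesis using that g(1) by blast
qed

lemma jet1_eqI:
  assumes "f = lift_t u + t_var * g" "g \<in> reg" shows "jet1 f = at_t0 g"
proof -
  have "at_t0 f = u" using assms by (simp add: reg_add reg_mult)
  thus ?thesis using assms by (simp add: jet1_def)
qed

lemma jet1_lift [simp]: "jet1 (lift_t u) = 0"
  using jet1_eqI[of "lift_t u" u "lift_t 0"] reg_lift[of 0] by simp

lemma jet1_t [simp]: "jet1 t_var = 1"
  using jet1_eqI[of t_var 0 "lift_t 1"] reg_lift[of 1] by simp

lemma jet1_add: assumes "f \<in> reg" "g \<in> reg" shows "jet1 (f + g) = jet1 f + jet1 g"
proof -
  obtain f' where f: "f' \<in> reg" "f = lift_t (at_t0 f) + t_var * f'" "at_t0 f' = jet1 f"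
    using assms(1) by (rule reg_expand)
  obtain g' where g: "g' \<in> reg" "g = lift_t (at_t0 g) + t_var * g'" "at_t0 g' = jet1 g"
    using assms(2) by (rule reg_expand)
  have "f + g = lift_t (at_t0 f + at_t0 g) + t_var * (f' + g')"
    by (subst f(2), subst g(2)) (simp add: algebra_simps)
  from jet1_eqI[OF this] show ?thesis using f g by (simp add: reg_add)
qed

lemma jet1_mult: assumes "f \<in> reg" "g \<in> reg"
  shows "jet1 (f * g) = at_t0 f * jet1 g + jet1 f * at_t0 g"
proof -
  obtain f' where f: "f' \<in> reg" "f = lift_t (at_t0 f) + t_var * f'" "at_t0 f' = jet1 f"
    using assms(1) by (rule reg_expand)
  obtain g' where g: "g' \<in> reg" "g = lift_t (at_t0 g) + t_var * g'" "at_t0 g' = jet1 g"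
    using assms(2) by (rule reg_expand)
  have "f * g = lift_t (at_t0 f * at_t0 g) +
      t_var * (lift_t (at_t0 f) * g' + f' * lift_t (at_t0 g) + t_var * (f' * g'))"
    by (subst f(2), subst g(2)) (simp add: algebra_simps)
  from jet1_eqI[OF this] show ?thesis using f g by (simp add: reg_add reg_mult)
qed

lemma reg_power:
  assumes "f \<in> reg"
  shows "f ^ n \<in> reg" "at_t0 (f ^ n) = at_t0 f ^ n"
proof -
  have "f ^ n \<in> reg \<and> at_t0 (f ^ n) = at_t0 f ^ n"
    using reg_lift[of 1] by (induction n) (simp_all add: reg_mult assms del: reg_lift)
  thus "f ^ n \<in> reg" "at_t0 (f ^ n) = at_t0 f ^ n" by auto
qed

lemma reg_power_int:
  assumes "f \<in> reg" "at_t0 f \<noteq> 0"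
  shows "f powi n \<in> reg" "at_t0 (f powi n) = at_t0 f powi n"
  using assms by (cases n rule: int_cases2; simp add: reg_power reg_inverse power_int_minus)+

lemma jet1_power_int:
  assumes "f \<in> reg" "at_t0 f \<noteq> 0"
  shows "jet1 (f powi n) = of_int n * (jet1 f / at_t0 f) * at_t0 f powi n"
proof -
  have nat: "jet1 (f ^ k) = of_nat k * (jet1 f / at_t0 f) * at_t0 f ^ k" for k
    using assms jet1_lift[of 1]
    by (induction k) (simp_all add: jet1_mult reg_power field_simps del: jet1_lift)
  show ?thesis
  proof (cases n rule: int_cases2)
    case (nonneg k) thus ?thesis by (simp add: nat)
  next
    case (nonpos k)
    have k: "f ^ k \<in> reg" "at_t0 (f ^ k) = at_t0 f ^ k" "at_t0 (f ^ k) \<noteq> 0"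
      using assms by (simp_all add: reg_power)
    have "f \<noteq> 0" using assms reg_lift(2)[of 0] by auto
    hence "jet1 (f ^ k * inverse (f ^ k)) = 0" using jet1_lift[of 1] by simp
    hence "at_t0 f ^ k * jet1 (inverse (f ^ k)) + jet1 (f ^ k) * inverse (at_t0 f ^ k) = 0"
      using k by (simp add: jet1_mult reg_inverse)
    hence "jet1 (inverse (f ^ k)) = - of_nat k * (jet1 f / at_t0 f) * inverse (at_t0 f ^ k)"
      using assms by (simp add: nat field_simps eq_neg_iff_add_eq_0 add.commute)
    thus ?thesis using nonpos by (simp add: power_int_minus)
  qed
qed

section \<open>Deformed monomials\<close>

lemma y_minus_t [simp]: "lift_t y_var - t_var \<in> reg" "at_t0 (lift_t y_var - t_var) = y_var"
  "lift_t y_var - t_var \<noteq> 0" "jet1 (lift_t y_var - t_var) = - 1"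
proof -
  show *: "lift_t y_var - t_var \<in> reg" "at_t0 (lift_t y_var - t_var) = y_var"
    by (simp_all add: reg_diff)
  show "lift_t y_var - t_var \<noteq> 0" using *(2) reg_lift(2)[of 0] by auto
  have "lift_t y_var - t_var = lift_t y_var + t_var * lift_t (- 1)" by simp
  from jet1_eqI[OF this] show "jet1 (lift_t y_var - t_var) = - 1" by (simp del: lift_simps)
qed

lemma y_neq_t [simp]: "lift_t y_var \<noteq> t_var"
  using y_minus_t(3) by simp

text \<open>
  On characters, this is minus the first-order term of the deformed monomials.
\<close>

definition trivializing_field :: "int \<Rightarrow> int \<Rightarrow> ratfun \<Rightarrow> ratfun" where
  "trivializing_field a lam = (\<lambda>f. (if a = 1 then - of_int lam else of_int lam) * (x_var / y_var) * partial_x f +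
     (if a = 1 then 0 else 1) * partial_y f)"

lemma derivation_trivializing_field: "derivation (trivializing_field a lam)"
  unfolding trivializing_field_def by (intro derivation_combination) simp_all

interpretation Z_tilde: character "\<lambda>c. lift_t (const_xy c)" "Z_tilde a lam" for a lam
proof unfold_locales
  show "Z_tilde a lam (v + w) = Z_tilde a lam v * Z_tilde a lam w" for v w
    by (simp add: Z_tilde_def Let_def distrib_left power_int_add power_int_diff power_int_minus)
      (simp add: field_simps)
qed (simp_all add: Z_tilde_def Let_def)

text \<open>
  The factor \<open>y - t\<close> has the logarithmic derivative \<open>- 1/y\<close> at \<open>t = 0\<close>, and \<open>x\<close> and \<open>y\<close> have none.
  Hence the coefficient of \<open>t\<close> is \<open>- 1/y\<close> times the exponent of \<open>y - t\<close> times \<open>\<chi>\<^sup>w\<close>.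
\<close>

lemma Z_tilde_expand:
  "Z_tilde a lam w \<in> reg" "at_t0 (Z_tilde a lam w) = chi w"
  "jet1 (Z_tilde a lam w) = - trivializing_field a lam (chi w)"
proof -
  note [simp] = reg_mult reg_power_int jet1_mult jet1_power_int
  show "Z_tilde a lam w \<in> reg" by (simp add: Z_tilde_def Let_def)
  show "at_t0 (Z_tilde a lam w) = chi w"
    by (simp add: Z_tilde_def Let_def chi_def)
      (simp add: power_int_add power_int_minus field_simps)
  show "jet1 (Z_tilde a lam w) = - trivializing_field a lam (chi w)"
    unfolding derivation_chi[OF derivation_trivializing_field]
    by (simp add: Z_tilde_def Let_def chi_def trivializing_field_def)
      (simp add: power_int_add power_int_minus field_simps)
qed

section \<open>Trivializations of a chart\<close>

lemma mod_t2_prod: "mod_t2 ([:u, v:] * [:u', v':]) = [:u * u', u * v' + v * u':]"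
proof -
  have "[:u, v:] * [:u', v':] = [:0, 0, 1:] * [:v * v':] + [:u * u', u * v' + v * u':]"
    by (simp add: algebra_simps)
  moreover have "degree [:u * u', u * v' + v * u':] < degree [:0, 0, 1 :: ratfun:]" by simp
  ultimately show ?thesis unfolding mod_t2_def by (metis mod_mult_self4 mod_poly_less mult.commute add.commute)
qed

lemma mod_t2_small: "degree p \<le> 1 \<Longrightarrow> mod_t2 p = p"
  by (simp add: mod_t2_def mod_poly_less)

lemma mod_t2_mult_left: "mod_t2 (mod_t2 p * q) = mod_t2 (p * q)"
  by (simp add: mod_t2_def mod_mult_left_eq)

lemma id_plus_t_jet: "id_plus_t D (jet f) = [:at_t0 f, jet1 f + D (at_t0 f):]"
  by (simp add: id_plus_t_def jet_def)

lemma id_plus_t_jet_mult: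
  assumes "derivation D" "f \<in> reg" "g \<in> reg"
  shows "id_plus_t D (jet (f * g)) = mod_t2 (id_plus_t D (jet f) * id_plus_t D (jet g))"
  unfolding id_plus_t_jet mod_t2_prod
  using assms by (simp add: reg_mult jet1_mult derivation_mult algebra_simps)

text \<open>
  A trivialization of the form \<open>(id + t D) \<circ> jet\<close> makes sense on the whole local ring, so its
  extension to a localization is given by the same formula.
\<close>

lemma localized_eq:
  assumes A: "A \<subseteq> reg" and D: "derivation D" and \<theta>: "\<And>f. f \<in> A \<Longrightarrow> \<theta> f = id_plus_t D (jet f)"
    and g: "g \<in> A" "at_t0 g \<noteq> 0" and b: "b \<in> localization A g"
  shows "localized A \<theta> g b = id_plus_t D (jet b)"
proof -
  let ?T = "\<lambda>f. id_plus_t D (jet f)"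
  have gr: "g \<in> reg" and g0: "g \<noteq> 0" using g A reg_lift(2)[of 0] by auto
  have gn: "g ^ n \<in> reg" "inverse (g ^ n) \<in> reg" for n
    using gr g by (simp_all add: reg_power reg_inverse)
  obtain f n where f: "f \<in> A" "b = f / g ^ n" using b by (auto simp: localization_def)
  have br: "b \<in> reg" unfolding f divide_inverse using f A gn reg_mult by blast
  have pow: "mod_t2 (p * ?T g ^ n) = mod_t2 (p * ?T (g ^ n))" for p n
  proof (induction n)
    case 0 show ?case using jet1_lift[of 1] reg_lift(2)[of 1]
      by (simp add: id_plus_t_jet derivation_01[OF D] one_pCons)
  next
    case (Suc n)
    have "mod_t2 (p * ?T g ^ Suc n) = mod_t2 (mod_t2 (p * ?T g ^ n) * ?T g)"
      by (subst mod_t2_mult_left) (simp add: ac_simps)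
    also have "\<dots> = mod_t2 (?T (g ^ n) * ?T g * p)"
      unfolding Suc.IH by (subst mod_t2_mult_left) (simp add: ac_simps)
    also have "\<dots> = mod_t2 (mod_t2 (?T (g ^ n) * ?T g) * p)" by (simp add: mod_t2_mult_left)
    also have "\<dots> = mod_t2 (p * ?T (g ^ Suc n))"
      using id_plus_t_jet_mult[OF D gn(1) gr] by (simp add: mult.commute)
    finally show ?case .
  qed
  show ?thesis unfolding localized_def
  proof (rule the_equality, safe)
    show "degree (?T b) \<le> 1" by (simp add: id_plus_t_def)
    have bg: "b * g ^ n = f" using g0 f(2) by simp
    have "?T f = mod_t2 (?T b * ?T (g ^ n))"
      using id_plus_t_jet_mult[OF D br gn(1), of n] unfolding bg .
    thus "\<exists>f\<in>A. \<exists>n. b = f / g ^ n \<and> mod_t2 (?T b * \<theta> g ^ n) = \<theta> f"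
      using f g by (intro bexI[of _ f] exI[of _ n]) (simp_all add: \<theta> pow)
  next
    fix p f' k
    assume p: "degree p \<le> 1" and f': "f' \<in> A" "b = f' / g ^ k" "mod_t2 (p * \<theta> g ^ k) = \<theta> f'"
    \<comment> \<open>uniqueness: multiply with the value at \<open>1/g\<^sup>k\<close>, the inverse of the value at \<open>g\<^sup>k\<close> modulo \<open>t\<^sup>2\<close>\<close>
    have 1: "?T 1 = 1" using jet1_lift[of 1] reg_lift(2)[of 1]
      by (simp add: id_plus_t_jet derivation_01[OF D] one_pCons)
    have "f' \<in> reg" using f' A by auto
    hence "?T (f' / g ^ k) = mod_t2 (?T f' * ?T (inverse (g ^ k)))"
      unfolding divide_inverse using gn by (intro id_plus_t_jet_mult[OF D])
    also have "\<dots> = mod_t2 (mod_t2 (p * ?T (g ^ k)) * ?T (inverse (g ^ k)))"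
      using f' g by (simp add: \<theta> pow)
    also have "\<dots> = mod_t2 (mod_t2 (?T (g ^ k) * ?T (inverse (g ^ k))) * p)"
      by (simp only: mod_t2_mult_left) (simp add: ac_simps)
    also have "mod_t2 (?T (g ^ k) * ?T (inverse (g ^ k))) = 1"
      using id_plus_t_jet_mult[OF D gn, of k k] g0 by (simp add: 1)
    finally show "p = ?T (f' / g ^ k)" by (simp only: mult_1 mod_t2_small[OF p])
  qed
qed

lemma alg_gen_power: "f \<in> alg_gen G \<Longrightarrow> f ^ n \<in> alg_gen G"
proof (induction n)
  case 0 show ?case using alg_gen.const[of 1 G] by simp
qed (simp add: alg_gen.mult)

lemma alg_gen_0: "0 \<in> alg_gen G" and alg_gen_1: "1 \<in> alg_gen G"
  using alg_gen.const[of 0 G] alg_gen.const[of 1 G] by simp_all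

lemma alg_gen_uminus: "f \<in> alg_gen G \<Longrightarrow> - f \<in> alg_gen G"
  using alg_gen.mult[OF alg_gen.const[of "-1" G]] by simp

lemma alg_gen_minus: "f \<in> alg_gen G \<Longrightarrow> g \<in> alg_gen G \<Longrightarrow> f - g \<in> alg_gen G"
  using alg_gen.add[OF _ alg_gen_uminus] by fastforce

lemma alg_gen_subset: "G \<subseteq> alg_gen H \<Longrightarrow> alg_gen G \<subseteq> alg_gen H"
proof
  fix f assume "f \<in> alg_gen G" "G \<subseteq> alg_gen H"
  thus "f \<in> alg_gen H" by induction (auto intro: alg_gen.intros)
qed

text \<open>
  The additional generator of the charts that do not meet the line of the slice.
\<close>

abbreviation "u_fun \<equiv> lift_t y_var * inverse (lift_t y_var - t_var)"

text \<open>
  One chart of the family, abstracted from the fan: \<open>W\<close> is the monoid of exponents, freely generated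
  by \<open>w1\<close> and \<open>w2\<close>. The set \<open>E\<close> of additional generators is empty or consists of \<open>y/(y - t)\<close>; in
  the latter case \<open>1/y\<close> belongs to the chart.
\<close>

locale chart =
  fixes a lam :: int and w1 w2 :: lattice and W :: "lattice set" and E :: "ratfun_t set"
  assumes a: "a = 1 \<or> a = - 1"
    and basis: "\<bar>det2 w1 w2\<bar> = 1"
    and W0: "0 \<in> W" and W_add: "\<And>v w. v \<in> W \<Longrightarrow> w \<in> W \<Longrightarrow> v + w \<in> W"
    and w12: "w1 \<in> W" "w2 \<in> W"
    and W_gen: "\<And>w. w \<in> W \<Longrightarrow> \<exists>m n. w = (int m * fst w1, int m * snd w1) + (int n * fst w2, int n * snd w2)"
    and E: "E = {} \<or> E = {u_fun} \<and> a = 1 \<and> lam = 0 \<and> (0, - 1) \<in> W"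
begin

abbreviation "Z \<equiv> Z_tilde a lam"

definition "A = alg_gen ({t_var, Z w1, Z w2} \<union> E)"

definition "A0 = char_span const_xy chi W"

abbreviation "deformed_span \<equiv> char_span (\<lambda>c. lift_t (const_xy c)) Z W"

lemma t_in_A: "t_var \<in> A" unfolding A_def by (intro alg_gen.gen) auto

lemma A_closed: "f \<in> A \<Longrightarrow> g \<in> A \<Longrightarrow> f + g \<in> A" "f \<in> A \<Longrightarrow> g \<in> A \<Longrightarrow> f * g \<in> A"
  "lift_t (const_xy c) \<in> A" "0 \<in> A" "1 \<in> A"
  unfolding A_def by (auto intro: alg_gen.intros alg_gen_0 alg_gen_1)

lemma Z_in_A: assumes "w \<in> W" shows "Z w \<in> A"
proof -
  obtain m n where w: "w = (int m * fst w1, int m * snd w1) + (int n * fst w2, int n * snd w2)"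
    using W_gen[OF assms] by blast
  show ?thesis unfolding w Z_tilde.Z_add Z_tilde.Z_power A_def
    by (intro alg_gen.mult alg_gen_power alg_gen.gen) auto
qed

lemma deformed_span_subset_A: "deformed_span \<subseteq> A"
proof
  fix f assume "f \<in> deformed_span"
  thus "f \<in> A" by (induction rule: Z_tilde.span_induct) (auto intro: A_closed Z_in_A)
qed

text \<open>
  The only generator not visibly of this form is \<open>u = y/(y - t)\<close>, and \<open>u = 1 + t (1/y) u\<close> with
  \<open>1/y\<close> in the ring. The decomposition is preserved by products.
\<close>

lemma A_decomp:
  assumes "f \<in> A" obtains F g where "F \<in> deformed_span" "g \<in> A" "f = F + t_var * g"
proof -
  let ?P = "\<lambda>f. \<exists>F\<in>deformed_span. \<exists>g\<in>A. f = F + t_var * g"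
  have deformed_span: "?P f" if "f \<in> deformed_span" for f
    using that A_closed(4) by (intro bexI[of _ f] bexI[of _ 0]) auto
  from assms[unfolded A_def] have "?P f"
  proof induction
    case (const c) show ?case by (intro deformed_span Z_tilde.span_const W0)
  next
    case (gen f)
    then consider "f = t_var" | "f = Z w1 \<or> f = Z w2" | "f \<in> E" by auto
    thus ?case
    proof cases
      case 1 thus ?thesis using Z_tilde.span_0 A_closed(5) by (intro bexI[of _ 0] bexI[of _ 1]) auto
    next
      case 2 thus ?thesis using Z_tilde.span_char[of w1 W 1 a lam] Z_tilde.span_char[of w2 W 1 a lam] w12 by (auto intro!: deformed_span)
    next
      case 3
      hence e: "f = u_fun" "a = 1" "lam = 0" "(0, - 1) \<in> W" "E = {u_fun}" using E by auto
      have "u_fun \<in> A" unfolding A_def by (intro alg_gen.gen) (simp add: e(5))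
      hence "Z (0, - 1) * u_fun \<in> A" by (rule A_closed(2)[OF Z_in_A[OF e(4)]])
      moreover have "f = 1 + t_var * (Z (0, - 1) * u_fun)"
        using e by (simp add: Z_tilde_def Let_def power_int_minus field_simps)
      moreover have "1 \<in> deformed_span" using Z_tilde.span_const[OF W0, of 1] by simp
      ultimately show ?thesis by blast
    qed
  next
    case (add f f')
    then obtain F g F' g' where *: "F \<in> deformed_span" "g \<in> A" "f = F + t_var * g"
      "F' \<in> deformed_span" "g' \<in> A" "f' = F' + t_var * g'" by blast
    have "f + f' = (F + F') + t_var * (g + g')" using * by (simp add: algebra_simps)
    thus ?case using * Z_tilde.span_add A_closed(1) by blast
  next
    case (mult f f')
    then obtain F g F' g' where *: "F \<in> deformed_span" "g \<in> A" "f = F + t_var * g"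
      "F' \<in> deformed_span" "g' \<in> A" "f' = F' + t_var * g'" by blast
    have "f * f' = F * F' + t_var * (F * g' + (g * F' + t_var * (g * g')))"
      using * by (simp add: algebra_simps)
    moreover have "F \<in> A" "F' \<in> A" using * deformed_span_subset_A by auto
    hence "F * g' + (g * F' + t_var * (g * g')) \<in> A" using * A_closed t_in_A by auto
    moreover have "F * F' \<in> deformed_span" using * Z_tilde.span_mult[OF W_add] by blast
    ultimately show ?case by blast
  qed
  thus thesis using that by blast
qed

lemma A_reg: "A \<subseteq> reg"
proof
  fix f assume "f \<in> A"
  thus "f \<in> reg" unfolding A_def
  proof induction
    case (gen f)
    have "u_fun \<in> reg" by (intro reg_mult reg_inverse) simp_all
    thus ?case using gen E by (auto simp: Z_tilde_expand)
  qed (auto simp: reg_add reg_mult)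
qed

lemma deformed_span_jet:
  assumes "F \<in> deformed_span"
  shows "at_t0 F \<in> A0" "jet1 F = - trivializing_field a lam (at_t0 F)" "F \<in> reg"
proof -
  note [simp] = reg_add reg_mult jet1_add jet1_mult Z_tilde_expand derivation_01[OF derivation_trivializing_field]
    derivation_add[OF derivation_trivializing_field] derivation_mult[OF derivation_trivializing_field]
    derivation_const[OF derivation_trivializing_field]
  have "at_t0 F \<in> A0 \<and> jet1 F = - trivializing_field a lam (at_t0 F) \<and> F \<in> reg"
    using assms
  proof (induction rule: Z_tilde.span_induct)
    case zero show ?case using jet1_lift[of 0] reg_lift[of 0] by (simp add: A0_def chi.span_0)
  next
    case (insert f w c)
    thus ?case by (auto simp: A0_def chi.span_insert)
  qed
  thus "at_t0 F \<in> A0" "jet1 F = - trivializing_field a lam (at_t0 F)" "F \<in> reg" by auto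
qed

lemma at_t0_A: "f \<in> A \<Longrightarrow> at_t0 f \<in> A0"
proof -
  assume "f \<in> A"
  then obtain F g where "F \<in> deformed_span" "g \<in> A" "f = F + t_var * g" by (rule A_decomp)
  thus ?thesis using A_reg deformed_span_jet by (auto simp: reg_add reg_mult)
qed

text \<open>
  So the fibre of the chart over \<open>t = 0\<close> is the toric chart. In the decomposition \<open>f = F + t g\<close>, the restriction of
  \<open>F\<close> to \<open>t = 0\<close> is a vanishing combination of characters, so that \<open>F = 0\<close>.
\<close>

lemma vanishing_A:
  assumes "f \<in> A" "at_t0 f = 0" obtains g where "g \<in> A" "f = t_var * g"
proof -
  obtain F g where *: "F \<in> deformed_span" "g \<in> A" "f = F + t_var * g" using assms(1) by (rule A_decomp)
  have F0: "at_t0 F = 0" using * assms A_reg deformed_span_jet(3) by (auto simp: reg_add reg_mult)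
  obtain S c where S: "F = (\<Sum>w\<in>S. lift_t (const_xy (c w)) * Z w)" "finite S"
    using *(1) by (auto simp: char_span_def)
  have "at_t0 F = (\<Sum>w\<in>S. const_xy (c w) * chi w) \<and> F \<in> reg"
    unfolding S(1) using S(2) reg_lift[of 0]
    by (induction S rule: finite_induct) (simp_all add: reg_add reg_mult Z_tilde_expand)
  hence "c w = 0" if "w \<in> S" for w using characters_independent[OF S(2) _ that] F0 by simp
  hence "F = 0" unfolding S(1) by (intro sum.neutral) simp
  thus thesis using that * by auto
qed

text \<open>
  On \<open>F + t g\<close> with \<open>F\<close> a combination of deformed monomials, this map takes the value
  \<open>F|\<^sub>t\<^sub>=\<^sub>0 + t g|\<^sub>t\<^sub>=\<^sub>0\<close>, because \<open>\<delta>\<close> cancels the first-order part of \<open>F\<close>. Surjectivity is then clear,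
  and two applications of \<open>vanishing_A\<close> give the kernel.
\<close>

lemma standard_trivialization:
  "trivialization A0 A (\<lambda>f. id_plus_t (trivializing_field a lam) (jet f))"
  (is "trivialization A0 A ?T")
proof -
  let ?D = "trivializing_field a lam"
  note D = derivation_trivializing_field[of a lam]
  have r: "f \<in> A \<Longrightarrow> f \<in> reg" for f using A_reg by auto
  have decomp: "?T (F + t_var * g) = [:at_t0 F, at_t0 g:]" if "F \<in> deformed_span" "g \<in> A" for F g
    using deformed_span_jet[OF that(1)] r[OF that(2)]
    by (simp add: id_plus_t_jet reg_add reg_mult jet1_add jet1_mult)
  have lift: "\<exists>F\<in>deformed_span. at_t0 F = u" if "u \<in> A0" for u
    using that unfolding A0_def
  proof (induction rule: chi.span_induct)
    case zero show ?case using Z_tilde.span_0 reg_lift(2)[of 0] by force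
  next
    case (insert f w c)
    then obtain F where F: "F \<in> deformed_span" "at_t0 F = f" by auto
    have "F + lift_t (const_xy c) * Z w \<in> deformed_span" using F insert by (simp add: Z_tilde.span_insert)
    moreover have "at_t0 (F + lift_t (const_xy c) * Z w) = f + const_xy c * chi w"
      using F deformed_span_jet by (simp add: reg_add reg_mult Z_tilde_expand)
    ultimately show ?case by blast
  qed
  show ?thesis unfolding trivialization_def
  proof (intro conjI ballI allI)
    fix f g assume fg: "f \<in> A" "g \<in> A"
    show "?T (f + g) = ?T f + ?T g"
      using r[OF fg(1)] r[OF fg(2)] by (simp add: id_plus_t_jet reg_add jet1_add derivation_add D)
    show "?T (f * g) = mod_t2 (?T f * ?T g)" using r fg D by (intro id_plus_t_jet_mult)
  next
    fix c show "?T (lift_t (const_xy c)) = [:const_xy c:]" by (simp add: id_plus_t_jet derivation_const D)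
  next
    show "?T t_var = [:0, 1:]" by (simp add: id_plus_t_jet derivation_01 D)
  next
    show "?T ` A = first_order A0"
    proof (intro equalityI subsetI)
      fix p assume "p \<in> ?T ` A"
      then obtain f where f: "f \<in> A" "p = ?T f" by auto
      then obtain F g where *: "F \<in> deformed_span" "g \<in> A" "f = F + t_var * g" using A_decomp by blast
      show "p \<in> first_order A0" unfolding f(2) *(3) decomp[OF *(1,2)] first_order_def
        using deformed_span_jet(1)[OF *(1)] at_t0_A[OF *(2)] by blast
    next
      fix p assume "p \<in> first_order A0"
      then obtain u v where p: "p = [:u, v:]" "u \<in> A0" "v \<in> A0" by (auto simp: first_order_def)
      obtain F G where FG: "F \<in> deformed_span" "at_t0 F = u" "G \<in> deformed_span" "at_t0 G = v" using lift p by meson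
      have "p = ?T (F + t_var * G)" using decomp[of F G] FG p deformed_span_subset_A by auto
      moreover have "F + t_var * G \<in> A" using FG deformed_span_subset_A by (intro A_closed(1) A_closed(2)[OF t_in_A]) auto
      ultimately show "p \<in> ?T ` A" by blast
    qed
  next
    show "{f \<in> A. ?T f = 0} = (\<lambda>g. t_var\<^sup>2 * g) ` A"
    proof (intro equalityI subsetI)
      fix f assume "f \<in> {f \<in> A. ?T f = 0}"
      hence f: "f \<in> A" "?T f = 0" by auto
      hence "at_t0 f = 0" by (simp add: id_plus_t_jet)
      then obtain g where g: "g \<in> A" "f = t_var * g" using vanishing_A f by blast
      have "?T f = [:0, at_t0 g:]" unfolding g(2) using r[OF g(1)]
        by (simp add: id_plus_t_jet reg_mult jet1_mult derivation_01 D)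
      hence "at_t0 g = 0" using f by simp
      then obtain h where "h \<in> A" "g = t_var * h" using vanishing_A g by blast
      thus "f \<in> (\<lambda>g. t_var\<^sup>2 * g) ` A" using g by (auto simp: power2_eq_square algebra_simps)
    next
      fix f assume "f \<in> (\<lambda>g. t_var\<^sup>2 * g) ` A"
      then obtain g where g: "g \<in> A" "f = t_var * (t_var * g)"
        by (auto simp: power2_eq_square algebra_simps)
      have "?T f = 0" unfolding g(2) using r[OF g(1)]
        by (simp add: id_plus_t_jet reg_mult jet1_mult derivation_01 D)
      moreover have "f \<in> A" unfolding g(2) by (intro A_closed(2) t_in_A g(1))
      ultimately show "f \<in> {f \<in> A. ?T f = 0}" by simp
    qed
  qed (simp add: id_plus_t_jet)
qed

text \<open>
  A derivation acts on \<open>\<chi>\<^sup>w\<close> through a logarithmic derivative that is additive in \<open>w\<close>, so it can be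
  prescribed on a basis of \<open>M\<close>; the logarithmic derivatives \<open>p\<close> and \<open>q\<close> of \<open>x\<close> and \<open>y\<close> come from
  Cramer's rule.
\<close>

lemma prescribed_derivation: "\<exists>D. derivation D \<and> D (chi w1) = u1 \<and> D (chi w2) = u2"
proof -
  let ?d = "of_int (det2 w1 w2) :: ratfun"
  let ?a1 = "u1 / chi w1" and ?a2 = "u2 / chi w2"
  define p where "p = ?d * (?a1 * of_int (snd w2) - ?a2 * of_int (snd w1))"
  define q where "q = ?d * (of_int (fst w1) * ?a2 - of_int (fst w2) * ?a1)"
  define D where "D = (\<lambda>f. p * x_var * partial_x f + q * y_var * partial_y f)"
  have D: "derivation D" unfolding D_def by (intro derivation_combination) simp_all
  have "det2 w1 w2 = 1 \<or> det2 w1 w2 = - 1" using basis by linarith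
  hence "det2 w1 w2 * det2 w1 w2 = 1" by auto
  hence "?d * ?d = 1" by (metis of_int_1 of_int_mult)
  hence dd: "?d * (of_int (fst w1) * of_int (snd w2) - of_int (snd w1) * of_int (fst w2)) = 1"
    by (simp add: det2_def)
  have "of_int (fst w1) * p + of_int (snd w1) * q =
      ?d * (of_int (fst w1) * of_int (snd w2) - of_int (snd w1) * of_int (fst w2)) * ?a1"
    "of_int (fst w2) * p + of_int (snd w2) * q =
      ?d * (of_int (fst w1) * of_int (snd w2) - of_int (snd w1) * of_int (fst w2)) * ?a2"
    unfolding p_def q_def by (simp_all add: algebra_simps)
  hence "of_int (fst w1) * p + of_int (snd w1) * q = ?a1" "of_int (fst w2) * p + of_int (snd w2) * q = ?a2"
    unfolding dd by simp_all
  moreover have "D x_var / x_var = p" "D y_var / y_var = q" by (simp_all add: D_def)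
  ultimately have "D (chi w1) = u1" "D (chi w2) = u2"
    unfolding derivation_chi[OF D] by (simp_all)
  thus ?thesis using D by blast
qed

lemma derivation_eq_chart:
  assumes D: "derivation D" and D': "derivation D'"
    and 1: "D (chi w1) = D' (chi w1)" and 2: "D (chi w2) = D' (chi w2)"
  shows "D = D'"
proof -
  let ?p = "D x_var / x_var - D' x_var / x_var" and ?q = "D y_var / y_var - D' y_var / y_var"
  have "of_int (fst w1) * ?p + of_int (snd w1) * ?q = 0" "of_int (fst w2) * ?p + of_int (snd w2) * ?q = 0"
    using 1 2 by (simp_all add: derivation_chi D D') (simp_all add: algebra_simps)
  hence "of_int (det2 w1 w2) * ?p = 0" "of_int (det2 w1 w2) * ?q = 0"
    unfolding det2_def of_int_diff of_int_mult by algebra+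
  moreover have "det2 w1 w2 = 1 \<or> det2 w1 w2 = - 1" using basis by linarith
  ultimately have "?p = 0" "?q = 0" by auto
  thus ?thesis by (intro derivation_eqI D D') (simp_all add: field_simps)
qed

text \<open>
  Modulo \<open>t\<close> the value of \<open>\<theta>\<close> at a deformed monomial is \<open>\<chi>\<^sup>w\<close>. Its first-order part is multiplicative
  in the way of a derivation, so one derivation \<open>D\<close> of the function field that is right for the two
  generators is right for all deformed monomials, and then on the ring, which is their span up to
  \<open>t\<close>. The first-order parts lie in the toric ring, which is therefore preserved by \<open>D\<close>.
\<close>

lemma trivialization_form:
  assumes "trivialization A0 A \<theta>"
  obtains D where "derivation D" "\<And>f. f \<in> A \<Longrightarrow> \<theta> f = id_plus_t (\<lambda>f. D f + trivializing_field a lam f) (jet f)"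
    "D ` A0 \<subseteq> A0"
proof -
  from assms have add: "\<And>f g. f \<in> A \<Longrightarrow> g \<in> A \<Longrightarrow> \<theta> (f + g) = \<theta> f + \<theta> g"
    and mult: "\<And>f g. f \<in> A \<Longrightarrow> g \<in> A \<Longrightarrow> \<theta> (f * g) = mod_t2 (\<theta> f * \<theta> g)"
    and const: "\<And>c. \<theta> (lift_t (const_xy c)) = [:const_xy c:]" and t: "\<theta> t_var = [:0, 1:]"
    and im: "\<theta> ` A = first_order A0" and red: "\<And>f. f \<in> A \<Longrightarrow> coeff (\<theta> f) 0 = at_t0 f"
    unfolding trivialization_def by auto
  have form: "\<theta> f = [:at_t0 f, coeff (\<theta> f) 1:]" "coeff (\<theta> f) 1 \<in> A0" if "f \<in> A" for f
  proof -
    have "\<theta> f \<in> first_order A0" using im that by blast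
    then obtain u v where *: "\<theta> f = [:u, v:]" "u \<in> A0" "v \<in> A0" by (auto simp: first_order_def)
    thus "\<theta> f = [:at_t0 f, coeff (\<theta> f) 1:]" "coeff (\<theta> f) 1 \<in> A0" using red[OF that] by auto
  qed
  obtain D where D: "derivation D" "D (chi w1) = coeff (\<theta> (Z w1)) 1" "D (chi w2) = coeff (\<theta> (Z w2)) 1"
    using prescribed_derivation by blast
  \<comment> \<open>the elements whose value under \<open>\<theta>\<close> is explained by \<open>D\<close> alone form a subring with all deformed monomials\<close>
  define G where "G = {f \<in> A. \<theta> f = [:at_t0 f, D (at_t0 f):]}"
  have r: "f \<in> A \<Longrightarrow> f \<in> reg" for f using A_reg by auto
  have G_mult: "f * g \<in> G" if "f \<in> G" "g \<in> G" for f g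
    using that r unfolding G_def
    by (auto simp: A_closed mult mod_t2_prod reg_mult derivation_mult[OF D(1)] add.commute
        simp del: mult_pCons_left mult_pCons_right)
  have G_add: "f + g \<in> G" if "f \<in> G" "g \<in> G" for f g
    using that r unfolding G_def
    by (auto simp: A_closed add reg_add derivation_add[OF D(1)])
  have G_const: "lift_t (const_xy c) \<in> G" for c
    by (simp add: G_def A_closed const derivation_const[OF D(1)])
  have G_pow: "f ^ n \<in> G" if "f \<in> G" for f n
    using that G_const[of 1] by (induction n) (auto intro: G_mult)
  have "Z w1 \<in> G" "Z w2 \<in> G" unfolding G_def
    using Z_in_A w12 form[of "Z w1"] form[of "Z w2"] D by (auto simp: Z_tilde_expand)
  hence GZ: "Z w \<in> G" if wW: "w \<in> W" for w
  proof -
    obtain m n where w: "w = (int m * fst w1, int m * snd w1) + (int n * fst w2, int n * snd w2)"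
      using W_gen[OF wW] by blast
    show ?thesis unfolding w Z_tilde.Z_add Z_tilde.Z_power
      by (intro G_mult G_pow) fact+
  qed
  have G_span: "F \<in> G" if "F \<in> deformed_span" for F
    using that
  proof (induction rule: Z_tilde.span_induct)
    case zero show ?case using G_const[of 0] by simp
  qed (auto intro: G_add G_mult G_const GZ)
  show thesis
  proof (rule that[OF D(1)])
    fix f assume "f \<in> A"
    then obtain F g where *: "F \<in> deformed_span" "g \<in> A" "f = F + t_var * g" using A_decomp by blast
    have FA: "F \<in> A" "t_var * g \<in> A" using * deformed_span_subset_A A_closed(2)[OF t_in_A] by auto
    have "\<theta> f = \<theta> F + mod_t2 (\<theta> t_var * \<theta> g)"
      unfolding *(3) using FA * t_in_A by (simp add: add mult)
    also have "\<dots> = [:at_t0 F, D (at_t0 F) + at_t0 g:]"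
      using G_span[OF *(1)] by (subst form(1)[OF *(2)]) (simp add: t mod_t2_prod G_def del: mult_pCons_left mult_pCons_right)
    also have "\<dots> = id_plus_t (\<lambda>f. D f + trivializing_field a lam f) (jet f)"
      unfolding *(3) using deformed_span_jet[OF *(1)] r[OF *(2)]
      by (simp add: id_plus_t_jet reg_add reg_mult jet1_add jet1_mult)
    finally show "\<theta> f = id_plus_t (\<lambda>f. D f + trivializing_field a lam f) (jet f)" .
  next
    show "D ` A0 \<subseteq> A0"
    proof
      fix v assume "v \<in> D ` A0"
      then obtain f where f: "f \<in> A0" "v = D f" by auto
      from f(1) have "D f \<in> A0" unfolding A0_def
      proof (induction rule: chi.span_induct)
        case zero show ?case by (simp add: derivation_01[OF D(1)] chi.span_0)
      next
        case (insert f w c)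
        have "D (chi w) \<in> A0"
          using GZ[OF \<open>w \<in> W\<close>] form(2)[OF Z_in_A[OF \<open>w \<in> W\<close>]] by (simp add: G_def Z_tilde_expand)
        hence "const_xy c * D (chi w) \<in> A0"
          unfolding A0_def by (intro chi.span_mult[OF W_add] chi.span_const W0)
        thus ?case using insert
          by (simp add: A0_def derivation_add derivation_mult derivation_const D(1) chi.span_add)
      qed
      thus "v \<in> A0" using f by simp
    qed
  qed
qed

end

section \<open>Common localizations of adjacent charts\<close>

lemma localization_closed:
  "f \<in> alg_gen G \<Longrightarrow> f / g ^ n \<in> localization (alg_gen G) g"
  "f \<in> alg_gen G \<Longrightarrow> f \<in> localization (alg_gen G) g"
  "g \<in> alg_gen G \<Longrightarrow> g \<noteq> 0 \<Longrightarrow> f \<in> localization (alg_gen G) g \<Longrightarrow> f' \<in> localization (alg_gen G) g \<Longrightarrow>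
    f + f' \<in> localization (alg_gen G) g"
  "f \<in> localization (alg_gen G) g \<Longrightarrow> f' \<in> localization (alg_gen G) g \<Longrightarrow>
    f * f' \<in> localization (alg_gen G) g"
proof -
  show *: "f / g ^ n \<in> localization (alg_gen G) g" if "f \<in> alg_gen G" for f n
    using that by (auto simp: localization_def)
  show "f \<in> localization (alg_gen G) g" if "f \<in> alg_gen G"
    using *[OF that, of 0] by simp
  {
    assume g: "g \<in> alg_gen G" "g \<noteq> 0"
      and "f \<in> localization (alg_gen G) g" "f' \<in> localization (alg_gen G) g"
    then obtain h m h' n where h: "f = h / g ^ m" "f' = h' / g ^ n" "h \<in> alg_gen G" "h' \<in> alg_gen G"
      by (auto simp: localization_def)
    have "f + f' = (h * g ^ n + h' * g ^ m) / g ^ (m + n)"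
      using g by (simp add: h power_add field_simps)
    moreover have "h * g ^ n + h' * g ^ m \<in> alg_gen G"
      using g h by (intro alg_gen.add alg_gen.mult alg_gen_power)
    ultimately show "f + f' \<in> localization (alg_gen G) g" using * by simp
  next
    assume "f \<in> localization (alg_gen G) g" "f' \<in> localization (alg_gen G) g"
    then obtain h m h' n where h: "f = h / g ^ m" "f' = h' / g ^ n" "h \<in> alg_gen G" "h' \<in> alg_gen G"
      by (auto simp: localization_def)
    have "f * f' = (h * h') / g ^ (m + n)" by (simp add: h power_add)
    moreover have "h * h' \<in> alg_gen G" using h by (intro alg_gen.mult)
    ultimately show "f * f' \<in> localization (alg_gen G) g" using * by (simp only:)
  }
qed

text \<open>
  How all localizations below are computed: generators of either side are compared with the other side.
\<close>

lemma localization_eqI: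
  assumes g: "g \<in> alg_gen G" "g \<noteq> 0" and inv: "inverse g \<in> alg_gen H"
    and GH: "G \<subseteq> alg_gen H" and HG: "H \<subseteq> localization (alg_gen G) g"
  shows "localization (alg_gen G) g = alg_gen H"
proof (intro equalityI subsetI)
  fix f assume "f \<in> localization (alg_gen G) g"
  then obtain h n where h: "h \<in> alg_gen G" "f = h / g ^ n" by (auto simp: localization_def)
  have "h \<in> alg_gen H" using alg_gen_subset[OF GH] h by auto
  hence "h * inverse g ^ n \<in> alg_gen H" by (intro alg_gen.mult alg_gen_power inv)
  thus "f \<in> alg_gen H" by (simp add: h divide_inverse power_inverse)
next
  fix f assume "f \<in> alg_gen H"
  thus "f \<in> localization (alg_gen G) g"
    by induction (use HG g in \<open>auto intro: localization_closed alg_gen.const\<close>)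
qed

lemma localization_power: assumes "f \<in> localization (alg_gen G) g" shows "f ^ n \<in> localization (alg_gen G) g"
proof (induction n)
  case 0 show ?case using localization_closed(2)[OF alg_gen_1] by simp
qed (simp add: localization_closed(4) assms)

lemma u_fun_nonzero: "u_fun \<noteq> 0"
  by simp

lemma alg_gen_power_int:
  assumes "f \<in> alg_gen G" "inverse f \<in> alg_gen G" shows "f powi n \<in> alg_gen G"
  by (cases n rule: int_cases2)
    (simp_all add: alg_gen_power[OF assms(1)] alg_gen_power[OF assms(2)] power_int_minus flip: power_inverse)

context chart
begin

text \<open>
  If \<open>w0\<close> spans the edge of \<open>W\<close> vanishing on a ray, inverting its deformed monomial enlarges \<open>W\<close> to the
  half-plane \<open>W'\<close> of exponents that are nonnegative on the ray.
\<close>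

lemma localization_character:
  assumes "E = {}" "w0 \<in> W" "W \<subseteq> W'" "- w0 \<in> W'"
    and W': "\<And>w. w \<in> W' \<Longrightarrow> \<exists>n. w + (int n * fst w0, int n * snd w0) \<in> W"
  shows "localization A (Z w0) = alg_gen (insert t_var (Z ` W'))"
  unfolding A_def
proof (rule localization_eqI)
  let ?G = "{t_var, Z w1, Z w2} \<union> E"
  show "Z w0 \<in> alg_gen ?G" using Z_in_A[OF assms(2)] by (simp only: A_def)
  show "Z w0 \<noteq> 0" by (rule Z_tilde.Z_nonzero)
  show "inverse (Z w0) \<in> alg_gen (insert t_var (Z ` W'))"
    using assms(4) by (auto simp flip: Z_tilde.Z_minus intro: alg_gen.gen)
  show "?G \<subseteq> alg_gen (insert t_var (Z ` W'))"
    using assms(1,3) w12 by (auto intro: alg_gen.gen)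
  show "insert t_var (Z ` W') \<subseteq> localization (alg_gen ?G) (Z w0)"
  proof
    fix f assume "f \<in> insert t_var (Z ` W')"
    then consider "f = t_var" | w where "f = Z w" "w \<in> W'" by auto
    thus "f \<in> localization (alg_gen ?G) (Z w0)"
    proof cases
      case 1 thus ?thesis by (auto intro: localization_closed alg_gen.gen)
    next
      case 2
      then obtain n where "w + (int n * fst w0, int n * snd w0) \<in> W" using W' by blast
      from Z_in_A[OF this] have "Z w * Z w0 ^ n \<in> alg_gen ?G"
        unfolding A_def Z_tilde.Z_add Z_tilde.Z_power .
      from localization_closed(1)[OF this, of "Z w0" n] show ?thesis
        using 2 Z_tilde.Z_nonzero by simp
    qed
  qed
qed

text \<open>
  Once \<open>u = y/(y - t)\<close> is a unit, the deformation of the monomials is invisible.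
\<close>

lemma Z_eq_chi_u: "Z w = lift_t (chi w) * u_fun powi (if a = 1 then lam * fst w else - (snd w + lam * fst w))"
  by (simp add: Z_tilde_def Let_def chi_def lift_power_int power_int_mult_distrib)
    (simp add: power_int_add power_int_diff power_int_minus power_int_inverse field_simps)

text \<open>
  When \<open>1/y\<close> is regular along the ray, the right-hand side does not depend on the tuple any more. Besides
  the deformed monomial of \<open>w0\<close>, the element \<open>z = 1 - a t Z(0,-1)\<close> has to be inverted, which is \<open>u\<close>
  or \<open>1/u\<close> and restricts to \<open>1\<close> at \<open>t = 0\<close>. Since \<open>1/y\<close> itself need not belong to the ring of the
  chart, it is multiplied with a power of the monomial of \<open>w0\<close>.
\<close>

lemma localization_pole:
  assumes w0: "w0 \<in> W" and WW': "W \<subseteq> W'" and mw0: "- w0 \<in> W'" and pole: "(0, - 1) \<in> W'"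
    and W': "\<And>w. w \<in> W' \<Longrightarrow> \<exists>n. w + (int n * fst w0, int n * snd w0) \<in> W"
  shows "\<exists>g\<in>A. at_t0 g \<noteq> 0 \<and>
    localization A g = alg_gen ({t_var, u_fun, inverse u_fun} \<union> (\<lambda>w. lift_t (chi w)) ` W')"
proof -
  let ?G = "{t_var, Z w1, Z w2} \<union> E"
  let ?H = "{t_var, u_fun, inverse u_fun} \<union> (\<lambda>w. lift_t (chi w)) ` W'"
  let ?c = "lift_t (const_xy (of_int a))"
  obtain n where n: "(0, - 1) + (int n * fst w0, int n * snd w0) \<in> W" using W'[OF pole] by blast
  define z where "z = 1 - ?c * t_var * Z (0, - 1)"
  define g where "g = Z w0 ^ Suc n * z"
  \<comment> \<open>one factor less than in \<open>g\<close>, so that \<open>h/g\<close> is the inverse of the deformed monomial of \<open>w0\<close>\<close>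
  define h where "h = Z w0 ^ n * z"
  have u: "u_fun = z \<or> u_fun = inverse z"
    using a by (auto simp: z_def Z_tilde_def Let_def power_int_minus field_simps)
  have z0: "z \<noteq> 0" using u u_fun_nonzero by (metis inverse_zero)
  have intA: "?c \<in> A" by (rule A_closed(3))
  have hA: "h \<in> A"
  proof -
    have "h = Z w0 ^ n - ?c * t_var * Z ((0, - 1) + (int n * fst w0, int n * snd w0))"
      unfolding Z_tilde.Z_add Z_tilde.Z_power by (simp add: h_def z_def algebra_simps)
    moreover have "Z w0 ^ n \<in> A" "Z ((0, - 1) + (int n * fst w0, int n * snd w0)) \<in> A"
      using Z_in_A[OF n] Z_in_A[OF w0] alg_gen_power by (auto simp only: A_def)
    ultimately show ?thesis using intA t_in_A by (auto simp: A_def intro: alg_gen_minus alg_gen.mult)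
  qed
  have gA: "g \<in> A"
  proof -
    have "g = Z w0 * h" by (simp add: g_def h_def)
    thus ?thesis using hA Z_in_A[OF w0] A_closed(2) by auto
  qed
  have g0: "g \<noteq> 0" using z0 Z_tilde.Z_nonzero by (simp add: g_def)
  have "at_t0 g = chi w0 ^ Suc n" 
  proof -
    have "at_t0 z = 1" "z \<in> reg"
      using reg_lift[of 1] by (simp_all add: z_def reg_diff reg_mult Z_tilde_expand)
    thus ?thesis unfolding g_def by (simp add: reg_mult reg_power Z_tilde_expand del: power_Suc)
  qed
  hence nz: "at_t0 g \<noteq> 0" by simp
  have chiH: "lift_t (chi w) \<in> alg_gen ?H" if "w \<in> W'" for w using that by (auto intro: alg_gen.gen)
  have uH: "u_fun powi k \<in> alg_gen ?H" for k
    by (intro alg_gen_power_int alg_gen.gen) auto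
  have ZH: "Z w \<in> alg_gen ?H" if "w \<in> W'" for w
    unfolding Z_eq_chi_u using chiH[OF that] uH by (intro alg_gen.mult)
  let ?L = "localization (alg_gen ?G) g"
  have AL: "f \<in> ?L" if "f \<in> A" for f using that unfolding A_def by (rule localization_closed(2))
  note L = localization_closed(3)[OF gA[unfolded A_def] g0] localization_closed(4)[of _ ?G g]
  have "localization (alg_gen ?G) g = alg_gen ?H"
  proof (rule localization_eqI)
    show "g \<in> alg_gen ?G" using gA by (simp only: A_def)
    have "inverse z \<in> alg_gen ?H" using u uH[of 1] uH[of "-1"] by (auto simp: power_int_minus)
    moreover have "inverse (Z w0) \<in> alg_gen ?H" using ZH[OF mw0] by (simp only: Z_tilde.Z_minus)
    moreover have "inverse g = inverse (Z w0) ^ Suc n * inverse z"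
      by (simp add: g_def power_inverse del: power_Suc)
    ultimately show "inverse g \<in> alg_gen ?H" by (simp only: alg_gen.mult alg_gen_power)
    have "t_var \<in> alg_gen ?H" "u_fun \<in> alg_gen ?H"
      by (intro alg_gen.gen; simp)+
    moreover have "Z w1 \<in> alg_gen ?H" "Z w2 \<in> alg_gen ?H"
      by (rule ZH[OF subsetD[OF WW' w12(1)]], rule ZH[OF subsetD[OF WW' w12(2)]])
    ultimately show "?G \<subseteq> alg_gen ?H" using E by blast
    have Zinv: "inverse (Z w0) \<in> ?L"
    proof -
      have "h / g ^ 1 = inverse (Z w0)" using z0 Z_tilde.Z_nonzero[of a lam w0] by (simp add: g_def h_def field_simps)
      thus ?thesis using localization_closed(1)[OF hA[unfolded A_def], of g 1] by simp
    qed
    have ZL: "Z w \<in> ?L" if w: "w \<in> W'" for w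
    proof -
      obtain k where k: "w + (int k * fst w0, int k * snd w0) \<in> W" using W'[OF w] by blast
      have "Z w = Z (w + (int k * fst w0, int k * snd w0)) * inverse (Z w0) ^ k"
        unfolding Z_tilde.Z_add Z_tilde.Z_power using Z_tilde.Z_nonzero[of a lam w0] by (simp add: field_simps)
      thus ?thesis using L(2)[OF AL[OF Z_in_A[OF k]] localization_power[OF Zinv]] by simp
    qed
    have zL: "z \<in> ?L"
    proof -
      have "- ?c * t_var \<in> A" using A_closed(2)[OF intA t_in_A] alg_gen_uminus by (auto simp: A_def)
      from L(2)[OF AL[OF this] ZL[OF pole]] have "- ?c * t_var * Z (0, - 1) \<in> ?L" .
      from L(1)[OF AL[OF A_closed(5)] this] show ?thesis by (simp add: z_def)
    qed
    have zinvL: "inverse z \<in> ?L"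
    proof -
      have "Z w0 ^ Suc n / g ^ 1 = inverse z" using z0 Z_tilde.Z_nonzero[of a lam w0] by (simp add: g_def field_simps)
      moreover have "Z w0 ^ Suc n \<in> alg_gen ?G" using Z_in_A[OF w0] alg_gen_power by (simp only: A_def)
      ultimately show ?thesis using localization_closed(1)[of "Z w0 ^ Suc n" ?G g 1] by simp
    qed
    have uL: "u_fun \<in> ?L" "inverse u_fun \<in> ?L"
      using u zL zinvL by (elim disjE; simp only: inverse_inverse_eq)+
    hence uL': "u_fun powi k \<in> ?L" for k
      by (cases k rule: int_cases2)
        (simp_all add: localization_power power_int_minus flip: power_inverse)
    have "lift_t (chi w) \<in> ?L" if "w \<in> W'" for w
    proof -
      define k where "k = (if a = 1 then lam * fst w else - (snd w + lam * fst w))"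
      have "Z w = lift_t (chi w) * u_fun powi k" unfolding k_def by (rule Z_eq_chi_u)
      hence "Z w * u_fun powi (- k) = lift_t (chi w)"
        using u_fun_nonzero by (simp add: power_int_minus)
      thus ?thesis using L(2)[OF ZL[OF that] uL'[of "- k"]] by simp
    qed
    thus "?H \<subseteq> ?L" using AL[OF t_in_A] uL by auto
  qed (rule g0)
  thus ?thesis using gA nz unfolding A_def by blast
qed

end

text \<open>
  Here the ray is spanned by \<open>(p, 1)\<close> with \<open>p = \<lambda>\<^sub>i\<^sub>-\<^sub>1 + \<lambda>\<^sub>i\<close>, and the sign of the tuple changes.
  The exponents \<open>(r, - p r)\<close> vanishing on the ray have the same deformed monomial on both
  sides, thanks to the condition on \<open>p\<close>. The remaining generator of exponent \<open>(0, 1)\<close> is \<open>y\<close> on one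
  side and \<open>y - t\<close> on the other.
\<close>

lemma wall_ring_subset:
  assumes a: "a = 1 \<or> a = - 1" and p: "p = lam + mu" and W': "W' = {w. p * fst w + snd w \<ge> 0}"
  shows "insert t_var (Z_tilde a lam ` W') \<subseteq> alg_gen (insert t_var (Z_tilde (- a) mu ` W'))"
proof
  let ?S = "alg_gen (insert t_var (Z_tilde (- a) mu ` W'))"
  fix f assume "f \<in> insert t_var (Z_tilde a lam ` W')"
  then consider "f = t_var" | w where "f = Z_tilde a lam w" "w \<in> W'" by auto
  thus "f \<in> ?S"
  proof cases
    case 1 thus ?thesis by (auto intro: alg_gen.gen)
  next
    case 2
    define k where "k = nat (p * fst w + snd w)"
    have "int k = p * fst w + snd w" using 2 W' by (simp add: k_def)
    hence w: "w = (fst w, - p * fst w) + (int k * fst (0, 1 :: int), int k * snd (0 :: int, 1))" by (cases w) simp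
    have S: "Z_tilde (- a) mu v \<in> ?S" if "v \<in> W'" for v using that by (auto intro: alg_gen.gen)
    have 01: "(0, 1) \<in> W'" "(fst w, - p * fst w) \<in> W'" using W' by auto
    have eq: "Z_tilde a lam (fst w, - p * fst w) = Z_tilde (- a) mu (fst w, - p * fst w)"
      using a by (auto simp: Z_tilde_def Let_def p algebra_simps)
    have "Z_tilde a lam (0, 1) = Z_tilde (- a) mu (0, 1) + lift_t (const_xy (of_int a)) * t_var"
      using a lift_simps(5)[of 1] by (auto simp: Z_tilde_def Let_def)
    also have "\<dots> \<in> ?S" by (intro alg_gen.add[OF S[OF 01(1)]] alg_gen.mult alg_gen.const alg_gen.gen) simp
    finally have 1: "Z_tilde a lam (0, 1) \<in> ?S" .
    have "Z_tilde a lam w = Z_tilde (- a) mu (fst w, - p * fst w) * Z_tilde a lam (0, 1) ^ k"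
      by (subst w) (simp only: Z_tilde.Z_add Z_tilde.Z_power eq)
    thus ?thesis using 2 S[OF 01(2)] alg_gen_power[OF 1] by (simp add: alg_gen.mult)
  qed
qed

lemma wall_ring_eq:
  assumes a: "a = 1 \<or> a = - 1" and p: "p = lam + mu" and W': "W' = {w. p * fst w + snd w \<ge> 0}"
  shows "alg_gen (insert t_var (Z_tilde a lam ` W')) = alg_gen (insert t_var (Z_tilde (- a) mu ` W'))"
proof (rule equalityI; rule alg_gen_subset)
  show "insert t_var (Z_tilde a lam ` W') \<subseteq> alg_gen (insert t_var (Z_tilde (- a) mu ` W'))"
    by (rule wall_ring_subset[OF a p W'])
  show "insert t_var (Z_tilde (- a) mu ` W') \<subseteq> alg_gen (insert t_var (Z_tilde a lam ` W'))"
  proof -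
    have "- a = 1 \<or> - a = - 1" "p = mu + lam" using a p by auto
    from wall_ring_subset[OF this W'] show ?thesis by (simp only: minus_minus)
  qed
qed

section \<open>Plane cones\<close>

text \<open>
  The integral version of \<open>pairing\<close>.
\<close>

definition ipair :: "lattice \<Rightarrow> lattice \<Rightarrow> int" where
  "ipair w v = fst w * fst v + snd w * snd v"

lemma cone_gen_empty: "cone_gen {} = {(0, 0)}"
  by (auto simp: cone_gen_def)

lemma cone_gen_single: "z \<in> cone_gen {v} \<longleftrightarrow> (\<exists>c\<ge>0. z = (c * of_int (fst v), c * of_int (snd v)))"
proof
  assume "\<exists>c\<ge>0. z = (c * of_int (fst v), c * of_int (snd v))"
  then obtain c where "c \<ge> 0" "z = (c * of_int (fst v), c * of_int (snd v))" by blast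
  thus "z \<in> cone_gen {v}" unfolding cone_gen_def by (intro CollectI exI[of _ "\<lambda>_. c"]) auto
qed (auto simp: cone_gen_def)

lemma cone_gen_pair:
  assumes "v \<noteq> v'"
  shows "z \<in> cone_gen {v, v'} \<longleftrightarrow> (\<exists>c\<ge>0. \<exists>d\<ge>0.
    z = (c * of_int (fst v) + d * of_int (fst v'), c * of_int (snd v) + d * of_int (snd v')))"
proof
  assume "\<exists>c\<ge>0. \<exists>d\<ge>0.
    z = (c * of_int (fst v) + d * of_int (fst v'), c * of_int (snd v) + d * of_int (snd v'))"
  then obtain c d where "c \<ge> 0" "d \<ge> 0"
    "z = (c * of_int (fst v) + d * of_int (fst v'), c * of_int (snd v) + d * of_int (snd v'))" by blast
  thus "z \<in> cone_gen {v, v'}"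
    unfolding cone_gen_def using assms by (intro CollectI exI[of _ "\<lambda>w. if w = v then c else d"]) auto
qed (use assms in \<open>auto simp: cone_gen_def\<close>)

lemma generator_in_cone:
  assumes "finite G" "v \<in> G" shows "(of_int (fst v), of_int (snd v)) \<in> cone_gen G"
proof -
  have "(\<Sum>w\<in>G. (if w = v then 1 else 0) * f w) = (f v :: rat)" for f
    using assms by (simp add: if_distrib[where f = "\<lambda>x. x * _"] cong: if_cong)
  thus ?thesis unfolding cone_gen_def
    by (intro CollectI exI[of _ "\<lambda>w. if w = v then 1 else 0"]) auto
qed

lemma dual_monoid_cone_gen:
  assumes "finite G" shows "dual_monoid (cone_gen G) = {w. \<forall>v\<in>G. ipair w v \<ge> 0}"
proof (intro equalityI subsetI CollectI ballI)
  fix w v assume "w \<in> dual_monoid (cone_gen G)" "v \<in> G"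
  hence "pairing w (of_int (fst v), of_int (snd v)) \<ge> 0"
    using generator_in_cone[OF assms] by (auto simp: dual_monoid_def)
  hence "(of_int (ipair w v) :: rat) \<ge> 0" by (simp add: pairing_def ipair_def)
  thus "ipair w v \<ge> 0" by simp
next
  fix w assume w: "w \<in> {w. \<forall>v\<in>G. ipair w v \<ge> 0}"
  show "w \<in> dual_monoid (cone_gen G)" unfolding dual_monoid_def
  proof (intro CollectI ballI)
    fix z assume "z \<in> cone_gen G"
    then obtain c where c: "\<forall>v\<in>G. c v \<ge> 0"
      "z = ((\<Sum>v\<in>G. c v * of_int (fst v)), (\<Sum>v\<in>G. c v * of_int (snd v)))"
      by (auto simp: cone_gen_def)
    have "pairing w z = (\<Sum>v\<in>G. c v * of_int (ipair w v))"
      by (simp add: c(2) pairing_def ipair_def sum_distrib_left sum.distrib[symmetric] algebra_simps)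
    also have "\<dots> \<ge> 0" using c(1) w by (intro sum_nonneg mult_nonneg_nonneg) auto
    finally show "pairing w z \<ge> 0" .
  qed
qed

lemma det2_nonzero_neq: "det2 v v' \<noteq> 0 \<Longrightarrow> v \<noteq> v'"
  by (auto simp: det2_def)

lemma of_int_det2:
  "(of_int (det2 v v') :: rat) = of_int (fst v) * of_int (snd v') - of_int (snd v) * of_int (fst v')"
  by (simp add: det2_def)

text \<open>
  The two linear forms are the coordinates with respect to the basis \<open>v, v'\<close>.
\<close>

lemma mem_unimodular_cone:
  assumes "det2 v v' = 1"
  shows "z \<in> cone_gen {v, v'} \<longleftrightarrow>
    0 \<le> fst z * of_int (snd v') - snd z * of_int (fst v') \<and>
    0 \<le> of_int (fst v) * snd z - of_int (snd v) * fst z"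
proof -
  have d: "(of_int (fst v) * of_int (snd v') - of_int (snd v) * of_int (fst v') :: rat) = 1"
    using assms of_int_det2[of v v'] by simp
  have vv': "v \<noteq> v'" using assms by (intro det2_nonzero_neq) simp
  show ?thesis
  proof
    assume "z \<in> cone_gen {v, v'}"
    then obtain c e where ce: "c \<ge> 0" "e \<ge> 0"
      "z = (c * of_int (fst v) + e * of_int (fst v'), c * of_int (snd v) + e * of_int (snd v'))"
      unfolding cone_gen_pair[OF vv'] by blast
    have "fst z * of_int (snd v') - snd z * of_int (fst v') =
        c * (of_int (fst v) * of_int (snd v') - of_int (snd v) * of_int (fst v'))"
      "of_int (fst v) * snd z - of_int (snd v) * fst z =
        e * (of_int (fst v) * of_int (snd v') - of_int (snd v) * of_int (fst v'))"
      unfolding ce(3) by (simp_all add: algebra_simps)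
    thus "0 \<le> fst z * of_int (snd v') - snd z * of_int (fst v') \<and>
        0 \<le> of_int (fst v) * snd z - of_int (snd v) * fst z"
      unfolding d using ce by simp
  next
    let ?c = "fst z * of_int (snd v') - snd z * of_int (fst v')"
    let ?e = "of_int (fst v) * snd z - of_int (snd v) * fst z"
    assume *: "0 \<le> ?c \<and> 0 \<le> ?e"
    have "?c * of_int (fst v) + ?e * of_int (fst v') =
        fst z * (of_int (fst v) * of_int (snd v') - of_int (snd v) * of_int (fst v'))"
      "?c * of_int (snd v) + ?e * of_int (snd v') =
        snd z * (of_int (fst v) * of_int (snd v') - of_int (snd v) * of_int (fst v'))"
      by (simp_all add: algebra_simps)
    hence "z = (?c * of_int (fst v) + ?e * of_int (fst v'), ?c * of_int (snd v) + ?e * of_int (snd v'))"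
      unfolding d by (intro prod_eqI) simp_all
    thus "z \<in> cone_gen {v, v'}" unfolding cone_gen_pair[OF vv'] using * by blast
  qed
qed

lemma primitive_parallel:
  assumes "primitive v" "primitive w" "c \<ge> 0"
    and "of_int (fst v) = c * of_int (fst w)" "of_int (snd v) = c * (of_int (snd w) :: rat)"
  shows "v = w"
proof -
  have "(of_int (fst v * snd w) :: rat) = of_int (snd v * fst w)" using assms(4,5) by simp
  hence eq: "fst v * snd w = snd v * fst w" by (simp only: of_int_eq_iff)
  have "\<bar>fst v\<bar> * \<bar>snd w\<bar> = \<bar>snd v\<bar> * \<bar>fst w\<bar>" using eq by (simp flip: abs_mult)
  hence "\<bar>fst v\<bar> = \<bar>fst w\<bar>" "\<bar>snd v\<bar> = \<bar>snd w\<bar>"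
    using coprime_crossproduct_int[of "fst v" "snd v" "fst w" "snd w"] assms(1,2)
    by (auto simp: primitive_def coprime_commute mult.commute)
  moreover have "0 \<le> fst v \<longleftrightarrow> 0 \<le> fst w" "0 \<le> snd v \<longleftrightarrow> 0 \<le> snd w"
  proof -
    have "c \<noteq> 0" using assms by (auto simp: primitive_def)
    hence c: "c > 0" using assms(3) by simp
    have "0 \<le> (of_int (fst v) :: rat) \<longleftrightarrow> 0 \<le> (of_int (fst w) :: rat)"
      "0 \<le> (of_int (snd v) :: rat) \<longleftrightarrow> 0 \<le> (of_int (snd w) :: rat)"
      unfolding assms(4,5) using c by (simp_all add: zero_le_mult_iff)
    thus "0 \<le> fst v \<longleftrightarrow> 0 \<le> fst w" "0 \<le> snd v \<longleftrightarrow> 0 \<le> snd w" by simp_all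
  qed
  ultimately have "fst v = fst w" "snd v = snd w" by linarith+
  thus ?thesis by (rule prod_eqI)
qed

lemma unimodular_primitive: "\<bar>det2 v w\<bar> = 1 \<Longrightarrow> primitive v \<and> primitive w"
proof -
  assume *: "\<bar>det2 v w\<bar> = 1"
  have "is_unit d" if "d dvd fst v" "d dvd snd v" for d
  proof -
    have "d dvd det2 v w" using that by (simp add: det2_def)
    thus ?thesis using * by (metis dvd_abs_iff)
  qed
  moreover have "is_unit d" if "d dvd fst w" "d dvd snd w" for d
  proof -
    have "d dvd det2 v w" using that by (simp add: det2_def)
    thus ?thesis using * by (metis dvd_abs_iff)
  qed
  ultimately show ?thesis by (auto simp: primitive_def intro: coprimeI)
qed

lemma ray_eq_iff:
  assumes "primitive v" "primitive w" "cone_gen {v} = cone_gen {w}" shows "v = w"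
proof -
  have "(of_int (fst v), of_int (snd v)) \<in> cone_gen {w}" using generator_in_cone[of "{v}" v] assms by simp
  thus ?thesis using primitive_parallel[OF assms(1,2)] by (auto simp: cone_gen_single)
qed

text \<open>
  Write \<open>v\<close> as a nonnegative combination of \<open>b, b'\<close> and these as nonnegative combinations of
  \<open>v, v'\<close>. No \<open>v'\<close> can occur in those of \<open>b, b'\<close> that are used for \<open>v\<close>, so one of them is a multiple of
  \<open>v\<close>, hence equal to \<open>v\<close> by primitivity.
\<close>

lemma extremal_generator:
  assumes det: "det2 v v' \<noteq> 0" and prim: "primitive v" "primitive b" "primitive b'"
    and bb': "b \<noteq> b'" and eq: "cone_gen {v, v'} = cone_gen {b, b'}"
  shows "v = b \<or> v = b'"
proof -
  have vv': "v \<noteq> v'" using det by (rule det2_nonzero_neq)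
  have dn: "of_int (fst v) * of_int (snd v') - of_int (snd v) * of_int (fst v') \<noteq> (0 :: rat)"
    using det unfolding of_int_det2[symmetric] by simp
  have "(of_int (fst v), of_int (snd v)) \<in> cone_gen {b, b'}"
    using generator_in_cone[of "{v, v'}" v] eq by simp
  then obtain r s where rs: "r \<ge> 0" "s \<ge> 0" "of_int (fst v) = r * of_int (fst b) + s * of_int (fst b')"
    "of_int (snd v) = r * of_int (snd b) + s * (of_int (snd b') :: rat)"
    unfolding cone_gen_pair[OF bb'] by auto
  have "(of_int (fst b), of_int (snd b)) \<in> cone_gen {v, v'}"
    using generator_in_cone[of "{b, b'}" b] eq by simp
  then obtain c d where cd: "c \<ge> 0" "d \<ge> 0" "of_int (fst b) = c * of_int (fst v) + d * of_int (fst v')"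
    "of_int (snd b) = c * of_int (snd v) + d * (of_int (snd v') :: rat)"
    unfolding cone_gen_pair[OF vv'] by auto
  have "(of_int (fst b'), of_int (snd b')) \<in> cone_gen {v, v'}"
    using generator_in_cone[of "{b, b'}" b'] eq by simp
  then obtain c' d' where cd': "c' \<ge> 0" "d' \<ge> 0" "of_int (fst b') = c' * of_int (fst v) + d' * of_int (fst v')"
    "of_int (snd b') = c' * of_int (snd v) + d' * (of_int (snd v') :: rat)"
    unfolding cone_gen_pair[OF vv'] by auto
  have "(r * d + s * d') * (of_int (fst v) * of_int (snd v') - of_int (snd v) * of_int (fst v')) = 0"
    using rs(3,4) unfolding cd(3,4) cd'(3,4) by algebra
  hence "r * d + s * d' = 0" using dn by simp
  moreover have "r * d \<ge> 0" "s * d' \<ge> 0" using rs cd cd' by simp_all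
  ultimately have "r * d = 0" "s * d' = 0" by linarith+
  moreover have "r \<noteq> 0 \<or> s \<noteq> 0" using rs prim(1) by (auto simp: primitive_def)
  ultimately have "d = 0 \<or> d' = 0" by auto
  thus ?thesis
    using primitive_parallel[OF prim(2,1) cd(1)] primitive_parallel[OF prim(3,1) cd'(1)] cd cd' by auto
qed

lemma cone_generators_unique:
  assumes "det2 v v' \<noteq> 0" "primitive v" "primitive v'" "primitive b" "primitive b'" "b \<noteq> b'"
    and eq: "cone_gen {v, v'} = cone_gen {b, b'}"
  shows "v = b \<and> v' = b' \<or> v = b' \<and> v' = b"
proof -
  have "v = b \<or> v = b'" by (rule extremal_generator[OF assms(1,2,4,5,6) eq])
  moreover have "det2 v' v \<noteq> 0" using assms(1) by (simp add: det2_def algebra_simps)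
  hence "v' = b \<or> v' = b'" using extremal_generator[of v' v b b'] assms eq by (simp add: insert_commute)
  ultimately show ?thesis using det2_nonzero_neq[OF assms(1)] by auto
qed

lemma face_cases:
  assumes det: "det2 v v' \<noteq> 0" and F: "face_of_cone F (cone_gen {v, v'})"
  shows "F = {(0, 0)} \<or> F = cone_gen {v} \<or> F = cone_gen {v'} \<or> F = cone_gen {v, v'}"
proof -
  have vv': "v \<noteq> v'" using det by (rule det2_nonzero_neq)
  obtain w where w: "ipair w v \<ge> 0" "ipair w v' \<ge> 0" "F = {z \<in> cone_gen {v, v'}. pairing w z = 0}"
    using F by (auto simp: face_of_cone_def dual_monoid_cone_gen)
  let ?z = "\<lambda>c d. (c * of_int (fst v) + d * of_int (fst v'), c * of_int (snd v) + d * of_int (snd v')) :: rat_plane"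
  have pair: "pairing w (?z c d) = c * of_int (ipair w v) + d * of_int (ipair w v')" for c d
    by (simp add: pairing_def ipair_def algebra_simps)
  have zero: "pairing w (?z c d) = 0 \<longleftrightarrow> (c = 0 \<or> ipair w v = 0) \<and> (d = 0 \<or> ipair w v' = 0)"
    if "c \<ge> 0" "d \<ge> 0" for c d
  proof -
    have "c * of_int (ipair w v) \<ge> 0" "d * of_int (ipair w v') \<ge> 0" using that w by simp_all
    hence "pairing w (?z c d) = 0 \<longleftrightarrow> c * of_int (ipair w v) = 0 \<and> d * of_int (ipair w v') = 0"
      unfolding pair by linarith
    thus ?thesis by simp
  qed
  have F': "z \<in> F \<longleftrightarrow> (\<exists>c\<ge>0. \<exists>d\<ge>0. z = ?z c d \<and> (c = 0 \<or> ipair w v = 0) \<and> (d = 0 \<or> ipair w v' = 0))" for z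
    unfolding w(3) mem_Collect_eq cone_gen_pair[OF vv'] using zero by blast
  consider "ipair w v = 0" "ipair w v' = 0" | "ipair w v \<noteq> 0" "ipair w v' = 0"
    | "ipair w v = 0" "ipair w v' \<noteq> 0" | "ipair w v \<noteq> 0" "ipair w v' \<noteq> 0" by blast
  thus ?thesis
  proof cases
    case 1
    hence "F = cone_gen {v, v'}" by (intro set_eqI) (simp add: F' cone_gen_pair[OF vv'])
    thus ?thesis by simp
  next
    case 2
    have "z \<in> F \<longleftrightarrow> (\<exists>d\<ge>0. z = ?z 0 d)" for z
    proof
      assume "\<exists>d\<ge>0. z = ?z 0 d"
      thus "z \<in> F" unfolding F' using 2 order_refl[of "0 :: rat"] by blast
    qed (use 2 in \<open>auto simp: F'\<close>)
    hence "F = cone_gen {v'}" by (intro set_eqI) (simp add: cone_gen_single)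
    thus ?thesis by simp
  next
    case 3
    have "z \<in> F \<longleftrightarrow> (\<exists>c\<ge>0. z = ?z c 0)" for z
    proof
      assume "\<exists>c\<ge>0. z = ?z c 0"
      thus "z \<in> F" unfolding F' using 3 order_refl[of "0 :: rat"] by blast
    qed (use 3 in \<open>auto simp: F'\<close>)
    hence "F = cone_gen {v}" by (intro set_eqI) (simp add: cone_gen_single)
    thus ?thesis by simp
  next
    case 4
    hence "F = {(0, 0)}" by (intro set_eqI) (auto simp: F')
    thus ?thesis by simp
  qed
qed

lemma ray_is_face:
  assumes "\<bar>det2 v v'\<bar> = 1"
  shows "face_of_cone (cone_gen {v}) (cone_gen {v, v'})"
proof -
  have vv': "v \<noteq> v'" using assms by (intro det2_nonzero_neq) auto
  define w where "w = (det2 v v' * - snd v, det2 v v' * fst v)"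
  have dd: "det2 v v' * det2 v v' = 1" using assms by (metis abs_mult_self_eq mult_1)
  have "ipair w v' = det2 v v' * det2 v v'" by (simp add: w_def ipair_def det2_def algebra_simps)
  hence w: "ipair w v = 0" "ipair w v' = 1" using dd by (simp_all add: w_def ipair_def)
  have "pairing w (c * of_int (fst v) + d * of_int (fst v'), c * of_int (snd v) + d * of_int (snd v')) =
     c * of_int (ipair w v) + d * of_int (ipair w v')" for c d
    by (simp add: pairing_def ipair_def algebra_simps)
  hence pair: "pairing w (c * of_int (fst v) + d * of_int (fst v'), c * of_int (snd v) + d * of_int (snd v')) = d" for c d
    using w by simp
  have "cone_gen {v} = {z \<in> cone_gen {v, v'}. pairing w z = 0}"
  proof (intro equalityI subsetI)
    fix z assume "z \<in> cone_gen {v}"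
    then obtain c where c: "c \<ge> 0" "z = (c * of_int (fst v) + 0 * of_int (fst v'), c * of_int (snd v) + 0 * of_int (snd v'))"
      by (auto simp: cone_gen_single)
    hence "z \<in> cone_gen {v, v'}" unfolding cone_gen_pair[OF vv'] by blast
    moreover have "pairing w z = 0" unfolding c(2) pair ..
    ultimately show "z \<in> {z \<in> cone_gen {v, v'}. pairing w z = 0}" by simp
  next
    fix z assume "z \<in> {z \<in> cone_gen {v, v'}. pairing w z = 0}"
    thus "z \<in> cone_gen {v}" using pair by (auto simp: cone_gen_pair[OF vv'] cone_gen_single)
  qed
  moreover have "w \<in> dual_monoid (cone_gen {v, v'})" using w by (simp add: dual_monoid_cone_gen)
  ultimately show ?thesis unfolding face_of_cone_def by blast
qed

section \<open>The rays of a smooth fan\<close>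

locale ccw_fan =
  fixes \<Sigma> :: "rat_plane set set" and l :: nat and \<nu> :: "nat \<Rightarrow> lattice"
  assumes fan: "fan \<Sigma>" and smooth: "smooth_fan \<Sigma>" and ccw: "ccw_ray_generators \<Sigma> l \<nu>"
begin

lemma periodic: "\<nu> (i + l) = \<nu> i" and prim: "primitive (\<nu> i)"
  and det_pos: "det2 (\<nu> i) (\<nu> (Suc i)) > 0" and cone_in: "cone_gen {\<nu> i, \<nu> (Suc i)} \<in> \<Sigma>"
  and bij: "bij_betw (\<lambda>i. cone_gen {\<nu> i}) {1..l} (rays \<Sigma>)"
  using ccw by (auto simp: ccw_ray_generators_def)

text \<open>
  The smoothness of the fan gives some generators of determinant \<open>\<plusminus> 1\<close>; primitive generators
  of a two-dimensional cone are unique.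
\<close>

lemma det_1: "det2 (\<nu> i) (\<nu> (Suc i)) = 1"
proof -
  let ?v = "\<nu> i" and ?v' = "\<nu> (Suc i)"
  obtain b1 b2 G where b: "\<bar>det2 b1 b2\<bar> = 1" "G \<subseteq> {b1, b2}" "cone_gen {?v, ?v'} = cone_gen G"
    using smooth cone_in unfolding smooth_fan_def by meson
  have in1: "(of_int (fst ?v), of_int (snd ?v)) \<in> cone_gen G" "(of_int (fst ?v'), of_int (snd ?v')) \<in> cone_gen G"
    using generator_in_cone[of "{?v, ?v'}"] b(3) by auto
  have G: "G = {b1, b2}"
  proof (rule ccontr)
    assume "G \<noteq> {b1, b2}"
    then obtain b where "G \<subseteq> {b}" using b(2) by blast
    have "\<exists>c. z = (c * of_int (fst b), c * of_int (snd b))" if "z \<in> cone_gen G" for z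
    proof (cases "G = {}")
      case True thus ?thesis using that by (auto simp: cone_gen_empty intro!: exI[of _ 0])
    next
      case False
      hence "G = {b}" using \<open>G \<subseteq> {b}\<close> by auto
      thus ?thesis using that by (auto simp: cone_gen_single)
    qed
    from this[OF in1(1)] this[OF in1(2)] obtain c c' where
      "of_int (fst ?v) = c * of_int (fst b)" "of_int (snd ?v) = c * (of_int (snd b) :: rat)"
      "of_int (fst ?v') = c' * of_int (fst b)" "of_int (snd ?v') = c' * (of_int (snd b) :: rat)" by auto
    hence "(of_int (det2 ?v ?v') :: rat) = 0" unfolding of_int_det2 by simp
    thus False using det_pos[of i] by simp
  qed
  have "det2 ?v ?v' \<noteq> 0" using det_pos[of i] by simp
  moreover have "primitive b1" "primitive b2" "b1 \<noteq> b2"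
    using unimodular_primitive[OF b(1)] b(1) by (auto simp: det2_def)
  ultimately have "?v = b1 \<and> ?v' = b2 \<or> ?v = b2 \<and> ?v' = b1"
    using cone_generators_unique[of ?v ?v' b1 b2] prim b(3) G by auto
  hence "\<bar>det2 ?v ?v'\<bar> = 1" using b(1) by (auto simp: det2_def algebra_simps)
  thus ?thesis using det_pos[of i] by simp
qed

lemma l_pos: "l > 0"
proof (rule ccontr)
  assume "\<not> l > 0"
  hence "rays \<Sigma> = {}" using bij by (simp add: bij_betw_def)
  moreover have "cone_gen {\<nu> 0} \<in> \<Sigma>"
    using fan cone_in[of 0] ray_is_face[of "\<nu> 0" "\<nu> (Suc 0)"] det_1[of 0] by (auto simp: fan_def)
  moreover have "\<nu> 0 \<noteq> 0" using prim[of 0] by (auto simp: primitive_def)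
  ultimately show False unfolding rays_def by blast
qed

lemma periodic_mod: "\<nu> (i mod l) = \<nu> i"
proof -
  have "\<nu> (j + k * l) = \<nu> j" for j k
    by (induction k) (simp_all add: periodic add.assoc[symmetric] add.commute[of l])
  from this[of "i mod l" "i div l"] show ?thesis by simp
qed

lemma generators_inj: assumes "\<nu> i = \<nu> j" shows "i mod l = j mod l"
proof -
  define r where "r i = (if i mod l = 0 then l else i mod l)" for i
  have r: "r i \<in> {1..l}" "\<nu> (r i) = \<nu> i" "r i mod l = i mod l" for i
    using l_pos mod_less_divisor[of l i] periodic_mod[of i] periodic_mod[of l]
    by (auto simp: r_def less_imp_le)
  have "cone_gen {\<nu> (r i)} = cone_gen {\<nu> (r j)}" using assms by (simp add: r)
  hence "r i = r j" using bij r(1) by (auto simp: bij_betw_def inj_on_def)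
  thus ?thesis using r(3) by metis
qed

text \<open>
  The intersection is a face of both cones. A common ray of two cones is the left one for
  one of them and the right one for the other, unless the cones coincide.
\<close>

lemma cone_inter:
  "chart_cone \<nu> i \<inter> chart_cone \<nu> j = {(0, 0)} \<or> i mod l = j mod l \<or>
   chart_cone \<nu> i \<inter> chart_cone \<nu> j = cone_gen {\<nu> (Suc i)} \<and> Suc i mod l = j mod l \<or>
   chart_cone \<nu> i \<inter> chart_cone \<nu> j = cone_gen {\<nu> (Suc j)} \<and> Suc j mod l = i mod l"
proof -
  let ?F = "chart_cone \<nu> i \<inter> chart_cone \<nu> j"
  have nz: "det2 (\<nu> k) (\<nu> (Suc k)) \<noteq> 0" for k using det_1[of k] by simp
  have "face_of_cone ?F (chart_cone \<nu> i)" "face_of_cone ?F (chart_cone \<nu> j)"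
    using fan cone_in unfolding fan_def chart_cone_def by blast+
  hence *: "?F = {(0, 0)} \<or> ?F = cone_gen {\<nu> i} \<or> ?F = cone_gen {\<nu> (Suc i)} \<or> ?F = chart_cone \<nu> i"
    "?F = {(0, 0)} \<or> ?F = cone_gen {\<nu> j} \<or> ?F = cone_gen {\<nu> (Suc j)} \<or> ?F = chart_cone \<nu> j"
    using face_cases[OF nz] unfolding chart_cone_def by blast+
  have not_ray: "cone_gen {v} \<noteq> chart_cone \<nu> k" for v k
  proof
    assume "cone_gen {v} = chart_cone \<nu> k"
    hence "(of_int (fst (\<nu> k)), of_int (snd (\<nu> k))) \<in> cone_gen {v}"
      "(of_int (fst (\<nu> (Suc k))), of_int (snd (\<nu> (Suc k)))) \<in> cone_gen {v}"
      unfolding chart_cone_def by (simp_all add: generator_in_cone)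
    hence "(of_int (det2 (\<nu> k) (\<nu> (Suc k))) :: rat) = 0"
      unfolding of_int_det2 cone_gen_single by auto
    thus False using nz by simp
  qed
  have cyc: "Suc i' mod l = Suc j' mod l \<Longrightarrow> i' mod l = j' mod l" for i' j'
  proof -
    assume "Suc i' mod l = Suc j' mod l"
    hence "(Suc i' + (l - 1)) mod l = (Suc j' + (l - 1)) mod l" by (metis mod_add_left_eq)
    thus ?thesis using l_pos by simp
  qed
  have same: "i mod l = j mod l" if "chart_cone \<nu> i = chart_cone \<nu> j"
  proof -
    have "\<nu> j \<noteq> \<nu> (Suc j)" using det2_nonzero_neq[OF nz] .
    from cone_generators_unique[OF nz prim prim prim prim this that[unfolded chart_cone_def]]
    consider "\<nu> i = \<nu> j" | "\<nu> i = \<nu> (Suc j)" "\<nu> (Suc i) = \<nu> j" by auto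
    thus ?thesis
    proof cases
      case 1 thus ?thesis by (rule generators_inj)
    next
      case 2 thus ?thesis using det_1[of i] det_1[of j] by (simp add: det2_def algebra_simps)
    qed
  qed
  have ray: "k mod l = k' mod l" if "?F = cone_gen {\<nu> k}" "?F = cone_gen {\<nu> k'}" for k k'
    using that by (intro generators_inj ray_eq_iff[OF prim prim]) simp
  show ?thesis using * not_ray same ray cyc by metis
qed

end

section \<open>The slice\<close>

lemma mem_slice_cone:
  assumes "det2 v v' = 1"
  shows "z \<in> slice (cone_gen {v, v'}) \<longleftrightarrow>
    of_int (fst v') \<le> of_int (snd v') * z \<and> of_int (snd v) * z \<le> of_int (fst v)"
proof -
  have "z \<in> slice (cone_gen {v, v'}) \<longleftrightarrow> (z, 1) \<in> cone_gen {v, v'}"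
    by (auto simp: slice_def pairing_def R_deg_def)
  thus ?thesis unfolding mem_unimodular_cone[OF assms] by (auto simp: mult.commute)
qed

lemma slice_ray: "slice (cone_gen {v}) = (if snd v > 0 then {of_int (fst v) / of_int (snd v)} else {})"
proof -
  have mem: "z \<in> slice (cone_gen {v}) \<longleftrightarrow> (\<exists>c\<ge>0. z = c * of_int (fst v) \<and> c * of_int (snd v) = 1)" for z
    by (auto simp: slice_def pairing_def R_deg_def cone_gen_single)
  show ?thesis
  proof (cases "snd v > 0")
    case True
    hence "z \<in> slice (cone_gen {v}) \<longleftrightarrow> z = of_int (fst v) / of_int (snd v)" for z
      unfolding mem by (auto simp: field_simps intro!: exI[of _ "1 / of_int (snd v)"])
    thus ?thesis using True by auto
  next
    case False
    have "c * of_int (snd v) \<noteq> (1::rat)" if "c \<ge> 0" for c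
    proof -
      have "c * of_int (snd v) \<le> (0::rat)" using that False by (intro mult_nonneg_nonpos) auto
      thus ?thesis by linarith
    qed
    thus ?thesis using False mem by auto
  qed
qed

context ccw_fan
begin

text \<open>
  The ray \<open>\<rho>\<^sub>i\<close> is spanned by \<open>(p i, q i)\<close>. If \<open>q i > 0\<close> it meets the line of the slice in the point \<open>P i\<close>,
  and \<open>S i\<close> is the slice of the chart cone between \<open>\<rho>\<^sub>i\<close> and \<open>\<rho>\<^sub>i\<^sub>+\<^sub>1\<close>, which ends at \<open>P i\<close> on the right
  and at \<open>P (i + 1)\<close> on the left.
\<close>

abbreviation "p i \<equiv> rat_of_int (fst (\<nu> i))"
abbreviation "q i \<equiv> rat_of_int (snd (\<nu> i))"
abbreviation "P i \<equiv> p i / q i"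
abbreviation "S i \<equiv> slice (cone_gen {\<nu> i, \<nu> (Suc i)})"

lemma S_iff: "z \<in> S i \<longleftrightarrow> p (Suc i) \<le> q (Suc i) * z \<and> q i * z \<le> p i"
  by (rule mem_slice_cone[OF det_1])

lemma pq_det: "p i * q (Suc i) - q i * p (Suc i) = 1"
  using det_1[of i] of_int_det2[of "\<nu> i" "\<nu> (Suc i)"] by simp

text \<open>
  The segment extends beyond its left end by some \<open>e > 0\<close> because the determinant condition
  leaves the slack \<open>1/q (i + 1)\<close> in the inequality of the other ray.
\<close>

lemma left_end:
  assumes "q (Suc i) > 0"
  shows "P (Suc i) \<in> S i" "z \<in> S i \<Longrightarrow> P (Suc i) \<le> z" "\<exists>z\<in>S i. P (Suc i) < z"
proof -
  have eq: "q i * P (Suc i) = p i - 1 / q (Suc i)"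
    using assms pq_det[of i] by (simp add: field_simps)
  have pos: "1 / q (Suc i) > 0" using assms by simp
  have mem: "P (Suc i) + e \<in> S i" if "e \<ge> 0" "q i * e \<le> 1 / q (Suc i)" for e
  proof -
    have "p (Suc i) \<le> q (Suc i) * (P (Suc i) + e)" using assms that(1) by (simp add: distrib_left)
    moreover have "q i * (P (Suc i) + e) \<le> p i" using eq that(2) by (simp add: distrib_left)
    ultimately show ?thesis unfolding S_iff by blast
  qed
  from mem[of 0] pos show "P (Suc i) \<in> S i" by (simp add: less_imp_le)
  show "P (Suc i) \<le> z" if "z \<in> S i" using that assms unfolding S_iff by (simp add: field_simps)
  define e where "e = (if q i > 0 then 1 / (q i * q (Suc i)) else 1)"
  have "e > 0 \<and> q i * e \<le> 1 / q (Suc i)"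
  proof (cases "q i > 0")
    case False thus ?thesis using pos unfolding e_def by (simp only: if_False) linarith
  qed (use assms in \<open>simp add: e_def\<close>)
  thus "\<exists>z\<in>S i. P (Suc i) < z" using mem[of e] by (intro bexI[of _ "P (Suc i) + e"]) auto
qed

lemma right_end:
  assumes "q i > 0"
  shows "P i \<in> S i" "z \<in> S i \<Longrightarrow> z \<le> P i" "\<exists>z\<in>S i. z < P i"
    and "q (Suc i) \<le> 0 \<Longrightarrow> \<exists>z\<in>S i. z < c"
proof -
  have eq: "q (Suc i) * P i = p (Suc i) + 1 / q i"
    using assms pq_det[of i] by (simp add: field_simps)
  have pos: "1 / q i > 0" using assms by simp
  have mem: "P i - e \<in> S i" if "e \<ge> 0" "q (Suc i) * e \<le> 1 / q i" for e
  proof -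
    have "q i * (P i - e) \<le> p i" using assms that(1) by (simp add: right_diff_distrib)
    moreover have "p (Suc i) \<le> q (Suc i) * (P i - e)" using eq that(2) by (simp add: right_diff_distrib)
    ultimately show ?thesis unfolding S_iff by blast
  qed
  from mem[of 0] pos show "P i \<in> S i" by (simp add: less_imp_le)
  show "z \<le> P i" if "z \<in> S i" using that assms unfolding S_iff by (simp add: field_simps)
  define e where "e = (if q (Suc i) > 0 then 1 / (q i * q (Suc i)) else 1)"
  have "e > 0 \<and> q (Suc i) * e \<le> 1 / q i"
  proof (cases "q (Suc i) > 0")
    case False thus ?thesis using pos unfolding e_def by (simp only: if_False) linarith
  qed (use assms in \<open>simp add: e_def\<close>)
  thus "\<exists>z\<in>S i. z < P i" using mem[of e] by (intro bexI[of _ "P i - e"]) auto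
  assume neg: "q (Suc i) \<le> 0"
  define e' where "e' = \<bar>P i - c\<bar> + 1"
  have e': "e' \<ge> 0" by (simp add: e'_def)
  have "q (Suc i) * e' \<le> 0" using neg e' by (rule mult_nonpos_nonneg)
  hence "q (Suc i) * e' \<le> 1 / q i" using pos by linarith
  hence "P i - e' \<in> S i" by (rule mem[OF e'])
  moreover have "P i - e' < c" unfolding e'_def by linarith
  ultimately show "\<exists>z\<in>S i. z < c" by blast
qed

lemma S_empty: "q i \<le> 0 \<Longrightarrow> q (Suc i) \<le> 0 \<Longrightarrow> S i = {}"
proof (rule ccontr)
  assume q: "q i \<le> 0" "q (Suc i) \<le> 0" and "S i \<noteq> {}"
  then obtain z where z: "p (Suc i) \<le> q (Suc i) * z" "q i * z \<le> p i" using S_iff by blast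
  have "p i * q (Suc i) \<le> q i * z * q (Suc i)" using z(2) q(2) by (rule mult_right_mono_neg)
  moreover have "q i * (q (Suc i) * z) \<le> q i * p (Suc i)" using z(1) q(1) by (rule mult_left_mono_neg)
  ultimately show False using pq_det[of i] by (simp add: algebra_simps)
qed

lemma S_in_subdivision:
  assumes "q i > 0 \<or> q (Suc i) > 0"
  shows "S i \<in> {X \<in> slice_subdivision \<Sigma>. \<not> is_singleton X}"
proof -
  obtain y z where yz: "y \<in> S i" "z \<in> S i" "y \<noteq> z"
  proof (cases "q i > 0")
    case True thus thesis using right_end(1,3)[OF True] that by (metis less_irrefl)
  next
    case False
    hence "q (Suc i) > 0" using assms by simp
    thus thesis using left_end(1,3)[of i] that by (metis less_irrefl)
  qed
  have "S i \<noteq> {}" using yz(1) by blast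
  moreover have "\<not> is_singleton (S i)" using yz by (metis is_singletonE singletonD)
  moreover have "S i \<in> slice ` \<Sigma>" using cone_in by (rule imageI)
  ultimately show ?thesis unfolding slice_subdivision_def by blast
qed

text \<open>
  The ray of \<open>b1\<close> is some \<open>\<rho>\<^sub>j\<close>. The cone and the chart cone following \<open>\<rho>\<^sub>j\<close> counterclockwise lie on the
  same side of \<open>\<rho>\<^sub>j\<close>, so a vector \<open>u\<close> close to that ray is interior to both. As their
  intersection is a face of either of them, it is everything.
\<close>

lemma two_dim_cone_is_chart:
  assumes C: "cone_gen {b1, b2} \<in> \<Sigma>" and det: "det2 b1 b2 = 1"
  shows "\<exists>j. cone_gen {b1, b2} = cone_gen {\<nu> j, \<nu> (Suc j)}"
proof -
  let ?C = "cone_gen {b1, b2}"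
  have prim_b: "primitive b1" "primitive b2" using unimodular_primitive[of b1 b2] det by auto
  have "cone_gen {b1} \<in> \<Sigma>" using fan C ray_is_face[of b1 b2] det by (auto simp: fan_def)
  moreover have "b1 \<noteq> 0" using prim_b(1) by (auto simp: primitive_def)
  ultimately have "cone_gen {b1} \<in> rays \<Sigma>" unfolding rays_def by blast
  then obtain j where j: "cone_gen {b1} = cone_gen {\<nu> j}" using bij by (auto simp: bij_betw_def)
  hence b1: "b1 = \<nu> j" using ray_eq_iff prim_b prim by blast
  let ?D = "cone_gen {\<nu> j, \<nu> (Suc j)}"
  \<comment> \<open>\<open>u = n b1 + \<nu> (j + 1)\<close>, with \<open>n\<close> so large that \<open>u\<close> lies between \<open>b1\<close> and \<open>b2\<close>\<close>
  define n where "n = \<bar>det2 (\<nu> (Suc j)) b2\<bar> + 1"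
  define u where "u = (n * fst b1 + fst (\<nu> (Suc j)), n * snd b1 + snd (\<nu> (Suc j)))"
  let ?u = "(of_int (fst u), of_int (snd u)) :: rat_plane"
  have "det2 b1 u = det2 b1 (\<nu> (Suc j))" by (simp add: u_def det2_def algebra_simps)
  hence du1: "det2 b1 u = 1" using det_1[of j] b1 by simp
  have "det2 u b2 = n * det2 b1 b2 + det2 (\<nu> (Suc j)) b2" by (simp add: u_def det2_def algebra_simps)
  hence du2: "det2 u b2 \<ge> 1" using det by (simp add: n_def)
  have "det2 u (\<nu> (Suc j)) = n * det2 b1 (\<nu> (Suc j))" by (simp add: u_def det2_def algebra_simps)
  hence du3: "det2 u (\<nu> (Suc j)) \<ge> 1" using det_1[of j] b1 by (simp add: n_def)
  have "(0 :: rat) \<le> of_int (det2 u b2)" "(0 :: rat) \<le> of_int (det2 b1 u)"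
    "(0 :: rat) \<le> of_int (det2 u (\<nu> (Suc j)))" using du1 du2 du3 by simp_all
  moreover have "det2 b1 (\<nu> (Suc j)) = 1" using det_1[of j] b1 by simp
  ultimately have u: "?u \<in> ?C" "?u \<in> ?D"
    unfolding b1[symmetric] by (simp_all add: mem_unimodular_cone det of_int_det2)
  \<comment> \<open>a linear form vanishing on \<open>b1\<close> and \<open>u\<close> is zero, so the face it cuts out is the whole cone\<close>
  have full: "?C \<inter> ?D = cone_gen {b1, b}" if face: "face_of_cone (?C \<inter> ?D) (cone_gen {b1, b})" and db: "det2 b1 b = 1" for b
  proof -
    have b: "det2 b1 b \<noteq> 0" "b1 \<noteq> b" using db by (auto simp: det2_def)
    obtain w where w: "ipair w b1 \<ge> 0" "ipair w b \<ge> 0" "?C \<inter> ?D = {z \<in> cone_gen {b1, b}. pairing w z = 0}"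
      using face by (auto simp: face_of_cone_def dual_monoid_cone_gen)
    have "pairing w ?u = 0" using u w(3) by blast
    hence "(of_int (ipair w u) :: rat) = 0" by (simp add: pairing_def ipair_def)
    hence wu: "ipair w u = 0" by simp
    have "(of_int (fst b1), of_int (snd b1)) \<in> ?C \<inter> ?D"
      unfolding b1 using generator_in_cone[of "{\<nu> j, b2}" "\<nu> j"] generator_in_cone[of "{\<nu> j, \<nu> (Suc j)}" "\<nu> j"] by simp
    hence "pairing w (of_int (fst b1), of_int (snd b1)) = 0" using w(3) by blast
    hence "(of_int (ipair w b1) :: rat) = 0" by (simp add: pairing_def ipair_def)
    hence wb: "ipair w b1 = 0" by simp
    have "fst w * det2 b1 u = 0" "snd w * det2 b1 u = 0"
      using wu wb unfolding ipair_def det2_def by algebra+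
    hence "w = (0, 0)" using du1 by (intro prod_eqI) simp_all
    thus ?thesis unfolding w(3) by (auto simp: pairing_def)
  qed
  have "face_of_cone (?C \<inter> ?D) ?C" "face_of_cone (?C \<inter> ?D) ?D"
    using fan C cone_in unfolding fan_def by blast+
  hence "?C \<inter> ?D = ?C" "?C \<inter> ?D = ?D" using full[of b2] full[of "\<nu> (Suc j)"] det det_1[of j] b1 by auto
  thus ?thesis by blast
qed

lemma segment_is_S:
  assumes "X \<in> slice_subdivision \<Sigma>" "\<not> is_singleton X"
  shows "\<exists>j. X = S j \<and> (q j > 0 \<or> q (Suc j) > 0)"
proof -
  obtain C where C: "C \<in> \<Sigma>" "X = slice C" "X \<noteq> {}" using assms by (auto simp: slice_subdivision_def)
  obtain b1 b2 G where b: "\<bar>det2 b1 b2\<bar> = 1" "G \<subseteq> {b1, b2}" "C = cone_gen G"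
    using smooth C(1) unfolding smooth_fan_def by meson
  have G: "G = {b1, b2}"
  proof (rule ccontr)
    assume "G \<noteq> {b1, b2}"
    then obtain b where "G \<subseteq> {b}" using b(2) by blast
    hence "G = {} \<or> G = {b}" by auto
    moreover have "slice (cone_gen {}) = {}" by (simp add: cone_gen_empty slice_def pairing_def)
    ultimately show False using C assms b(3) slice_ray[of b] by (auto simp: is_singleton_def split: if_splits)
  qed
  have "det2 b2 b1 = - det2 b1 b2" by (simp add: det2_def algebra_simps)
  then consider "det2 b1 b2 = 1" | "det2 b2 b1 = 1" using b(1) by linarith
  hence "\<exists>j. C = cone_gen {\<nu> j, \<nu> (Suc j)}"
    using two_dim_cone_is_chart[of b1 b2] two_dim_cone_is_chart[of b2 b1] C(1) b(3) G by cases (auto simp: insert_commute)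
  then obtain j where j: "X = S j" using C by auto
  moreover have "q j > 0 \<or> q (Suc j) > 0" using S_empty[of j] C(3) j by force
  ultimately show ?thesis by blast
qed

end

locale sliced_fan = ccw_fan +
  fixes m :: nat and \<Delta> :: "nat \<Rightarrow> rat set"
  assumes segs: "slice_segments \<Sigma> m \<Delta>"
    and start: "slice (cone_gen {\<nu> 1}) = \<Delta> 0 \<inter> \<Delta> 1"
begin

lemma \<Delta>_bij: "bij_betw \<Delta> {0..Suc m} {X \<in> slice_subdivision \<Sigma>. \<not> is_singleton X}"
  and \<Delta>_adj: "i \<le> m \<Longrightarrow> x \<in> \<Delta> i \<Longrightarrow> y \<in> \<Delta> (Suc i) \<Longrightarrow> y \<le> x"
  using segs by (auto simp: slice_segments_def)

lemma \<Delta>_is_S: assumes "k \<le> Suc m" obtains j where "\<Delta> k = S j" "q j > 0 \<or> q (Suc j) > 0"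
proof -
  have "\<Delta> k \<in> {X \<in> slice_subdivision \<Sigma>. \<not> is_singleton X}"
    using \<Delta>_bij assms by (auto simp: bij_betw_def)
  thus thesis using segment_is_S that by blast
qed

lemma S_is_\<Delta>: assumes "q j > 0 \<or> q (Suc j) > 0" obtains k where "k \<le> Suc m" "S j = \<Delta> k"
proof -
  have "S j \<in> \<Delta> ` {0..Suc m}" using \<Delta>_bij S_in_subdivision[OF assms] by (simp only: bij_betw_def)
  thus thesis using that by auto
qed

lemma \<Delta>_two_points: assumes "k \<le> Suc m" shows "\<Delta> k \<noteq> {}" "\<not> \<Delta> k \<subseteq> {x}"
proof -
  have "\<Delta> k \<in> {X \<in> slice_subdivision \<Sigma>. \<not> is_singleton X}"
    using \<Delta>_bij assms by (auto simp: bij_betw_def)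
  thus ne: "\<Delta> k \<noteq> {}" and "\<not> \<Delta> k \<subseteq> {x}"
    by (auto simp: slice_subdivision_def is_singleton_def subset_singleton_iff)
qed

lemma \<Delta>_order: "k < k' \<Longrightarrow> k' \<le> Suc m \<Longrightarrow> x \<in> \<Delta> k \<Longrightarrow> y \<in> \<Delta> k' \<Longrightarrow> y \<le> x"
proof (induction k' arbitrary: y)
  case (Suc n)
  show ?case
  proof (cases "k = n")
    case True thus ?thesis using Suc \<Delta>_adj[of n x y] by simp
  next
    case False
    obtain z where "z \<in> \<Delta> n" using \<Delta>_two_points(1)[of n] Suc by auto
    thus ?thesis using Suc.IH[of z] \<Delta>_adj[of n z y] Suc.prems False by fastforce
  qed
qed simp

text \<open>
  Two segments meeting at \<open>P (j + 1)\<close> are consecutive: a segment between them in the given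
  decreasing order would be squeezed into this point.
\<close>

lemma segment_step:
  assumes k: "k \<le> Suc m" "\<Delta> k = S j" and q: "q (Suc j) > 0"
  shows "k \<le> m" "\<Delta> (Suc k) = S (Suc j)" "\<Delta> k \<inter> \<Delta> (Suc k) = slice (cone_gen {\<nu> (Suc j)})"
proof -
  obtain k' where k': "k' \<le> Suc m" "S (Suc j) = \<Delta> k'" using S_is_\<Delta>[of "Suc j"] q by auto
  let ?P = "P (Suc j)"
  have Pk: "?P \<in> \<Delta> k" "?P \<in> \<Delta> k'" using left_end(1)[OF q] right_end(1)[OF q] k k' by auto
  obtain z where z: "z \<in> \<Delta> k'" "z < ?P" using right_end(3)[OF q] k' by auto
  have "\<not> k' < k" "k' \<noteq> k" 
    using \<Delta>_order[of k' k z ?P] z Pk k left_end(2)[OF q, of z] by auto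
  hence lt: "k < k'" by simp
  have "k' = Suc k"
  proof (rule ccontr)
    assume "k' \<noteq> Suc k"
    hence "Suc k < k'" using lt by simp
    hence "\<Delta> (Suc k) \<subseteq> {?P}"
      using \<Delta>_order[of k "Suc k" ?P] \<Delta>_order[of "Suc k" k' _ ?P] Pk k' by force
    thus False using \<Delta>_two_points(2)[of "Suc k" ?P] \<open>Suc k < k'\<close> k' by simp
  qed
  thus "k \<le> m" and S: "\<Delta> (Suc k) = S (Suc j)" using k' by auto
  have "\<Delta> k \<inter> \<Delta> (Suc k) = {?P}"
  proof (intro equalityI subsetI)
    fix x assume "x \<in> \<Delta> k \<inter> \<Delta> (Suc k)"
    thus "x \<in> {?P}" using left_end(2)[OF q, of x] right_end(2)[OF q, of x] k(2) S by auto
  qed (use Pk S k' in auto)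
  thus "\<Delta> k \<inter> \<Delta> (Suc k) = slice (cone_gen {\<nu> (Suc j)})" using q by (simp add: slice_ray)
qed

text \<open>
  The slice is unbounded to the left, which leaves no room for a further segment.
\<close>

lemma segment_last:
  assumes k: "k \<le> Suc m" "\<Delta> k = S j" and q: "q j > 0" "q (Suc j) \<le> 0"
  shows "k = Suc m"
proof (rule ccontr)
  assume "k \<noteq> Suc m"
  hence "k \<le> m" using k by simp
  then obtain c where c: "c \<in> \<Delta> (Suc k)" using \<Delta>_two_points(1)[of "Suc k"] by auto
  obtain z where "z \<in> \<Delta> k" "z < c" using right_end(4)[OF q, of c] k by auto
  thus False using \<Delta>_adj[OF \<open>k \<le> m\<close> _ c, of z] by simp
qed

text \<open>
  The point \<open>\<Delta> 0 \<inter> \<Delta> 1\<close> exists, since the segment \<open>\<Delta> 0\<close> is bounded on the left by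
  \<open>segment_last\<close>; so \<open>\<rho>\<^sub>1\<close> does meet the line of the slice. The chart before \<open>\<rho>\<^sub>1\<close> is then \<open>\<Delta> k\<close> for some
  \<open>k\<close> with the same end point, and \<open>k = 0\<close> by squeezing once more.
\<close>

lemma first_segment: "q 1 > 0" "\<Delta> 0 = S 0" "\<Delta> 1 = S 1"
proof -
  obtain j where j: "\<Delta> 0 = S j" "q j > 0 \<or> q (Suc j) > 0" using \<Delta>_is_S[of 0] by blast
  have "q (Suc j) > 0" using segment_last[of 0 j] j by fastforce
  hence "slice (cone_gen {\<nu> 1}) = slice (cone_gen {\<nu> (Suc j)})"
    using segment_step(3)[of 0 j] j start by simp
  hence "slice (cone_gen {\<nu> 1}) \<noteq> {}" using \<open>q (Suc j) > 0\<close> by (simp add: slice_ray)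
  thus q1: "q 1 > 0" by (simp add: slice_ray split: if_splits)
  obtain k where k: "k \<le> Suc m" "S 0 = \<Delta> k" using S_is_\<Delta>[of 0] q1 by auto
  note step = segment_step[OF k(1) k(2)[symmetric]]
  have P: "P 1 \<in> \<Delta> 0" "P 1 \<in> \<Delta> 1" "P 1 \<in> \<Delta> (Suc k)"
    using start step(3) q1 by (auto simp: slice_ray)
  have "k = 0"
  proof (rule ccontr)
    assume "k \<noteq> 0"
    hence "1 < Suc k" "Suc k \<le> Suc m" using step(1) q1 by auto
    hence "\<Delta> 1 \<subseteq> {P 1}"
      using \<Delta>_order[of 0 1 "P 1"] \<Delta>_order[of 1 "Suc k" _ "P 1"] P by force
    thus False using \<Delta>_two_points(2)[of 1 "P 1"] by simp
  qed
  thus "\<Delta> 0 = S 0" "\<Delta> 1 = S 1" using k step q1 by auto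
qed

lemma upper_segments: "1 \<le> i \<Longrightarrow> i \<le> Suc m \<Longrightarrow> q i > 0 \<and> \<Delta> i = S i"
proof (induction i)
  case (Suc i)
  show ?case
  proof (cases "i = 0")
    case True thus ?thesis using first_segment by simp
  next
    case False
    hence IH: "q i > 0" "\<Delta> i = S i" using Suc by auto
    have "\<not> q (Suc i) \<le> 0" using segment_last[of i i] IH Suc.prems by auto
    thus ?thesis using segment_step(2)[of i i] IH Suc.prems by auto
  qed
qed simp

lemma upper_rays:
  assumes "1 \<le> i" "i \<le> Suc m"
  shows "snd (\<nu> i) > 0" "\<Delta> (i - 1) \<inter> \<Delta> i = {of_int (fst (\<nu> i)) / of_int (snd (\<nu> i))}"
proof -
  show q: "snd (\<nu> i) > 0" using upper_segments[OF assms] by simp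
  have "\<Delta> (i - 1) = S (i - 1)"
    using upper_segments[of "i - 1"] first_segment assms by (cases "i = 1") auto
  thus "\<Delta> (i - 1) \<inter> \<Delta> i = {of_int (fst (\<nu> i)) / of_int (snd (\<nu> i))}"
    using segment_step(3)[of "i - 1" "i - 1"] assms q by (simp add: slice_ray)
qed

text \<open>
  Otherwise the segment to the left of \<open>P i\<close> would be some \<open>\<Delta> k\<close> with \<open>1 \<le> k \<le> m + 1\<close>, so \<open>P i = P k\<close>
  and the rays \<open>\<rho>\<^sub>i\<close> and \<open>\<rho>\<^sub>k\<close> would coincide.
\<close>

lemma lower_rays:
  assumes "m + 2 \<le> i" "i \<le> l" shows "snd (\<nu> i) \<le> 0"
proof (rule ccontr)
  assume "\<not> snd (\<nu> i) \<le> 0"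
  hence qi: "q i > 0" by simp
  obtain j where i: "i = Suc j" using assms by (cases i) auto
  obtain k' where k': "k' \<le> Suc m" "S j = \<Delta> k'" using S_is_\<Delta>[of j] qi i by auto
  define k where "k = Suc k'"
  have k: "1 \<le> k" "k \<le> Suc m" "\<Delta> k = S i"
    using segment_step(1,2)[OF k'(1) k'(2)[symmetric]] qi i by (auto simp: k_def)
  have qk: "q k > 0" "S k = S i" using upper_segments[OF k(1,2)] k(3) by auto
  have "P i = P k"
    using right_end(1,2)[OF qi] right_end(1,2)[OF qk(1)] qk(2) by (auto intro: antisym)
  hence e1: "p i = (q i / q k) * p k" using qi qk by (simp add: field_simps)
  have e2: "q i = (q i / q k) * q k" using qk by simp
  have "\<nu> i = \<nu> k" using qi qk by (intro primitive_parallel[OF prim prim _ e1 e2]) simp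
  hence "i mod l = k mod l" by (rule generators_inj)
  thus False using k assms by (cases "i = l") auto
qed

end

section \<open>Vector fields on toric charts\<close>

lemma dual_monoid_add: "v \<in> dual_monoid C \<Longrightarrow> w \<in> dual_monoid C \<Longrightarrow> v + w \<in> dual_monoid C"
  by (fastforce simp: dual_monoid_def pairing_def algebra_simps)

lemma dual_monoid_0: "0 \<in> dual_monoid C"
  by (auto simp: dual_monoid_def pairing_def)

lemma toric_ring_closed:
  "f \<in> toric_ring C \<Longrightarrow> g \<in> toric_ring C \<Longrightarrow> f + g \<in> toric_ring C"
  "f \<in> toric_ring C \<Longrightarrow> g \<in> toric_ring C \<Longrightarrow> f * g \<in> toric_ring C"
  "const_xy c \<in> toric_ring C" "0 \<in> toric_ring C"
  unfolding toric_ring_eq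
  by (simp_all add: chi.span_add chi.span_mult dual_monoid_add chi.span_const dual_monoid_0 chi.span_0)

lemma toric_ring_of_int_chi: "w \<in> dual_monoid C \<Longrightarrow> of_int n * chi w \<in> toric_ring C"
  using chi.span_char[of w "dual_monoid C" "of_int n"] by (simp add: toric_ring_eq)

lemma vector_fieldsI:
  assumes D: "derivation D" and chi: "\<And>w. w \<in> dual_monoid C \<Longrightarrow> D (chi w) \<in> toric_ring C"
  shows "D \<in> vector_fields C"
proof -
  have "D f \<in> toric_ring C" if "f \<in> toric_ring C" for f
    using that unfolding toric_ring_eq[of C]
  proof (induction rule: chi.span_induct)
    case zero show ?case using toric_ring_closed(4) by (simp add: derivation_01[OF D] flip: toric_ring_eq)
  next
    case (insert f w c)
    thus ?case using chi[of w] toric_ring_closed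
      by (simp add: derivation_add derivation_mult derivation_const D flip: toric_ring_eq)
  qed
  thus ?thesis using D by (auto simp: vector_fields_def)
qed

lemma vector_fields_diff:
  assumes "D \<in> vector_fields C" "D' \<in> vector_fields C"
  shows "(\<lambda>f. D f - D' f) \<in> vector_fields C"
proof -
  have "D f - D' f \<in> toric_ring C" if "f \<in> toric_ring C" for f
  proof -
    have "D f \<in> toric_ring C" "D' f \<in> toric_ring C" using assms that by (auto simp: vector_fields_def)
    hence "D f + const_xy (- 1) * D' f \<in> toric_ring C" by (intro toric_ring_closed)
    thus ?thesis by simp
  qed
  thus ?thesis using assms derivation_diff[of D D'] by (auto simp: vector_fields_def)
qed

lemma vector_fields_0: "(\<lambda>f. 0) \<in> vector_fields C"
  using derivation_zero toric_ring_closed(4) by (auto simp: vector_fields_def)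

lemma vector_fields_uminus: "D \<in> vector_fields C \<Longrightarrow> (\<lambda>f. - D f) \<in> vector_fields C"
  using vector_fields_diff[OF vector_fields_0, of D C] by simp

lemma vector_fields_plus:
  assumes "D \<in> vector_fields C" "D' \<in> vector_fields C"
  shows "(\<lambda>f. D f + D' f) \<in> vector_fields C"
  using vector_fields_diff[OF assms(1) vector_fields_uminus[OF assms(2)]] by simp

section \<open>Cech classes\<close>

lemma cohomologousI:
  assumes "D \<in> cech_cocycles l \<sigma>" "E \<in> cech_cocycles l \<sigma>"
    and "\<And>i. i < l \<Longrightarrow> e i \<in> vector_fields (\<sigma> i)"
    and "\<And>i j f. i < l \<Longrightarrow> j < l \<Longrightarrow> E i j f - D i j f = e j f - e i f"
  shows "(D, E) \<in> cohomologous l \<sigma>"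
  unfolding cohomologous_def
  by (intro CollectI case_prodI conjI exI[of _ e] allI impI) (fact assms | (rule assms; assumption))+

lemma cohomologousE:
  assumes "(D, E) \<in> cohomologous l \<sigma>"
  obtains e where "D \<in> cech_cocycles l \<sigma>" "E \<in> cech_cocycles l \<sigma>"
    "\<And>i. i < l \<Longrightarrow> e i \<in> vector_fields (\<sigma> i)"
    "\<And>i j f. i < l \<Longrightarrow> j < l \<Longrightarrow> E i j f - D i j f = e j f - e i f"
proof -
  from assms obtain e where "D \<in> cech_cocycles l \<sigma>" "E \<in> cech_cocycles l \<sigma>"
    "\<forall>i<l. e i \<in> vector_fields (\<sigma> i)"
    "\<forall>i<l. \<forall>j<l. \<forall>f. E i j f - D i j f = e j f - e i f"
    unfolding cohomologous_def mem_Collect_eq prod.case by (elim conjE exE)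
  thus thesis by (intro that[of e]) simp_all
qed

lemma cohomologous_sym:
  assumes "(D, E) \<in> cohomologous l \<sigma>" shows "(E, D) \<in> cohomologous l \<sigma>"
proof -
  obtain e where DE: "D \<in> cech_cocycles l \<sigma>" "E \<in> cech_cocycles l \<sigma>"
    and e: "\<And>i. i < l \<Longrightarrow> e i \<in> vector_fields (\<sigma> i)"
      "\<And>i j f. i < l \<Longrightarrow> j < l \<Longrightarrow> E i j f - D i j f = e j f - e i f"
    using assms by (rule cohomologousE) blast
  show ?thesis
  proof (rule cohomologousI[OF DE(2,1)])
    show "(\<lambda>f. - e i f) \<in> vector_fields (\<sigma> i)" if "i < l" for i
      by (rule vector_fields_uminus[OF e(1)[OF that]])
    show "D i j f - E i j f = - e j f - - e i f" if "i < l" "j < l" for i j f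
      using e(2)[OF that, of f] by (metis minus_diff_eq minus_diff_minus)
  qed
qed

lemma cohomologous_trans:
  assumes "(D, E) \<in> cohomologous l \<sigma>" "(E, F) \<in> cohomologous l \<sigma>"
  shows "(D, F) \<in> cohomologous l \<sigma>"
proof -
  obtain e where D: "D \<in> cech_cocycles l \<sigma>"
    and e: "\<And>i. i < l \<Longrightarrow> e i \<in> vector_fields (\<sigma> i)"
      "\<And>i j f. i < l \<Longrightarrow> j < l \<Longrightarrow> E i j f - D i j f = e j f - e i f"
    using assms(1) by (rule cohomologousE) blast
  obtain e' where F: "F \<in> cech_cocycles l \<sigma>"
    and e': "\<And>i. i < l \<Longrightarrow> e' i \<in> vector_fields (\<sigma> i)"
      "\<And>i j f. i < l \<Longrightarrow> j < l \<Longrightarrow> F i j f - E i j f = e' j f - e' i f"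
    using assms(2) by (rule cohomologousE) blast
  show ?thesis
  proof (rule cohomologousI[OF D F])
    show "(\<lambda>f. e i f + e' i f) \<in> vector_fields (\<sigma> i)" if "i < l" for i
      by (rule vector_fields_plus[OF e(1)[OF that] e'(1)[OF that]])
    show "F i j f - D i j f = (e j f + e' j f) - (e i f + e' i f)" if "i < l" "j < l" for i j f
    proof -
      have "F i j f - D i j f = (F i j f - E i j f) + (E i j f - D i j f)" by simp
      also have "\<dots> = (e' j f - e' i f) + (e j f - e i f)" by (simp only: e(2)[OF that] e'(2)[OF that])
      finally show ?thesis by simp
    qed
  qed
qed

lemma cohomologous_class_eq:
  assumes "(D, E) \<in> cohomologous l \<sigma>"
  shows "cech_class l \<sigma> D = cech_class l \<sigma> E"
  unfolding cech_class_def
  using assms cohomologous_sym[of _ _ l \<sigma>] cohomologous_trans[of _ _ l \<sigma>] by fast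

text \<open>
  Every pair of indices is connected by a chain of consecutive ones.
\<close>

lemma cocycle_identity_determined:
  fixes D E :: "nat \<Rightarrow> nat \<Rightarrow> 'a \<Rightarrow> ratfun"
  assumes D: "\<And>i j k f. i < l \<Longrightarrow> j < l \<Longrightarrow> k < l \<Longrightarrow> D i j f + D j k f = D i k f"
    and E: "\<And>i j k f. i < l \<Longrightarrow> j < l \<Longrightarrow> k < l \<Longrightarrow> E i j f + E j k f = E i k f"
    and adj: "\<And>k f. Suc k < l \<Longrightarrow> D k (Suc k) f = E k (Suc k) f"
    and ij: "i < l" "j < l"
  shows "D i j f = E i j f"
proof -
  have l: "0 < l" using ij by simp
  have 0: "D 0 j f = E 0 j f" if "j < l" for j
    using that
  proof (induction j)
    case 0
    have "D 0 0 f = 0" "E 0 0 f = 0"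
      using D[OF l l l, of f] E[OF l l l, of f] unfolding add_cancel_left_right .
    thus ?case by simp
  next
    case (Suc j)
    thus ?case using D[of 0 j "Suc j" f] E[of 0 j "Suc j" f] adj[of j f] l by simp
  qed
  have "D i j f = D 0 j f - D 0 i f" "E i j f = E 0 j f - E 0 i f"
    using D[OF l ij, of f] E[OF l ij, of f] by (simp_all add: algebra_simps)
  thus ?thesis using 0 ij by simp
qed

section \<open>The Kodaira-Spencer cocycle\<close>

text \<open>
  The field \<open>\<delta>\<close> has degree \<open>[0,-1]\<close>; this is its coefficient on \<open>\<chi>\<^sup>w\<close>.
\<close>

definition trivializing_coeff :: "int \<Rightarrow> int \<Rightarrow> lattice \<Rightarrow> int" where
  "trivializing_coeff a lam w = (if a = 1 then - lam * fst w else lam * fst w + snd w)"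

lemma trivializing_field_chi: "trivializing_field a lam (chi w) = of_int (trivializing_coeff a lam w) * chi (w + (0, - 1))"
  unfolding derivation_chi[OF derivation_trivializing_field] chi_add
  by (simp add: trivializing_field_def trivializing_coeff_def chi_def power_int_minus field_simps)

locale deformation = sliced_fan +
  fixes a lam :: "nat \<Rightarrow> int" and lam0 :: int
  assumes adm: "admissible_tuple m \<Delta> a" and shifts: "shifts l m \<Delta> lam0 a lam"
begin

abbreviation "\<delta> i \<equiv> trivializing_field (a i) (lam i)"
abbreviation "ring i \<equiv> A_tilde m \<nu> a lam i"
abbreviation "\<sigma> \<equiv> chart_cone \<nu>"

lemma a_lam_periodic: "a (i + l) = a i" "lam (i + l) = lam i"
  and lower_a_lam: "Suc m < i \<Longrightarrow> i < l \<Longrightarrow> a i = 1 \<and> lam i = 0"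
  and lam_same: "i \<le> m \<Longrightarrow> a (Suc i) = a i \<Longrightarrow> lam (Suc i) = lam i"
  and lam_jump: "i \<le> m \<Longrightarrow> a (Suc i) \<noteq> a i \<Longrightarrow> \<Delta> i \<inter> \<Delta> (Suc i) = {of_int (lam i + lam (Suc i))}"
  using shifts by (auto simp: shifts_def)

lemma a_sign: "i \<le> l \<Longrightarrow> a i = 1 \<or> a i = - 1"
proof -
  have *: "a i = 1 \<or> a i = - 1" if "i < l" for i
    using adm lower_a_lam[of i] that by (cases "i \<le> Suc m") (auto simp: admissible_tuple_def)
  assume "i \<le> l"
  thus ?thesis using *[of i] *[of 0] a_lam_periodic(1)[of 0] l_pos by (cases "i = l") auto
qed

lemma a_lam_mod: "a (k mod l) = a k" "lam (k mod l) = lam k"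
proof -
  have "a (j + n * l) = a j \<and> lam (j + n * l) = lam j" for j n
    by (induction n) (simp_all add: a_lam_periodic add.assoc[symmetric] add.commute[of l])
  from this[of "k mod l" "k div l"] show "a (k mod l) = a k" "lam (k mod l) = lam k" by simp_all
qed

text \<open>
  A wall where the tuple changes is crossed at a lattice point, so its primitive generator
  has height \<open>1\<close>.
\<close>

lemma jump_ray:
  assumes "k \<le> m" "a (Suc k) \<noteq> a k"
  shows "snd (\<nu> (Suc k)) = 1" "fst (\<nu> (Suc k)) = lam k + lam (Suc k)"
proof -
  let ?v = "\<nu> (Suc k)"
  have q: "snd ?v > 0" and "\<Delta> k \<inter> \<Delta> (Suc k) = {of_int (fst ?v) / of_int (snd ?v)}"
    using upper_rays[of "Suc k"] assms by auto
  hence "(of_int (fst ?v) / of_int (snd ?v) :: rat) = of_int (lam k + lam (Suc k))"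
    using lam_jump[OF assms] by simp
  hence "(of_int (fst ?v) :: rat) = of_int ((lam k + lam (Suc k)) * snd ?v)"
    using q by (simp add: field_simps)
  hence eq: "fst ?v = (lam k + lam (Suc k)) * snd ?v" by (simp only: of_int_eq_iff)
  have "coprime (fst ?v) (snd ?v)" using prim by (simp add: primitive_def)
  hence "is_unit (snd ?v)" unfolding eq by (metis coprime_commute coprime_mult_right_iff coprime_self)
  thus "snd ?v = 1" using q by simp
  thus "fst ?v = lam k + lam (Suc k)" using eq by simp
qed

text \<open>
  The field shifts exponents by \<open>(0, - 1)\<close>. For rays with \<open>snd (\<nu> i) \<le> 0\<close> this shift is
  harmless. On a wall where the tuple changes, the coefficient on \<open>\<chi>\<^sup>w\<close> is, up to sign, the pairing of \<open>w\<close>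
  with the generator of height \<open>1\<close>: it vanishes exactly when the shift would leave the dual half-plane.
  At the remaining rays the field is zero.
\<close>

lemma wall_field_preserves:
  assumes "k < l"
  shows "(\<lambda>f. \<delta> (Suc k) f - \<delta> k f) \<in> vector_fields (cone_gen {\<nu> (Suc k)})"
proof (rule vector_fieldsI)
  show "derivation (\<lambda>f. \<delta> (Suc k) f - \<delta> k f)" by (intro derivation_diff derivation_trivializing_field)
  fix w assume "w \<in> dual_monoid (cone_gen {\<nu> (Suc k)})"
  hence w: "ipair w (\<nu> (Suc k)) \<ge> 0" by (simp add: dual_monoid_cone_gen)
  let ?n = "trivializing_coeff (a (Suc k)) (lam (Suc k)) w - trivializing_coeff (a k) (lam k) w"
  have eq: "\<delta> (Suc k) (chi w) - \<delta> k (chi w) = of_int ?n * chi (w + (0, - 1))"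
    by (simp add: trivializing_field_chi algebra_simps)
  have dual: "w + (0, - 1) \<in> dual_monoid (cone_gen {\<nu> (Suc k)}) \<longleftrightarrow> snd (\<nu> (Suc k)) \<le> ipair w (\<nu> (Suc k))"
    by (simp add: dual_monoid_cone_gen ipair_def algebra_simps)
  have "?n = 0 \<or> w + (0, - 1) \<in> dual_monoid (cone_gen {\<nu> (Suc k)})"
  proof (cases "k \<le> m")
    case False
    hence "snd (\<nu> (Suc k)) \<le> 0" using lower_rays[of "Suc k"] assms by simp
    thus ?thesis using w dual by simp
  next
    case True
    show ?thesis
    proof (cases "a (Suc k) = a k")
      case True thus ?thesis using lam_same[OF \<open>k \<le> m\<close>] by simp
    next
      case False
      note v = jump_ray[OF True False]
      have "?n = ipair w (\<nu> (Suc k)) \<or> ?n = - ipair w (\<nu> (Suc k))"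
        using a_sign[of k] a_sign[of "Suc k"] False assms
        by (auto simp: trivializing_coeff_def ipair_def v algebra_simps)
      thus ?thesis using w dual v by auto
    qed
  qed
  thus "\<delta> (Suc k) (chi w) - \<delta> k (chi w) \<in> toric_ring (cone_gen {\<nu> (Suc k)})"
    unfolding eq
  proof (elim disjE)
    assume "?n = 0"
    thus "of_int ?n * chi (w + (0, - 1)) \<in> toric_ring (cone_gen {\<nu> (Suc k)})"
      by (simp only: of_int_0 mult_zero_left toric_ring_closed(4))
  qed (rule toric_ring_of_int_chi)
qed

lemma d_section_eq:
  assumes "k < l"
  shows "d_section l m a lam (Suc k) = (\<lambda>f. \<delta> (Suc k) f - \<delta> k f)"
proof (cases "a (Suc k) = a k")
  case True
  show ?thesis
  proof (cases "Suc k \<in> {m + 2, l}")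
    case False
    have "lam (Suc k) = lam k"
    proof (cases "k \<le> m")
      case True thus ?thesis using lam_same \<open>a (Suc k) = a k\<close> by simp
    next
      case False
      hence "Suc m < k" "Suc k < l" using \<open>Suc k \<notin> {m + 2, l}\<close> assms by auto
      thus ?thesis using lower_a_lam by simp
    qed
    thus ?thesis using True False by (auto simp: d_section_def)
  next
    case 2: True
    show ?thesis using True 2 a_sign[of k] assms
      by (intro ext) (auto simp: d_section_def trivializing_field_def algebra_simps)
  qed
next
  case False
  thus ?thesis using a_sign[of k] a_sign[of "Suc k"] assms
    by (intro ext) (auto simp: d_section_def trivializing_field_def algebra_simps)
qed

text \<open>
  The dual basis, rotated by a quarter turn from the generators of the cone. By
  \<open>expand\<close>, an element of the dual monoid that vanishes on one ray is a nonnegative multiple of one of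
  these, and primitivity makes the multiple \<open>1\<close>.
\<close>

lemma w12_eq: "w1 \<nu> i = (snd (\<nu> (Suc i)), - fst (\<nu> (Suc i)))" "w2 \<nu> i = (- snd (\<nu> i), fst (\<nu> i))"
proof -
  let ?v = "\<nu> i" and ?v' = "\<nu> (Suc i)"
  have d: "fst ?v * snd ?v' - snd ?v * fst ?v' = 1" using det_1[of i] by (simp add: det2_def)
  have dual: "w \<in> dual_monoid (chart_cone \<nu> i) \<longleftrightarrow> ipair w ?v \<ge> 0 \<and> ipair w ?v' \<ge> 0" for w
    by (simp add: chart_cone_def dual_monoid_cone_gen)
  have vanish: "(\<forall>z\<in>cone_gen {v}. pairing w z = 0) \<longleftrightarrow> ipair w v = 0" for v w
  proof
    assume "\<forall>z\<in>cone_gen {v}. pairing w z = 0"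
    hence "pairing w (of_int (fst v), of_int (snd v)) = 0" using generator_in_cone[of "{v}" v] by simp
    hence "(of_int (ipair w v) :: rat) = 0" by (simp add: pairing_def ipair_def)
    thus "ipair w v = 0" by simp
  next
    assume "ipair w v = 0"
    hence "(of_int (ipair w v) :: rat) = 0" by simp
    hence "c * (of_int (fst w) * of_int (fst v) + of_int (snd w) * of_int (snd v)) = (0 :: rat)" for c
      by (simp add: ipair_def)
    thus "\<forall>z\<in>cone_gen {v}. pairing w z = 0" by (auto simp: cone_gen_single pairing_def algebra_simps)
  qed
  have expand: "w = (ipair w ?v * snd ?v' - ipair w ?v' * snd ?v, - ipair w ?v * fst ?v' + ipair w ?v' * fst ?v)" for w
  proof (rule prod_eqI)
    have "ipair w ?v * snd ?v' - ipair w ?v' * snd ?v = fst w * (fst ?v * snd ?v' - snd ?v * fst ?v')"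
      "- ipair w ?v * fst ?v' + ipair w ?v' * fst ?v = snd w * (fst ?v * snd ?v' - snd ?v * fst ?v')"
      by (simp_all add: ipair_def algebra_simps)
    thus "fst w = fst (ipair w ?v * snd ?v' - ipair w ?v' * snd ?v, - ipair w ?v * fst ?v' + ipair w ?v' * fst ?v)"
      "snd w = snd (ipair w ?v * snd ?v' - ipair w ?v' * snd ?v, - ipair w ?v * fst ?v' + ipair w ?v' * fst ?v)"
      using d by simp_all
  qed
  have unit: "n = 1" if "primitive (n * r, n * s)" "n \<ge> 0" for n r s :: int
  proof -
    have "n dvd n * r" "n dvd n * s" by simp_all
    hence "is_unit n" using that(1) coprime_common_divisor unfolding primitive_def by fastforce
    thus ?thesis using that(2) by simp
  qed
  show "w1 \<nu> i = (snd ?v', - fst ?v')" unfolding w1_def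
  proof (rule the_equality)
    show "primitive (snd ?v', - fst ?v') \<and> (snd ?v', - fst ?v') \<in> dual_monoid (chart_cone \<nu> i) \<and>
        (\<forall>z\<in>cone_gen {?v'}. pairing (snd ?v', - fst ?v') z = 0)"
      using prim[of "Suc i"] d unfolding dual vanish
      by (auto simp: primitive_def ipair_def coprime_commute algebra_simps)
  next
    fix w assume "primitive w \<and> w \<in> dual_monoid (chart_cone \<nu> i) \<and> (\<forall>z\<in>cone_gen {?v'}. pairing w z = 0)"
    hence w: "primitive w" "ipair w ?v \<ge> 0" "ipair w ?v' = 0" unfolding dual vanish by auto
    define n where "n = ipair w ?v"
    have e: "w = (n * snd ?v', n * - fst ?v')" using expand[of w] w(3) by (simp add: n_def)
    have "n \<ge> 0" using w(2) by (simp only: n_def)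
    hence "n = 1" by (rule unit[OF w(1)[unfolded e]])
    thus "w = (snd ?v', - fst ?v')" using e by simp
  qed
  show "w2 \<nu> i = (- snd ?v, fst ?v)" unfolding w2_def
  proof (rule the_equality)
    show "primitive (- snd ?v, fst ?v) \<and> (- snd ?v, fst ?v) \<in> dual_monoid (chart_cone \<nu> i) \<and>
        (\<forall>z\<in>cone_gen {?v}. pairing (- snd ?v, fst ?v) z = 0)"
      using prim[of i] d unfolding dual vanish
      by (auto simp: primitive_def ipair_def coprime_commute algebra_simps)
  next
    fix w assume "primitive w \<and> w \<in> dual_monoid (chart_cone \<nu> i) \<and> (\<forall>z\<in>cone_gen {?v}. pairing w z = 0)"
    hence w: "primitive w" "ipair w ?v' \<ge> 0" "ipair w ?v = 0" unfolding dual vanish by auto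
    define n where "n = ipair w ?v'"
    have e: "w = (n * - snd ?v, n * fst ?v)" using expand[of w] w(3) by (simp add: n_def)
    have "n \<ge> 0" using w(2) by (simp only: n_def)
    hence "n = 1" by (rule unit[OF w(1)[unfolded e]])
    thus "w = (- snd ?v, fst ?v)" using e by simp
  qed
qed

abbreviation "extra i \<equiv> (if i \<le> Suc m then {} else {u_fun})"

lemma dual_chart: "w \<in> dual_monoid (\<sigma> i) \<longleftrightarrow> ipair w (\<nu> i) \<ge> 0 \<and> ipair w (\<nu> (Suc i)) \<ge> 0"
  by (simp add: chart_cone_def dual_monoid_cone_gen)

lemma ipair_w12:
  "ipair (w1 \<nu> i) (\<nu> i) = 1" "ipair (w1 \<nu> i) (\<nu> (Suc i)) = 0"
  "ipair (w2 \<nu> i) (\<nu> i) = 0" "ipair (w2 \<nu> i) (\<nu> (Suc i)) = 1"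
  using det_1[of i] by (simp_all add: w12_eq ipair_def det2_def algebra_simps)

lemma ipair_add: "ipair (v + w) z = ipair v z + ipair w z"
  by (simp add: ipair_def algebra_simps)

lemma ipair_scale: "ipair (n * fst w, n * snd w) z = n * ipair w z"
  by (simp add: ipair_def algebra_simps)

lemma ipair_minus: "ipair (- w) z = - ipair w z"
  by (simp add: ipair_def)

lemma chart: assumes "i < l"
  shows "chart (a i) (lam i) (w1 \<nu> i) (w2 \<nu> i) (dual_monoid (\<sigma> i)) (extra i)"
proof
  show "a i = 1 \<or> a i = - 1" using a_sign assms by simp
  show "\<bar>det2 (w1 \<nu> i) (w2 \<nu> i)\<bar> = 1" using det_1[of i] by (simp add: w12_eq det2_def algebra_simps)
  show "w1 \<nu> i \<in> dual_monoid (\<sigma> i)" "w2 \<nu> i \<in> dual_monoid (\<sigma> i)" by (simp_all add: dual_chart ipair_w12)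
  show "extra i = {} \<or> extra i = {u_fun} \<and> a i = 1 \<and> lam i = 0 \<and> (0, - 1) \<in> dual_monoid (\<sigma> i)"
    using lower_a_lam[of i] lower_rays[of i] lower_rays[of "Suc i"] assms
    by (auto simp: dual_chart ipair_def)
next
  fix w assume w: "w \<in> dual_monoid (\<sigma> i)"
  let ?m = "ipair w (\<nu> i)" and ?n = "ipair w (\<nu> (Suc i))"
  have d: "fst (\<nu> i) * snd (\<nu> (Suc i)) - snd (\<nu> i) * fst (\<nu> (Suc i)) = 1" using det_1[of i] by (simp add: det2_def)
  have "?m * snd (\<nu> (Suc i)) - ?n * snd (\<nu> i) = fst w * (fst (\<nu> i) * snd (\<nu> (Suc i)) - snd (\<nu> i) * fst (\<nu> (Suc i)))"
      "- ?m * fst (\<nu> (Suc i)) + ?n * fst (\<nu> i) = snd w * (fst (\<nu> i) * snd (\<nu> (Suc i)) - snd (\<nu> i) * fst (\<nu> (Suc i)))"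
      by (simp_all add: ipair_def algebra_simps)
  hence "w = (?m * fst (w1 \<nu> i), ?m * snd (w1 \<nu> i)) + (?n * fst (w2 \<nu> i), ?n * snd (w2 \<nu> i))"
    unfolding d w12_eq by (intro prod_eqI) simp_all
  moreover have "int (nat ?m) = ?m" "int (nat ?n) = ?n" using w by (simp_all add: dual_chart)
  ultimately show "\<exists>m n. w = (int m * fst (w1 \<nu> i), int m * snd (w1 \<nu> i)) + (int n * fst (w2 \<nu> i), int n * snd (w2 \<nu> i))"
    by metis
qed (simp_all add: dual_monoid_0 dual_monoid_add)

lemma chart_rings: assumes "i < l"
  shows "chart.A (a i) (lam i) (w1 \<nu> i) (w2 \<nu> i) (extra i) = ring i"
    "chart.A0 (dual_monoid (\<sigma> i)) = toric_ring (\<sigma> i)"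
  by (simp_all add: chart.A_def[OF chart[OF assms]] chart.A0_def[OF chart[OF assms]] A_tilde_def toric_ring_eq)

text \<open>
  The rays through the slice are treated by \<open>localization_character\<close> and \<open>wall_ring_eq\<close>, the others by
  \<open>localization_pole\<close>, whose right-hand side is the same for both charts.
\<close>

lemma common_localization:
  assumes "Suc k < l"
  shows "\<exists>g\<in>ring k. \<exists>h\<in>ring (Suc k). at_t0 g \<noteq> 0 \<and> at_t0 h \<noteq> 0 \<and>
    localization (ring k) g = localization (ring (Suc k)) h"
proof -
  have k: "k < l" using assms by simp
  interpret C: chart "a k" "lam k" "w1 \<nu> k" "w2 \<nu> k" "dual_monoid (\<sigma> k)" "extra k" by (rule chart[OF k])
  interpret C': chart "a (Suc k)" "lam (Suc k)" "w1 \<nu> (Suc k)" "w2 \<nu> (Suc k)" "dual_monoid (\<sigma> (Suc k))" "extra (Suc k)"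
    by (rule chart[OF assms])
  define W where "W = {w. ipair w (\<nu> (Suc k)) \<ge> 0}"
  have sub: "dual_monoid (\<sigma> k) \<subseteq> W" "dual_monoid (\<sigma> (Suc k)) \<subseteq> W" by (auto simp: W_def dual_chart)
  have neg: "- w1 \<nu> k \<in> W" "- w2 \<nu> (Suc k) \<in> W" by (simp_all add: W_def ipair_minus ipair_w12)
  have shift: "\<exists>n. w + (int n * fst (w1 \<nu> k), int n * snd (w1 \<nu> k)) \<in> dual_monoid (\<sigma> k)" if "w \<in> W" for w
    using that by (intro exI[of _ "nat (- ipair w (\<nu> k))"])
      (auto simp: W_def dual_chart ipair_add ipair_scale ipair_w12)
  have shift': "\<exists>n. w + (int n * fst (w2 \<nu> (Suc k)), int n * snd (w2 \<nu> (Suc k))) \<in> dual_monoid (\<sigma> (Suc k))"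
    if "w \<in> W" for w
    using that by (intro exI[of _ "nat (- ipair w (\<nu> (Suc (Suc k))))"])
      (auto simp: W_def dual_chart ipair_add ipair_scale ipair_w12)
  show ?thesis
  proof (cases "k \<le> m")
    case True
    have ring_eq: "alg_gen (insert t_var (Z_tilde (a k) (lam k) ` W)) =
        alg_gen (insert t_var (Z_tilde (a (Suc k)) (lam (Suc k)) ` W))"
    proof (cases "a (Suc k) = a k")
      case True thus ?thesis using lam_same[OF \<open>k \<le> m\<close>] by simp
    next
      case False
      note v = jump_ray[OF True False]
      have "a (Suc k) = - a k" using False C.a C'.a by auto
      moreover have "W = {w. fst (\<nu> (Suc k)) * fst w + snd w \<ge> 0}" by (simp add: W_def ipair_def v mult.commute)
      ultimately show ?thesis using wall_ring_eq[OF C.a v(2), of W] by simp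
    qed
    have "localization C.A (Z_tilde (a k) (lam k) (w1 \<nu> k)) = alg_gen (insert t_var (Z_tilde (a k) (lam k) ` W))"
      by (rule C.localization_character[OF _ C.w12(1) sub(1) neg(1) shift]) (use True in simp)
    moreover have "localization C'.A (Z_tilde (a (Suc k)) (lam (Suc k)) (w2 \<nu> (Suc k))) =
        alg_gen (insert t_var (Z_tilde (a (Suc k)) (lam (Suc k)) ` W))"
      by (rule C'.localization_character[OF _ C'.w12(2) sub(2) neg(2) shift']) (use True in simp)
    ultimately have "localization C.A (Z_tilde (a k) (lam k) (w1 \<nu> k)) =
        localization C'.A (Z_tilde (a (Suc k)) (lam (Suc k)) (w2 \<nu> (Suc k)))"
      using ring_eq by simp
    moreover have "Z_tilde (a k) (lam k) (w1 \<nu> k) \<in> C.A" "Z_tilde (a (Suc k)) (lam (Suc k)) (w2 \<nu> (Suc k)) \<in> C'.A"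
      using C.Z_in_A C'.Z_in_A C.w12 C'.w12 by auto
    ultimately show ?thesis unfolding chart_rings(1)[OF k] chart_rings(1)[OF assms]
      by (metis Z_tilde_expand(2) chi_nonzero)
  next
    case False
    have pole: "(0, - 1) \<in> W" using lower_rays[of "Suc k"] False assms by (simp add: W_def ipair_def)
    show ?thesis
      using C.localization_pole[OF C.w12(1) sub(1) neg(1) pole shift]
        C'.localization_pole[OF C'.w12(2) sub(2) neg(2) pole shift']
      unfolding chart_rings(1)[OF k] chart_rings(1)[OF assms] by metis
  qed
qed

text \<open>
  The transition cocycle of the natural trivializations.
\<close>

definition ks_field :: "nat \<Rightarrow> nat \<Rightarrow> ratfun \<Rightarrow> ratfun" where
  "ks_field i j = (if i < l \<and> j < l then (\<lambda>f. \<delta> j f - \<delta> i f) else (\<lambda>f. 0))"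

text \<open>
  For charts meeting only in the origin there is nothing to preserve beyond the Laurent
  polynomials; otherwise the charts are consecutive and the field is that of the wall between them.
\<close>

lemma ks_field_preserves: assumes "i < l" "j < l" shows "(\<lambda>f. \<delta> j f - \<delta> i f) \<in> vector_fields (\<sigma> i \<inter> \<sigma> j)"
proof -
  have mod: "i mod l = i" "j mod l = j" using assms by simp_all
  have \<delta>_mod: "\<delta> (n mod l) = \<delta> n" for n by (simp add: a_lam_mod)
  consider "\<sigma> i \<inter> \<sigma> j = {(0, 0)}" | "i = j" | "\<sigma> i \<inter> \<sigma> j = cone_gen {\<nu> (Suc i)}" "Suc i mod l = j"
    | "\<sigma> i \<inter> \<sigma> j = cone_gen {\<nu> (Suc j)}" "Suc j mod l = i"
    using cone_inter[of i j] mod by metis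
  thus ?thesis
  proof cases
    case 1
    show ?thesis unfolding 1
    proof (rule vector_fieldsI)
      show "derivation (\<lambda>f. \<delta> j f - \<delta> i f)" by (intro derivation_diff derivation_trivializing_field)
      fix w
      have "w + (0, - 1) \<in> dual_monoid {(0, 0)}" by (simp add: dual_monoid_def pairing_def)
      from toric_ring_of_int_chi[OF this, of "trivializing_coeff (a j) (lam j) w - trivializing_coeff (a i) (lam i) w"]
      show "\<delta> j (chi w) - \<delta> i (chi w) \<in> toric_ring {(0, 0)}"
        by (simp add: trivializing_field_chi algebra_simps)
    qed
  next
    case 2 thus ?thesis using vector_fields_0 by simp
  next
    case 3
    thus ?thesis using wall_field_preserves[OF assms(1)] \<delta>_mod[of "Suc i"] by simp
  next
    case 4
    thus ?thesis using vector_fields_uminus[OF wall_field_preserves[OF assms(2)]] \<delta>_mod[of "Suc j"] by simp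
  qed
qed

lemma ks_field_cocycle: "ks_field \<in> cech_cocycles l \<sigma>"
  unfolding cech_cocycles_def using ks_field_preserves by (auto simp: ks_field_def)

lemma ks_field_degree: assumes "i < l" "j < l" shows "has_degree (- R_deg) (ks_field i j)"
proof -
  let ?c = "\<lambda>i. if a i = 1 then - lam i else lam i" and ?e = "\<lambda>i. if a i = 1 then 0 else 1 :: int"
  have \<delta>: "\<delta> i f = inverse y_var * (of_int (?c i) * x_var * partial_x f + of_int (?e i) * y_var * partial_y f)" for i f
    by (simp add: trivializing_field_def field_simps)
  have "ks_field i j = (\<lambda>f. chi (- R_deg) * (const_xy (of_int (?c j - ?c i)) * x_var * partial_x f +
      const_xy (of_int (?e j - ?e i)) * y_var * partial_y f))"
    unfolding const_xy_of_int of_int_diff ks_field_def \<delta>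
    using assms by (simp add: chi_def R_deg_def power_int_minus algebra_simps)
  thus ?thesis unfolding has_degree_def by blast
qed

lemma ks_field_induced: "induced_by l \<sigma> (d_section l m a lam) ks_field"
  "induced_by l \<sigma> (d_section l m a lam) D \<Longrightarrow> D = ks_field"
proof -
  have adj: "d_section l m a lam k = ks_field (k - 1) (k mod l)" if "k \<in> {1..l}" for k
  proof -
    have "k - 1 < l" "k mod l < l" "Suc (k - 1) = k" using that l_pos by auto
    thus ?thesis using d_section_eq[of "k - 1"] by (simp add: ks_field_def a_lam_mod)
  qed
  thus "induced_by l \<sigma> (d_section l m a lam) ks_field" using ks_field_cocycle by (simp add: induced_by_def)
  assume D: "induced_by l \<sigma> (d_section l m a lam) D"
  have "D i j f = ks_field i j f" for i j f
  proof (cases "i < l \<and> j < l")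
    case True
    show ?thesis
    proof (rule cocycle_identity_determined[of l D ks_field])
      fix k f assume k: "Suc k < l"
      hence "D (Suc k - 1) (Suc k mod l) = d_section l m a lam (Suc k)"
        using D unfolding induced_by_def by (metis One_nat_def Suc_leI atLeastAtMost_iff less_imp_le zero_less_Suc)
      also have "\<dots> = ks_field (Suc k - 1) (Suc k mod l)" using adj[of "Suc k"] k by simp
      finally show "D k (Suc k) f = ks_field k (Suc k) f" using k by simp
    qed (use True D ks_field_cocycle in \<open>auto simp: induced_by_def cech_cocycles_def\<close>)
  next
    case False
    thus ?thesis using D by (auto simp: induced_by_def cech_cocycles_def ks_field_def)
  qed
  thus "D = ks_field" by blast
qed

lemma localized_chart:
  assumes i: "i < l" and D: "derivation D" and \<theta>: "\<And>f. f \<in> ring i \<Longrightarrow> \<theta> f = id_plus_t D (jet f)"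
    and g: "g \<in> ring i" "at_t0 g \<noteq> 0" "b \<in> localization (ring i) g"
  shows "localized (ring i) \<theta> g b = id_plus_t D (jet b)"
  using localized_eq[OF _ D \<theta> g] chart.A_reg[OF chart[OF i]] chart_rings(1)[OF i] by simp

lemma ks_field_is_KS_class: "is_KS_class l \<sigma> ring (cech_class l \<sigma> ks_field)"
proof -
  define \<theta> where "\<theta> i f = id_plus_t (\<delta> i) (jet f)" for i f
  have "trivialization (toric_ring (\<sigma> i)) (ring i) (\<theta> i)" if "i < l" for i
    using chart.standard_trivialization[OF chart[OF that]] unfolding chart_rings[OF that] \<theta>_def .
  moreover have "transition_cocycle l \<sigma> ring \<theta> ks_field"
    unfolding transition_cocycle_def
  proof (intro conjI ks_field_cocycle allI impI ballI)
    fix i j g h b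
    assume ij: "i < l" "j < l" and gh: "g \<in> ring i" "h \<in> ring j"
      and *: "at_t0 g \<noteq> 0 \<and> at_t0 h \<noteq> 0 \<and> localization (ring i) g = localization (ring j) h"
      and b: "b \<in> localization (ring i) g"
    have "localized (ring i) (\<theta> i) g b = id_plus_t (\<delta> i) (jet b)"
      using * b by (intro localized_chart ij gh derivation_trivializing_field) (auto simp: \<theta>_def)
    moreover have "localized (ring j) (\<theta> j) h b = id_plus_t (\<delta> j) (jet b)"
      using * b by (intro localized_chart ij gh derivation_trivializing_field) (auto simp: \<theta>_def)
    ultimately show "localized (ring j) (\<theta> j) h b = id_plus_t (ks_field i j) (localized (ring i) (\<theta> i) g b)"
      using ij by (simp add: id_plus_t_jet ks_field_def) (simp add: id_plus_t_def)
  qed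
  ultimately show ?thesis unfolding is_KS_class_def by blast
qed

text \<open>
  In terms of the fields \<open>\<epsilon> i = e i + \<delta> i\<close>, the gluing condition over a common localization of two
  consecutive charts reads \<open>D = \<epsilon> (k + 1) - \<epsilon> k\<close> on the restrictions to \<open>t = 0\<close>. These contain the
  characters of one chart, which determine a derivation. So \<open>D\<close> differs from \<open>ks_field\<close> by the
  coboundary of \<open>e\<close>.
\<close>

lemma KS_class_unique:
  assumes "is_KS_class l \<sigma> ring c" shows "c = cech_class l \<sigma> ks_field"
proof -
  obtain \<theta> D where triv: "\<And>i. i < l \<Longrightarrow> trivialization (toric_ring (\<sigma> i)) (ring i) (\<theta> i)"
    and trans: "transition_cocycle l \<sigma> ring \<theta> D" and c: "c = cech_class l \<sigma> D"
    using assms by (auto simp: is_KS_class_def)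
  have D: "D \<in> cech_cocycles l \<sigma>" using trans by (simp add: transition_cocycle_def)
  have "\<exists>e. e \<in> vector_fields (\<sigma> i) \<and> (\<forall>f\<in>ring i. \<theta> i f = id_plus_t (\<lambda>f. e f + \<delta> i f) (jet f))"
    if i: "i < l" for i
  proof -
    obtain e where e: "derivation e" "\<And>f. f \<in> ring i \<Longrightarrow> \<theta> i f = id_plus_t (\<lambda>f. e f + \<delta> i f) (jet f)"
      "e ` toric_ring (\<sigma> i) \<subseteq> toric_ring (\<sigma> i)"
      using chart.trivialization_form[OF chart[OF i], unfolded chart_rings[OF i], OF triv[OF i]] by metis
    thus ?thesis unfolding vector_fields_def by (intro exI[of _ e]) simp
  qed
  then obtain e where e: "\<And>i. i < l \<Longrightarrow> e i \<in> vector_fields (\<sigma> i)"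
    and \<theta>: "\<And>i f. i < l \<Longrightarrow> f \<in> ring i \<Longrightarrow> \<theta> i f = id_plus_t (\<lambda>f. e i f + \<delta> i f) (jet f)"
    by metis
  define \<epsilon> where "\<epsilon> i = (\<lambda>f. e i f + \<delta> i f)" for i
  have \<epsilon>: "derivation (\<epsilon> i)" if "i < l" for i
    unfolding \<epsilon>_def using e[OF that] derivation_trivializing_field by (intro derivation_plus) (simp_all add: vector_fields_def)
  have adj: "D k (Suc k) f = \<epsilon> (Suc k) f - \<epsilon> k f" if k': "Suc k < l" for k f
  proof -
    have k: "k < l" using k' by simp
    obtain g h where gh: "g \<in> ring k" "h \<in> ring (Suc k)" "at_t0 g \<noteq> 0" "at_t0 h \<noteq> 0"
      "localization (ring k) g = localization (ring (Suc k)) h"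
      using common_localization[OF k'] by blast
    have eq: "D k (Suc k) (at_t0 b) = \<epsilon> (Suc k) (at_t0 b) - \<epsilon> k (at_t0 b)" if "b \<in> ring k" for b
    proof -
      have b: "b \<in> localization (ring k) g"
        using that unfolding localization_def by (intro CollectI exI[of _ b] exI[of _ 0]) simp
      have "localized (ring k) (\<theta> k) g b = id_plus_t (\<epsilon> k) (jet b)"
        using gh b \<theta>[OF k] by (intro localized_chart k \<epsilon>) (auto simp: \<epsilon>_def)
      moreover have "localized (ring (Suc k)) (\<theta> (Suc k)) h b = id_plus_t (\<epsilon> (Suc k)) (jet b)"
        using gh b \<theta>[OF k'] by (intro localized_chart k' \<epsilon>) (auto simp: \<epsilon>_def)
      moreover have "localized (ring (Suc k)) (\<theta> (Suc k)) h b =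
          id_plus_t (D k (Suc k)) (localized (ring k) (\<theta> k) g b)"
        using trans gh b k k' unfolding transition_cocycle_def by blast
      ultimately have "id_plus_t (\<epsilon> (Suc k)) (jet b) = id_plus_t (D k (Suc k)) (id_plus_t (\<epsilon> k) (jet b))"
        by simp
      thus ?thesis unfolding id_plus_t_jet by (simp add: id_plus_t_def algebra_simps)
    qed
    interpret C: chart "a k" "lam k" "w1 \<nu> k" "w2 \<nu> k" "dual_monoid (\<sigma> k)" "extra k" by (rule chart[OF k])
    have "D k (Suc k) = (\<lambda>f. \<epsilon> (Suc k) f - \<epsilon> k f)"
    proof (rule C.derivation_eq_chart)
      show "derivation (D k (Suc k))" using D k k' by (auto simp: cech_cocycles_def vector_fields_def)
      show "derivation (\<lambda>f. \<epsilon> (Suc k) f - \<epsilon> k f)" using \<epsilon> k k' by (intro derivation_diff)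
      show "D k (Suc k) (chi (w1 \<nu> k)) = \<epsilon> (Suc k) (chi (w1 \<nu> k)) - \<epsilon> k (chi (w1 \<nu> k))"
        using eq[of "Z_tilde (a k) (lam k) (w1 \<nu> k)"] C.Z_in_A[OF C.w12(1)]
        by (simp add: chart_rings[OF k] Z_tilde_expand)
      show "D k (Suc k) (chi (w2 \<nu> k)) = \<epsilon> (Suc k) (chi (w2 \<nu> k)) - \<epsilon> k (chi (w2 \<nu> k))"
        using eq[of "Z_tilde (a k) (lam k) (w2 \<nu> k)"] C.Z_in_A[OF C.w12(2)]
        by (simp add: chart_rings[OF k] Z_tilde_expand)
    qed
    thus ?thesis by simp
  qed
  have "D i j f = \<epsilon> j f - \<epsilon> i f" if "i < l" "j < l" for i j f
    by (rule cocycle_identity_determined[of l D "\<lambda>i j f. \<epsilon> j f - \<epsilon> i f"])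
      (use D adj that in \<open>auto simp: cech_cocycles_def\<close>)
  hence "D i j f - ks_field i j f = e j f - e i f" if "i < l" "j < l" for i j f
    using that by (simp add: ks_field_def \<epsilon>_def algebra_simps)
  hence "(ks_field, D) \<in> cohomologous l \<sigma>" by (intro cohomologousI[of _ _ _ _ e] ks_field_cocycle D e)
  thus ?thesis using c cohomologous_class_eq by simp
qed

end

theorem theorem2p2:
  fixes \<Sigma> :: "(rat \<times> rat) set set" and l m :: nat
    and \<nu> :: "nat \<Rightarrow> int \<times> int" and \<Delta> :: "nat \<Rightarrow> rat set"
    and a lam :: "nat \<Rightarrow> int" and lam0 :: int
  assumes "fan \<Sigma>" and "complete_fan \<Sigma>" and "smooth_fan \<Sigma>"
    and "ccw_ray_generators \<Sigma> l \<nu>"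
    and "slice_segments \<Sigma> m \<Delta>"
    and "slice (cone_gen {\<nu> 1}) = \<Delta> 0 \<inter> \<Delta> 1"
    and "admissible_tuple m \<Delta> a"
    and "shifts l m \<Delta> lam0 a lam"
  shows "let \<sigma> = chart_cone \<nu>;
             A = A_tilde m \<nu> a lam;
             d = d_section l m a lam
         in (\<forall>i\<in>{1..l}. d i \<in> vector_fields (cone_gen {\<nu> i})) \<and>
            (\<exists>!D. induced_by l \<sigma> d D) \<and>
            (\<exists>!c. is_KS_class l \<sigma> A c) \<and>
            KS_class l \<sigma> A = cech_class l \<sigma> (induced_cocycle l \<sigma> d) \<and>
            KS_class l \<sigma> A \<in> cech_H1_degree l \<sigma> (- R_deg)"
proof -
  interpret deformation \<Sigma> l \<nu> m \<Delta> a lam lam0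
    by unfold_locales (fact assms)+
  let ?d = "d_section l m a lam"
  have d: "?d i \<in> vector_fields (cone_gen {\<nu> i})" if "i \<in> {1..l}" for i
  proof -
    have "i - 1 < l" "Suc (i - 1) = i" using that by auto
    thus ?thesis using wall_field_preserves[of "i - 1"] d_section_eq[of "i - 1"] by simp
  qed
  have ind: "\<exists>!D. induced_by l \<sigma> ?d D" and cocycle: "induced_cocycle l \<sigma> ?d = ks_field"
    unfolding induced_cocycle_def using ks_field_induced by (blast, intro the_equality)
  have ks: "\<exists>!c. is_KS_class l \<sigma> ring c" and cls: "KS_class l \<sigma> ring = cech_class l \<sigma> ks_field"
    unfolding KS_class_def using ks_field_is_KS_class KS_class_unique by (blast, intro the_equality)
  have "(ks_field, ks_field) \<in> cohomologous l \<sigma>"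
    by (rule cohomologousI[of _ _ _ _ "\<lambda>_ _. 0"]) (simp_all add: ks_field_cocycle vector_fields_0)
  hence "ks_field \<in> cech_class l \<sigma> ks_field" "cech_class l \<sigma> ks_field \<in> cech_H1 l \<sigma>"
    using ks_field_cocycle by (auto simp: cech_class_def cech_H1_def intro: quotientI)
  hence "cech_class l \<sigma> ks_field \<in> cech_H1_degree l \<sigma> (- R_deg)"
    using ks_field_degree unfolding cech_H1_degree_def by blast
  thus ?thesis using d ind cocycle ks cls by (simp add: Let_def)
qed

end
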